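(* Let $p$ be a prime, let $\Bbbk$ be any field of characteristic $p$, let $m$ be any positive integer, and let $\mu$ be any $(d-1)$-dimensional simplicial cycle over $\Bbbk$ with support $|\mu|$. Assume that for every face $\tau$ of $|\mu|$ with $0<|\tau|<d$ the link satisfies $$\tilde H_{d-1-|\tau|}(\mathrm{lk}_\tau|\mu|;\Bbbk)\cong \Bbbk .$$ Then there exist a field extension $\Bbbk'$ of $\Bbbk$ and a linear system of parameters $\Theta=(\theta_1,\dots,\theta_d)$ of the face ring $\Bbbk'[|\mu|]$ such that the corresponding Artinian reduction $\mathcal A^*(|\mu|)=\Bbbk'[|\mu|]/(\Theta)$ is $pm$-anisotropic, i.e. for every integer $0\le k\le \frac{d}{pm}$ and every nonzero element $u\in\mathcal B^k(\mu)$ of the Gorensteinification one has $$u^{pm}\neq 0 \quad\text{in } \mathcal B^{pmk}(\mu).$$ Moreover, the coefficients of the linear system of parameters can be chosen along the moment curve, i.e. $\Theta$ can be chosen so that there are elements $t_v\in\Bbbk'$, one for each vertex $v$ of $|\mu|$, with $\theta_i=\sum_v t_v^{\,i}x_v$ for $i=1,\dots,d$.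
   Context: $|\tau|$ denotes the cardinality of a face $\tau$, and $\tilde H$ is reduced simplicial homology. A $(d-1)$-dimensional simplicial cycle $\mu$ over $\Bbbk$ is a nonzero simplicial $(d-1)$-chain on a finite vertex set with coefficients in $\Bbbk$ and zero boundary (reduced, i.e. augmented, chain complex). Its support $|\mu|$ is the minimal simplicial complex containing $\mu$: the complex generated by the $d$-element faces with nonzero coefficient. For a field extension $\Bbbk'\supseteq\Bbbk$, $\mu$ is also regarded as a cycle over $\Bbbk'$. The link of $\tau$ is $\mathrm{lk}_\tau|\mu|=\{\rho:\rho\cap\tau=\emptyset,\ \rho\cup\tau\in|\mu|\}$. The face ring $\Bbbk'[\varDelta]$ of a simplicial complex $\varDelta$ is the polynomial ring over $\Bbbk'$ in variables $x_v$ ($v$ a vertex of $\varDelta$) modulo the ideal generated by the squarefree monomials $\prod_{v\in S}x_v$ with $S\notin\varDelta$, graded with $\deg x_v=1$. A linear system of parameters for $\varDelta$ of dimension $d-1$ is a sequence $\Theta=(\theta_1,\dots,\theta_d)$ of linear forms with $\Bbbk'[\varDelta]/(\Theta)$ finite-dimensional over $\Bbbk'$; this quotient is the Artinian reduction $\mathcal A^*(\varDelta)$. Writing $\theta_i=\sum_v a_{i,v}x_v$, let $\mathbf V=(a_{i,v})$, and for a $d$-element face $F$ let $\mathbf V_{|F}$ be the $d\times d$ submatrix with columns indexed by $F$ (in a fixed total order of the vertices). Gorensteinification: there is a surjective $\Bbbk'$-linear map $\deg:\mathcal A^d(|\mu|)\to\Bbbk'$ determined by $\deg(x_F)=\mu_F/\det(\mathbf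 V_{|F})$ for every facet $F$ of $|\mu|$ with $|F|=d$, where $x_F=\prod_{v\in F}x_v$ and $\mu_F$ is the coefficient of $\mu$ on $F$ oriented by the vertex order (it is the map $\mathcal A^d(|\mu|)\cong H^{d-1}(|\mu|;\Bbbk')\twoheadrightarrow \Bbbk'\mu^\vee\cong\Bbbk'$ dual to $\Bbbk'\mu\hookrightarrow H_{d-1}(|\mu|;\Bbbk')$). Let $L^k\subset\mathcal A^k(|\mu|)$ be the subspace of elements $a$ with $\deg(ab)=0$ for all $b\in\mathcal A^{d-k}(|\mu|)$, and $L=\bigoplus_kL^k$. Then $\mathcal B^*(\mu):=\mathcal A^*(|\mu|)/L$. *)

theory Defs
  imports
    "HOL-Algebra.Algebra"
    "HOL-Algebra.Algebraic_Closure_Type"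
    "HOL-Library.Poly_Mapping"
    "HOL-Computational_Algebra.Computational_Algebra"
    "Jordan_Normal_Form.Determinant"
begin

hide_const (open) Divisibility.prime

section \<open>Simplicial chains and reduced homology\<close>

text \<open>
  Faces are finite sets of vertices; the linear order on the type of vertices orients them.
  Chains are finitely supported functions on faces.  The empty face has dimension \<open>-1\<close>, so that
  the chain complex is the augmented one and homology is reduced.
\<close>

definition chains :: "'v set set \<Rightarrow> int \<Rightarrow> ('v set \<Rightarrow>\<^sub>0 'k::field) set" where
  "chains \<Delta> i = {c. \<forall>F \<in> Poly_Mapping.keys c. F \<in> \<Delta> \<and> finite F \<and> int (card F) = i + 1}"

definition boundary :: "('v::linorder set \<Rightarrow>\<^sub>0 'k::field) \<Rightarrow> ('v set \<Rightarrow>\<^sub>0 'k)" where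
  "boundary c = (\<Sum>F \<in> Poly_Mapping.keys c. \<Sum>v \<in> F.
     Poly_Mapping.single (F - {v}) ((-1) ^ card {w \<in> F. w < v} * Poly_Mapping.lookup c F))"

definition simplicial_cycle :: "int \<Rightarrow> ('v::linorder set \<Rightarrow>\<^sub>0 'k::field) \<Rightarrow> bool" where
  "simplicial_cycle i \<mu> \<longleftrightarrow> \<mu> \<noteq> 0 \<and> \<mu> \<in> chains UNIV i \<and> boundary \<mu> = 0"

definition chain_support :: "('v set \<Rightarrow>\<^sub>0 'k::field) \<Rightarrow> 'v set set" where
  "chain_support \<mu> = {G. \<exists>F \<in> Poly_Mapping.keys \<mu>. G \<subseteq> F}"

definition link :: "'v set \<Rightarrow> 'v set set \<Rightarrow> 'v set set" where
  "link \<tau> \<Delta> = {\<rho>. \<rho> \<inter> \<tau> = {} \<and> \<rho> \<union> \<tau> \<in> \<Delta>}"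

text \<open>
  Vector spaces are records of type \<^typ>\<open>('k, 'a) module\<close>, in which the fields for the
  multiplication and the unit are not used.
\<close>

definition scalar_module :: "('k::field, 'k) module" where
  "scalar_module = \<lparr>carrier = UNIV, monoid.mult = (*), one = 1, ring.zero = 0, add = (+),
     module.smult = (*)\<rparr>"

definition cycle_module :: "'v::linorder set set \<Rightarrow> int \<Rightarrow> ('k::field, 'v set \<Rightarrow>\<^sub>0 'k) module" where
  "cycle_module \<Delta> i = \<lparr>carrier = {c \<in> chains \<Delta> i. boundary c = 0},
     monoid.mult = undefined, one = undefined, ring.zero = 0, add = (+),
     module.smult = (\<lambda>a. Poly_Mapping.map ((*) a))\<rparr>"

definition boundaries :: "'v::linorder set set \<Rightarrow> int \<Rightarrow> ('v set \<Rightarrow>\<^sub>0 'k::field) set" where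
  "boundaries \<Delta> i = boundary ` chains \<Delta> (i + 1)"

definition quotient_module :: "('k, 'a) module \<Rightarrow> 'a set \<Rightarrow> ('k, 'a set) module" where
  "quotient_module M N = \<lparr>carrier = a_rcosets\<^bsub>M\<^esub> N,
     monoid.mult = undefined, one = undefined, ring.zero = N, add = set_add M,
     module.smult = (\<lambda>a C. N <+>\<^bsub>M\<^esub> (\<lambda>x. a \<odot>\<^bsub>M\<^esub> x) ` C)\<rparr>"

definition reduced_homology ::
    "'v::linorder set set \<Rightarrow> int \<Rightarrow> ('k::field, ('v set \<Rightarrow>\<^sub>0 'k) set) module" where
  "reduced_homology \<Delta> i = quotient_module (cycle_module \<Delta> i) (boundaries \<Delta> i)"

definition linearly_isomorphic ::
    "('k::field, 'a) module \<Rightarrow> ('k, 'b) module \<Rightarrow> bool" where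
  "linearly_isomorphic M N \<longleftrightarrow>
     (\<exists>f \<in> iso (add_monoid M) (add_monoid N).
        \<forall>a. \<forall>x \<in> carrier M. f (a \<odot>\<^bsub>M\<^esub> x) = a \<odot>\<^bsub>N\<^esub> f x)"


section \<open>Face rings\<close>

text \<open>
  The coefficient field of a face ring is a subfield \<open>K\<close> of a field given by a type \<open>'l\<close>.
\<close>

type_synonym ('v, 'l) mpoly = "('v \<Rightarrow>\<^sub>0 nat) \<Rightarrow>\<^sub>0 'l"

definition Var :: "'v \<Rightarrow> ('v, 'l::field) mpoly" where
  "Var v = Poly_Mapping.single (Poly_Mapping.single v 1) 1"

definition Const :: "'l \<Rightarrow> ('v, 'l::field) mpoly" where
  "Const c = Poly_Mapping.single 0 c"

definition poly_ring :: "'l::field set \<Rightarrow> 'v set \<Rightarrow> ('v, 'l) mpoly ring" where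
  "poly_ring K V = ring_of_type_algebra
     \<lparr>carrier := {p. range (Poly_Mapping.lookup p) \<subseteq> K \<and> (\<forall>m \<in> Poly_Mapping.keys p. Poly_Mapping.keys m \<subseteq> V)}\<rparr>"

definition hom_polys :: "'l::field set \<Rightarrow> 'v set \<Rightarrow> nat \<Rightarrow> ('v, 'l) mpoly set" where
  "hom_polys K V k = {p \<in> carrier (poly_ring K V).
     \<forall>m \<in> Poly_Mapping.keys p. (\<Sum>v \<in> Poly_Mapping.keys m. Poly_Mapping.lookup m v) = k}"

definition face_monomial :: "'v set \<Rightarrow> ('v, 'l::field) mpoly" where
  "face_monomial S = (\<Prod>v \<in> S. Var v)"

definition face_ideal :: "'l::field set \<Rightarrow> 'v set set \<Rightarrow> ('v, 'l) mpoly set" where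
  "face_ideal K \<Delta> = genideal (poly_ring K (\<Union>\<Delta>)) (face_monomial ` {S. S \<subseteq> \<Union>\<Delta> \<and> S \<notin> \<Delta>})"

definition face_ring :: "'l::field set \<Rightarrow> 'v set set \<Rightarrow> ('v, 'l) mpoly set ring" where
  "face_ring K \<Delta> = poly_ring K (\<Union>\<Delta>) Quot face_ideal K \<Delta>"

definition to_face_ring ::
    "'l::field set \<Rightarrow> 'v set set \<Rightarrow> ('v, 'l) mpoly \<Rightarrow> ('v, 'l) mpoly set" where
  "to_face_ring K \<Delta> p = face_ideal K \<Delta> +>\<^bsub>poly_ring K (\<Union>\<Delta>)\<^esub> p"


section \<open>Artinian reductions\<close>

text \<open>
  A sequence of \<open>d\<close> linear forms is given by its coefficients \<open>a i v\<close>, where \<open>i\<close> ranges over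
  \<open>{1..d}\<close> and \<open>v\<close> over the vertices.
\<close>

definition linear_form ::
    "'l::field set \<Rightarrow> 'v set set \<Rightarrow> ('v \<Rightarrow> 'l) \<Rightarrow> ('v, 'l) mpoly set" where
  "linear_form K \<Delta> c = to_face_ring K \<Delta> (\<Sum>v \<in> \<Union>\<Delta>. Const (c v) * Var v)"

definition theta_ideal ::
    "'l::field set \<Rightarrow> 'v set set \<Rightarrow> nat \<Rightarrow> (nat \<Rightarrow> 'v \<Rightarrow> 'l) \<Rightarrow> ('v, 'l) mpoly set set" where
  "theta_ideal K \<Delta> d a = genideal (face_ring K \<Delta>) ((\<lambda>i. linear_form K \<Delta> (a i)) ` {1..d})"

definition artin_ring ::
    "'l::field set \<Rightarrow> 'v set set \<Rightarrow> nat \<Rightarrow> (nat \<Rightarrow> 'v \<Rightarrow> 'l) \<Rightarrow> ('v, 'l) mpoly set set ring" where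
  "artin_ring K \<Delta> d a = face_ring K \<Delta> Quot theta_ideal K \<Delta> d a"

definition to_artin ::
    "'l::field set \<Rightarrow> 'v set set \<Rightarrow> nat \<Rightarrow> (nat \<Rightarrow> 'v \<Rightarrow> 'l) \<Rightarrow> ('v, 'l) mpoly \<Rightarrow> ('v, 'l) mpoly set set"
  where
  "to_artin K \<Delta> d a p = theta_ideal K \<Delta> d a +>\<^bsub>face_ring K \<Delta>\<^esub> to_face_ring K \<Delta> p"

definition artin_part ::
    "'l::field set \<Rightarrow> 'v set set \<Rightarrow> nat \<Rightarrow> (nat \<Rightarrow> 'v \<Rightarrow> 'l) \<Rightarrow> nat \<Rightarrow> ('v, 'l) mpoly set set set" where
  "artin_part K \<Delta> d a k = to_artin K \<Delta> d a ` hom_polys K (\<Union>\<Delta>) k"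

text \<open>Here \<open>d - 1\<close> is meant to be the dimension of \<open>\<Delta>\<close>.\<close>

definition is_lsop :: "'l::field set \<Rightarrow> 'v set set \<Rightarrow> nat \<Rightarrow> (nat \<Rightarrow> 'v \<Rightarrow> 'l) \<Rightarrow> bool" where
  "is_lsop K \<Delta> d a \<longleftrightarrow>
     (\<forall>i \<in> {1..d}. \<forall>v \<in> \<Union>\<Delta>. a i v \<in> K) \<and>
     ring.finite_dimension (artin_ring K \<Delta> d a)
       ((\<lambda>c. to_artin K \<Delta> d a (Const c)) ` K) (carrier (artin_ring K \<Delta> d a))"


section \<open>Gorensteinification\<close>

text \<open>
  From here on \<open>h\<close> is the embedding of the coefficient field of the cycle \<open>\<mu>\<close> into \<open>'l\<close>.
\<close>

definition theta_minor :: "nat \<Rightarrow> (nat \<Rightarrow> 'v::linorder \<Rightarrow> 'l::field) \<Rightarrow> 'v set \<Rightarrow> 'l" where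
  "theta_minor d a F = det (mat d d (\<lambda>(i, j). a (Suc i) (sorted_list_of_set F ! j)))"

definition is_degree_map ::
    "('k \<Rightarrow> 'l) \<Rightarrow> 'l::field set \<Rightarrow> nat \<Rightarrow> ('v::linorder set \<Rightarrow>\<^sub>0 'k::field) \<Rightarrow> (nat \<Rightarrow> 'v \<Rightarrow> 'l) \<Rightarrow>
      (('v, 'l) mpoly set set \<Rightarrow> 'l) \<Rightarrow> bool" where
  "is_degree_map h K d \<mu> a f \<longleftrightarrow>
     (let \<Delta> = chain_support \<mu>; A = artin_ring K \<Delta> d a; Ad = artin_part K \<Delta> d a d in
        f \<in> extensional Ad \<and> f ` Ad = K \<and>
        (\<forall>x \<in> Ad. \<forall>y \<in> Ad. f (x \<oplus>\<^bsub>A\<^esub> y) = f x + f y) \<and>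
        (\<forall>c \<in> K. \<forall>x \<in> Ad. f (to_artin K \<Delta> d a (Const c) \<otimes>\<^bsub>A\<^esub> x) = c * f x) \<and>
        (\<forall>F \<in> \<Delta>. card F = d \<longrightarrow>
           f (to_artin K \<Delta> d a (face_monomial F)) = h (Poly_Mapping.lookup \<mu> F) / theta_minor d a F))"

definition degree_map ::
    "('k \<Rightarrow> 'l) \<Rightarrow> 'l::field set \<Rightarrow> nat \<Rightarrow> ('v::linorder set \<Rightarrow>\<^sub>0 'k::field) \<Rightarrow> (nat \<Rightarrow> 'v \<Rightarrow> 'l) \<Rightarrow>
      ('v, 'l) mpoly set set \<Rightarrow> 'l" where
  "degree_map h K d \<mu> a = (THE f. is_degree_map h K d \<mu> a f)"

text \<open>
  In degrees \<open>k > d\<close> the condition below is vacuous, in accordance with the vanishing of the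
  Artinian reduction in the negative degree \<open>d - k\<close>.
\<close>

definition L_part ::
    "('k \<Rightarrow> 'l) \<Rightarrow> 'l::field set \<Rightarrow> nat \<Rightarrow> ('v::linorder set \<Rightarrow>\<^sub>0 'k::field) \<Rightarrow> (nat \<Rightarrow> 'v \<Rightarrow> 'l) \<Rightarrow> nat \<Rightarrow>
      ('v, 'l) mpoly set set set" where
  "L_part h K d \<mu> a k = {x \<in> artin_part K (chain_support \<mu>) d a k.
     \<forall>j. k + j = d \<longrightarrow> (\<forall>y \<in> artin_part K (chain_support \<mu>) d a j.
       degree_map h K d \<mu> a (x \<otimes>\<^bsub>artin_ring K (chain_support \<mu>) d a\<^esub> y) = 0)}"

definition L_ideal ::
    "('k \<Rightarrow> 'l) \<Rightarrow> 'l::field set \<Rightarrow> nat \<Rightarrow> ('v::linorder set \<Rightarrow>\<^sub>0 'k::field) \<Rightarrow> (nat \<Rightarrow> 'v \<Rightarrow> 'l) \<Rightarrow>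
      ('v, 'l) mpoly set set set" where
  "L_ideal h K d \<mu> a = {finsum (artin_ring K (chain_support \<mu>) d a) x {..n} | n x.
     \<forall>k \<le> n. x k \<in> L_part h K d \<mu> a k}"

definition gorenstein_ring ::
    "('k \<Rightarrow> 'l) \<Rightarrow> 'l::field set \<Rightarrow> nat \<Rightarrow> ('v::linorder set \<Rightarrow>\<^sub>0 'k::field) \<Rightarrow> (nat \<Rightarrow> 'v \<Rightarrow> 'l) \<Rightarrow>
      ('v, 'l) mpoly set set set ring" where
  "gorenstein_ring h K d \<mu> a = artin_ring K (chain_support \<mu>) d a Quot L_ideal h K d \<mu> a"

definition gorenstein_part ::
    "('k \<Rightarrow> 'l) \<Rightarrow> 'l::field set \<Rightarrow> nat \<Rightarrow> ('v::linorder set \<Rightarrow>\<^sub>0 'k::field) \<Rightarrow> (nat \<Rightarrow> 'v \<Rightarrow> 'l) \<Rightarrow> nat \<Rightarrow>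
      ('v, 'l) mpoly set set set set" where
  "gorenstein_part h K d \<mu> a k =
     (\<lambda>x. L_ideal h K d \<mu> a +>\<^bsub>artin_ring K (chain_support \<mu>) d a\<^esub> x) ` artin_part K (chain_support \<mu>) d a k"

definition anisotropic ::
    "nat \<Rightarrow> ('k \<Rightarrow> 'l) \<Rightarrow> 'l::field set \<Rightarrow> nat \<Rightarrow> ('v::linorder set \<Rightarrow>\<^sub>0 'k::field) \<Rightarrow> (nat \<Rightarrow> 'v \<Rightarrow> 'l) \<Rightarrow>
      bool" where
  "anisotropic q h K d \<mu> a \<longleftrightarrow>
     (\<forall>k::nat. real k \<le> real d / real q \<longrightarrow>
        (\<forall>u \<in> gorenstein_part h K d \<mu> a k.
           u \<noteq> \<zero>\<^bsub>gorenstein_ring h K d \<mu> a\<^esub> \<longrightarrow>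
           u [^]\<^bsub>gorenstein_ring h K d \<mu> a\<^esub> q \<noteq> \<zero>\<^bsub>gorenstein_ring h K d \<mu> a\<^esub>))"


section \<open>Field extensions\<close>

text \<open>
  HOL does not quantify existentially over types.  Field extensions of \<open>'k\<close> are therefore taken
  inside a universal domain: the algebraic closure of the field of rational functions over \<open>'k\<close> in
  countably many variables.  Every finitely generated extension of \<open>'k\<close> embeds into it over \<open>'k\<close>,
  and only the subfield generated by the coefficients of a linear system of parameters matters for
  the existence of an anisotropic one.
\<close>

type_synonym 'k universal_domain = "((nat \<Rightarrow>\<^sub>0 nat) \<Rightarrow>\<^sub>0 'k) fract alg_closure"

definition to_universal :: "'k::field \<Rightarrow> 'k universal_domain" where
  "to_universal c = to_ac (Fraction_Field.Fract (Poly_Mapping.single 0 c) 1)"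

definition is_extension_field :: "'k::field universal_domain set \<Rightarrow> bool" where
  "is_extension_field K \<longleftrightarrow> subfield K ring_of_type_algebra \<and> range to_universal \<subseteq> K"

end

theory Submission
  imports Defs
begin

text \<open>
  Let the \<open>t\<^sub>v\<close> be independent indeterminates over the field \<open>k\<close> and \<open>K\<close> a field of rational functions.
  Localizing at the last unit vector gives
  \<open>deg f = \<plusminus> \<Sum>F. \<mu>\<^sub>F * P\<^sub>F * f(c\<^sup>F)\<close>, where \<open>P\<^sub>F = \<Prod>v<w. (t\<^sub>w - t\<^sub>v)\<close> over \<open>F\<close> and
  \<open>c\<^sup>F\<^sub>v = 1 / (t\<^sub>v * \<Prod>w\<noteq>v. (t\<^sub>v - t\<^sub>w))\<close>.  Hence for a squarefree monomial \<open>x\<^sub>S\<close> the pairing \<open>deg (f * x\<^sub>S)\<close>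
  is, up to a factor that depends only on \<open>S\<close>, the sum of \<open>\<plusminus> \<mu>\<^sub>F * P\<^sub>F\<^sub>-\<^sub>S * f(c\<^sup>F)\<close> over the facets \<open>F\<close> that contain \<open>S\<close>.

  Let \<open>f\<close> have degree \<open>k\<close> and let \<open>S\<close> be the disjoint union of \<open>\<gamma>\<close> with \<open>d - p * k\<close> elements and of
  \<open>T\<close> with \<open>(p - 1) * k\<close> elements.  In \<open>deg (f ^ p * x\<^sub>\<gamma>)\<close> the Vandermonde products \<open>P\<^sub>F\<^sub>-\<^sub>\<gamma>\<close> have \<open>p * k\<close> variables.
  Expand them in the \<open>p\<close>-basis of monomials in the \<open>t\<^sub>v\<close> with exponents less than \<open>p\<close>: by the Laplace
  expansion along residues modulo \<open>p\<close>, the coefficient of a monomial in which each of the exponents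
  \<open>1, \<dots>, p - 1\<close> occurs on \<open>k\<close> vertices of \<open>T\<close> is a constant times the \<open>p\<close>-th power of \<open>P\<^sub>F\<^sub>-\<^sub>S\<close>.
  So if \<open>deg (f ^ p * x\<^sub>\<gamma>) = 0\<close>, then the sum of \<open>\<mu>\<^sub>F * (\<plusminus> P\<^sub>F\<^sub>-\<^sub>S * f(c\<^sup>F)) ^ p\<close> vanishes.
  The coefficients \<open>\<mu>\<^sub>F\<close> of the facets through a vertex of \<open>S\<close> are proportional to their \<open>p\<close>-th powers, because the
  Frobenius twist of the link cycle is again a cycle of the link, whose top homology is a line.
  Therefore \<open>deg (f * x\<^sub>S) ^ p = 0\<close>.  Since squarefree monomials span the Artinian reduction,
  \<open>f\<close> vanishes in the Gorensteinification as soon as \<open>f ^ p\<close> does.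
\<close>

abbreviation "keys \<equiv> Poly_Mapping.keys"
abbreviation "lookup \<equiv> Poly_Mapping.lookup"

section \<open>Vandermonde determinants in characteristic \<open>p\<close>\<close>

definition vander :: "(nat \<Rightarrow> 'a::comm_ring_1) \<Rightarrow> nat \<Rightarrow> 'a" where
  "vander x n = (\<Prod>j<n. \<Prod>i<j. x j - x i)"

text \<open>Column operations: multiplying by the unitriangular matrix of coefficients of the Newton
  polynomials \<open>N j\<close> turns the Vandermonde matrix into a lower triangular one, whose
  diagonal entries are the inner products of \<open>vander\<close>.\<close>

lemma det_vandermonde:
  fixes x :: "nat \<Rightarrow> 'a::idom"
  shows "det (mat n n (\<lambda>(i, j). x i ^ j)) = vander x n"
proof -
  define N where "N j = (\<Prod>i<j. [:- x i, 1:])" for j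
  have degN: "degree (N j) = j" for j
    unfolding N_def by (subst degree_prod_eq_sum_degree) auto
  have leadN: "coeff (N j) j = 1" for j
  proof -
    have "lead_coeff (N j) = 1" unfolding N_def lead_coeff_prod by simp
    then show ?thesis by (simp add: degN)
  qed
  have polyN: "poly (N j) a = (\<Prod>i<j. a - x i)" for j a
    unfolding N_def poly_prod by simp
  let ?M = "mat n n (\<lambda>(i, j). x i ^ j)"
  let ?U = "mat n n (\<lambda>(k, j). coeff (N j) k)"
  let ?T = "mat n n (\<lambda>(i, j). \<Prod>k<j. x i - x k)"
  have "?M * ?U = ?T"
  proof (rule eq_matI)
    fix i j assume ij: "i < dim_row ?T" "j < dim_col ?T"
    then have "(?M * ?U) $$ (i, j) = (\<Sum>k<n. x i ^ k * coeff (N j) k)"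
      by (simp add: scalar_prod_def atLeast0LessThan)
    also have "\<dots> = (\<Sum>k\<le>j. x i ^ k * coeff (N j) k)"
    proof (rule sum.mono_neutral_right)
      show "\<forall>k\<in>{..<n} - {..j}. x i ^ k * coeff (N j) k = 0"
        by (auto simp: coeff_eq_0 degN)
    qed (use ij in auto)
    also have "\<dots> = poly (N j) (x i)"
      unfolding poly_altdef degN by (simp add: mult.commute)
    finally show "(?M * ?U) $$ (i, j) = ?T $$ (i, j)"
      using ij by (simp add: polyN)
  qed auto
  then have "det ?M * det ?U = det ?T"
    by (metis det_mult mat_carrier)
  moreover have "det ?U = 1"
  proof -
    have "det ?U = prod_list (diag_mat ?U)"
      by (rule det_upper_triangular[of _ n]) (auto simp: coeff_eq_0 degN)
    also have "\<dots> = 1"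
      by (simp add: diag_mat_def leadN flip: prod.distinct_set_conv_list)
    finally show ?thesis .
  qed
  moreover have "det ?T = vander x n"
  proof -
    have "det ?T = prod_list (diag_mat ?T)"
      by (rule det_lower_triangular[of n]) (auto intro!: prod_zero)
    also have "\<dots> = (\<Prod>j<n. \<Prod>k<j. x j - x k)"
      by (simp add: diag_mat_def atLeast0LessThan flip: prod.distinct_set_conv_list)
    finally show ?thesis by (simp add: vander_def)
  qed
  ultimately show ?thesis by simp
qed

definition block_vander :: "nat \<Rightarrow> nat \<Rightarrow> (nat \<Rightarrow> 'a::comm_ring_1) \<Rightarrow> 'a" where
  "block_vander m k x = det (mat (m * k) (m * k)
     (\<lambda>(i, j). if j div k = i div k then x i ^ (j mod k) else 0))"

text \<open>The matrix has zero off-diagonal blocks. Subtracting \<open>k\<close> from an index of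
  the lower block lowers its quotient by one and keeps its remainder, so that block has the same
  form.\<close>

lemma block_vander_Suc:
  fixes x :: "nat \<Rightarrow> 'a::idom"
  assumes "k > 0"
  shows "block_vander (Suc m) k x = vander x k * block_vander m k (\<lambda>i. x (i + k))"
proof -
  let ?g = "\<lambda>x. (\<lambda>(i, j). if j div k = i div k then x i ^ (j mod k) else 0)"
  have "mat (Suc m * k) (Suc m * k) (?g x) =
    four_block_mat (mat k k (\<lambda>(i, j). x i ^ j)) (0\<^sub>m k (m * k)) (0\<^sub>m (m * k) k)
      (mat (m * k) (m * k) (?g (\<lambda>i. x (i + k))))" (is "?L = ?R")
  proof (rule eq_matI)
    fix i j assume "i < dim_row ?R" "j < dim_col ?R"
    then have ij: "i < k + m * k" "j < k + m * k" by auto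
    have *: "a div k = Suc ((a - k) div k)" "a mod k = (a - k) mod k" if "\<not> a < k" for a
      using that assms by (auto simp: le_div_geq le_mod_geq)
    have **: "a div k = 0" if "a < k" for a using that by simp
    show "?L $$ (i, j) = ?R $$ (i, j)"
    proof (cases "i < k"; cases "j < k")
      assume "i < k" "j < k" then show ?thesis using ij by simp
    next
      assume "i < k" "\<not> j < k" then show ?thesis using ij *(1)[of j] **[of i] by simp
    next
      assume "\<not> i < k" "j < k" then show ?thesis using ij *(1)[of i] **[of j] by simp
    next
      assume "\<not> i < k" "\<not> j < k"
      then show ?thesis using ij *(1)[of i] *[of j] by auto
    qed
  qed auto
  then have "block_vander (Suc m) k x = det (mat k k (\<lambda>(i, j). x i ^ j)) * block_vander m k (\<lambda>i. x (i + k))"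
    unfolding block_vander_def by (simp only:) (rule det_four_block_mat_lower_left_zero[of _ k _ "m * k"]; simp)
  then show ?thesis by (simp add: det_vandermonde)
qed

lemma block_vander_neq_0:
  fixes x :: "nat \<Rightarrow> 'a::idom"
  assumes "k > 0" "inj_on x {..<m * k}"
  shows "block_vander m k x \<noteq> 0"
  using assms(2)
proof (induction m arbitrary: x)
  case 0
  then show ?case by (simp add: block_vander_def)
next
  case (Suc m)
  have "vander x k \<noteq> 0"
    unfolding vander_def using inj_onD[OF Suc.prems] by (fastforce simp: prod_zero_iff)
  moreover have "block_vander m k (\<lambda>i. x (i + k)) \<noteq> 0"
    by (rule Suc.IH) (rule inj_onI, use inj_onD[OF Suc.prems] in fastforce)
  ultimately show ?case using assms(1) by (simp add: block_vander_Suc)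
qed

text \<open>With j = r * k + s, r < p and s < k, the map sends j to s * p + r. Transposing the p by
  k grid in this way lists the column indices by their residues modulo p.\<close>

lemma permutes_residue_sort:
  fixes k p :: nat
  assumes "k > 0" "p > 0"
  defines "q \<equiv> \<lambda>j. if j < p * k then p * (j mod k) + j div k else j"
  shows "q permutes {0..<p * k}"
proof (rule bij_imp_permutes)
  have *: "j div k < p" if "j < p * k" for j
    using that by (rule less_mult_imp_div_less)
  have "inj_on q {0..<p * k}"
  proof (rule inj_onI)
    fix i j assume "i \<in> {0..<p * k}" "j \<in> {0..<p * k}" and eq: "q i = q j"
    then have ij: "i < p * k" "j < p * k" by auto
    have "q i div p = i mod k" "q i mod p = i div k" "q j div p = j mod k" "q j mod p = j div k"
      using ij *[OF ij(1)] *[OF ij(2)] assms(2) by (simp_all add: q_def)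
    with eq show "i = j" by (metis div_mult_mod_eq)
  qed
  moreover have "q ` {0..<p * k} \<subseteq> {0..<p * k}"
  proof safe
    fix j assume "j \<in> {0..<p * k}"
    then have j: "j < p * k" by simp
    have "p * (j mod k) + j div k < p * (j mod k) + p" using *[OF j] by simp
    also have "\<dots> = p * Suc (j mod k)" by simp
    also have "\<dots> \<le> p * k" using assms(1) by (intro mult_left_mono) (simp_all add: Suc_leI)
    finally show "q j \<in> {0..<p * k}" using j by (simp add: q_def)
  qed
  ultimately show "bij_betw q {0..<p * k} {0..<p * k}"
    by (simp add: bij_betw_def endo_inj_surj)
qed (simp add: q_def)

text \<open>Sorting the columns by residue makes the matrix block diagonal. The sign of the sorting
  permutation is fixed before \<open>x\<close> is chosen, because one constant has to serve all
  facets.\<close>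

lemma det_residue_sort:
  assumes "k > 0" "p > 0"
  obtains s :: "'a::comm_ring_1" where "s = 1 \<or> s = -1"
    "\<And>x. det (mat (p * k) (p * k) (\<lambda>(i, j). if j mod p = i div k then x i ^ (j div p) else 0)) =
      s * block_vander p k x"
proof -
  define q where "q = (\<lambda>j. if j < p * k then p * (j mod k) + j div k else j)"
  have q: "q permutes {0..<p * k}"
    unfolding q_def by (rule permutes_residue_sort[OF assms])
  have *: "j div k < p" if "j < p * k" for j
    using that by (rule less_mult_imp_div_less)
  have qlt: "q j < p * k" if "j < p * k" for j
    using permutes_in_image[OF q, of j] that by simp
  have q1: "q j div p = j mod k" "q j mod p = j div k" if "j < p * k" for j
    using that *[OF that] assms(2) by (simp_all add: q_def)
  have eq: "of_int (sign q) * det (mat (p * k) (p * k) (\<lambda>(i, j). if j mod p = i div k then x i ^ (j div p) else 0)) =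
      block_vander p k x" for x :: "nat \<Rightarrow> 'a"
  proof -
    let ?M = "mat (p * k) (p * k) (\<lambda>(i, j). if j mod p = i div k then x i ^ (j div p) else 0)"
    let ?B = "mat (p * k) (p * k) (\<lambda>(i, j). if j div k = i div k then x i ^ (j mod k) else 0)"
    have "mat (p * k) (p * k) (\<lambda>(i, j). ?M\<^sup>T $$ (q i, j)) = ?B\<^sup>T"
      by (rule eq_matI) (auto simp: qlt q1)
    then have "det ?B\<^sup>T = of_int (sign q) * det ?M\<^sup>T"
      using det_permute_rows[of "?M\<^sup>T" "p * k" q] q by simp
    then show ?thesis unfolding block_vander_def
      using det_transpose[of ?M "p * k"] det_transpose[of ?B "p * k"] by simp
  qed
  have s: "sign q = 1 \<or> sign q = -1" by (simp add: sign_def)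
  show thesis
  proof (rule that[of "of_int (sign q)"])
    show "(of_int (sign q) :: 'a) = 1 \<or> (of_int (sign q) :: 'a) = -1" using s by auto
    show "det (mat (p * k) (p * k) (\<lambda>(i, j). if j mod p = i div k then x i ^ (j div p) else 0)) =
      of_int (sign q) * block_vander p k x" for x :: "nat \<Rightarrow> 'a"
      using s by (auto simp flip: eq)
  qed
qed

text \<open>Frobenius is additive, so it can be applied to -1 + 1 = 0; this treats p = 2 together
  with the odd primes.\<close>

lemma freshmans_dream_minus_one:
  assumes "prime CHAR('a::comm_ring_1)"
  shows "(-1 :: 'a) ^ CHAR('a) = -1"
proof -
  have "(-1 + 1 :: 'a) ^ CHAR('a) = (-1) ^ CHAR('a) + 1 ^ CHAR('a)"
    by (rule freshmans_dream[OF assms refl])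
  then show ?thesis
    using assms prime_gt_0_nat[of "CHAR('a)"] by (simp add: zero_power eq_neg_iff_add_eq_0)
qed

text \<open>The Vandermonde determinant is expanded in the monomials \<open>\<Prod>v\<in>V. t v ^ \<epsilon> v\<close> with
  \<open>\<epsilon> v < p\<close> over the field of \<open>p\<close>-th powers; \<open>frob_coeff\<close> is the \<open>p\<close>-th root of the coefficient.
  In the Leibniz formula, \<open>x ^ j\<close> is split as \<open>x ^ (j mod p) * (x ^ (j div p)) ^ p\<close>.\<close>

definition frob_coeff :: "nat \<Rightarrow> ('v \<Rightarrow> 'a::comm_ring_1) \<Rightarrow> 'v set \<Rightarrow> 'v list \<Rightarrow> ('v \<Rightarrow> nat) \<Rightarrow> 'a" where
  "frob_coeff p t V l \<epsilon> = (if \<forall>v \<in> V - set l. \<epsilon> v = 0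
     then det (mat (length l) (length l) (\<lambda>(i, j). if j mod p = \<epsilon> (l ! i) then t (l ! i) ^ (j div p) else 0))
     else 0)"

lemma det_vandermonde_frob_coeff:
  fixes t :: "'v \<Rightarrow> 'a::comm_ring_1"
  assumes p: "prime p" "CHAR('a) = p" and V: "finite V" "set l \<subseteq> V" and l: "distinct l"
  defines "n \<equiv> length l"
  shows "det (mat n n (\<lambda>(i, j). t (l ! i) ^ j)) =
    (\<Sum>\<epsilon> \<in> V \<rightarrow>\<^sub>E {..<p}. (\<Prod>v\<in>V. t v ^ \<epsilon> v) * frob_coeff p t V l \<epsilon> ^ p)"
proof -
  have p0: "p > 0" using p(1) prime_gt_0_nat by blast
  define idx where "idx = the_inv_into {..<n} (nth l)"
  have bij: "bij_betw (nth l) {..<n} (set l)"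
    using l by (simp add: bij_betw_nth n_def)
  have idx: "idx (l ! i) = i" if "i < n" for i
    using bij that by (simp add: idx_def bij_betw_def the_inv_into_f_f)
  have prodl: "(\<Prod>i = 0..<n. f (l ! i)) = prod f (set l)" for f :: "'v \<Rightarrow> 'a"
    using prod.reindex_bij_betw[OF bij, of f] by (simp add: atLeast0LessThan)
  let ?P = "{\<pi>. \<pi> permutes {0..<n}}"
  \<comment> \<open>The factor of the vertex v in the Leibniz term of \<pi> when residue r is
    prescribed at v. Vertices outside the list behave as if their exponent were 0.\<close>
  define g where "g \<pi> v r = (if v \<in> set l then (if \<pi> (idx v) mod p = r then t v ^ (\<pi> (idx v) div p) else 0)
      else (if r = 0 then 1 else 0))" for \<pi> :: "nat \<Rightarrow> nat" and v r
  have W: "frob_coeff p t V l \<epsilon> = (\<Sum>\<pi>\<in>?P. of_int (sign \<pi>) * (\<Prod>v\<in>V. g \<pi> v (\<epsilon> v)))" for \<epsilon>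
  proof (cases "\<forall>v \<in> V - set l. \<epsilon> v = 0")
    case True
    have "(\<Prod>v\<in>V. g \<pi> v (\<epsilon> v)) = (\<Prod>v\<in>set l. g \<pi> v (\<epsilon> v))" for \<pi>
      by (rule prod.mono_neutral_right) (use V True in \<open>auto simp: g_def\<close>)
    also have "\<dots> \<pi> = (\<Prod>i = 0..<n. g \<pi> (l ! i) (\<epsilon> (l ! i)))" for \<pi>
      by (rule prodl[symmetric])
    also have "\<dots> \<pi> = (\<Prod>i = 0..<n. if \<pi> i mod p = \<epsilon> (l ! i) then t (l ! i) ^ (\<pi> i div p) else 0)" for \<pi>
      by (rule prod.cong) (auto simp: idx n_def g_def)
    finally have eq: "(\<Prod>v\<in>V. g \<pi> v (\<epsilon> v)) =
      (\<Prod>i = 0..<n. if \<pi> i mod p = \<epsilon> (l ! i) then t (l ! i) ^ (\<pi> i div p) else 0)" for \<pi> .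
    let ?M = "mat n n (\<lambda>(i, j). if j mod p = \<epsilon> (l ! i) then t (l ! i) ^ (j div p) else 0)"
    have "frob_coeff p t V l \<epsilon> = det ?M"
      using True by (simp add: frob_coeff_def n_def)
    also have "\<dots> = (\<Sum>\<pi>\<in>?P. of_int (sign \<pi>) * (\<Prod>i = 0..<n. ?M $$ (i, \<pi> i)))"
      by (rule det_def') simp
    also have "\<dots> = (\<Sum>\<pi>\<in>?P. of_int (sign \<pi>) * (\<Prod>v\<in>V. g \<pi> v (\<epsilon> v)))"
    proof (rule sum.cong[OF refl])
      fix \<pi> assume "\<pi> \<in> ?P"
      then have "\<pi> i < n" if "i < n" for i
        using permutes_in_image[of \<pi> "{0..<n}" i] that by auto
      then show "of_int (sign \<pi>) * (\<Prod>i = 0..<n. ?M $$ (i, \<pi> i)) =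
        of_int (sign \<pi>) * (\<Prod>v\<in>V. g \<pi> v (\<epsilon> v))"
        unfolding eq by (intro arg_cong2[of _ _ _ _ "(*)"] prod.cong) auto
    qed
    finally show ?thesis .
  next
    case False
    then obtain v where v: "v \<in> V - set l" "\<epsilon> v \<noteq> 0" by blast
    then have "(\<Prod>v\<in>V. g \<pi> v (\<epsilon> v)) = 0" for \<pi>
      using V by (intro prod_zero bexI[of _ v]) (auto simp: g_def)
    then show ?thesis using False by (auto simp: frob_coeff_def)
  qed
  \<comment> \<open>Signs are fixed by Frobenius, so the p-th power may be taken factor by factor in
    each Leibniz term.\<close>
  have sgn: "(of_int (sign \<pi>) :: 'a) ^ p = of_int (sign \<pi>)" for \<pi> :: "nat \<Rightarrow> nat"
    using freshmans_dream_minus_one[where 'a = 'a] p by (simp add: sign_def)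
  have Wp: "frob_coeff p t V l \<epsilon> ^ p =
    (\<Sum>\<pi>\<in>?P. of_int (sign \<pi>) * (\<Prod>v\<in>V. g \<pi> v (\<epsilon> v) ^ p))" for \<epsilon>
  proof -
    have "frob_coeff p t V l \<epsilon> ^ p = (\<Sum>\<pi>\<in>?P. (of_int (sign \<pi>) * (\<Prod>v\<in>V. g \<pi> v (\<epsilon> v))) ^ p)"
      unfolding W by (rule freshmans_dream_sum) (use p in auto)
    then show ?thesis by (simp only: power_mult_distrib sgn prod_power_distrib)
  qed
  have "(\<Sum>\<epsilon> \<in> V \<rightarrow>\<^sub>E {..<p}. (\<Prod>v\<in>V. t v ^ \<epsilon> v) * frob_coeff p t V l \<epsilon> ^ p) =
    (\<Sum>\<epsilon> \<in> V \<rightarrow>\<^sub>E {..<p}. \<Sum>\<pi>\<in>?P. of_int (sign \<pi>) * (\<Prod>v\<in>V. t v ^ \<epsilon> v * g \<pi> v (\<epsilon> v) ^ p))"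
    unfolding Wp sum_distrib_left prod.distrib by (simp only: mult.left_commute)
  also have "\<dots> = (\<Sum>\<pi>\<in>?P. of_int (sign \<pi>) * (\<Sum>\<epsilon> \<in> V \<rightarrow>\<^sub>E {..<p}. \<Prod>v\<in>V. t v ^ \<epsilon> v * g \<pi> v (\<epsilon> v) ^ p))"
    unfolding sum_distrib_left by (rule sum.swap)
  also have "\<dots> = (\<Sum>\<pi>\<in>?P. of_int (sign \<pi>) * (\<Prod>i = 0..<n. mat n n (\<lambda>(i, j). t (l ! i) ^ j) $$ (i, \<pi> i)))"
  proof (rule sum.cong[OF refl])
    fix \<pi> assume pi: "\<pi> \<in> ?P"
    have "(\<Sum>\<epsilon> \<in> V \<rightarrow>\<^sub>E {..<p}. \<Prod>v\<in>V. t v ^ \<epsilon> v * g \<pi> v (\<epsilon> v) ^ p) =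
      (\<Prod>v\<in>V. \<Sum>r<p. t v ^ r * g \<pi> v r ^ p)"
      by (rule prod_sum_PiE[symmetric]) (use V in auto)
    also have "\<dots> = (\<Prod>v\<in>V. if v \<in> set l then t v ^ \<pi> (idx v) else 1)"
    proof (rule prod.cong[OF refl])
      fix v assume "v \<in> V"
      \<comment> \<open>At a listed vertex only the residue of \<open>\<pi> (idx v)\<close>
        contributes, and division with remainder restores the full exponent; at any other vertex
        only r = 0 contributes, with value 1.\<close>
      have "(\<Sum>r<p. t v ^ r * g \<pi> v r ^ p) =
        (\<Sum>r<p. if (if v \<in> set l then \<pi> (idx v) mod p else 0) = r
           then (if v \<in> set l then t v ^ (\<pi> (idx v) mod p) * (t v ^ (\<pi> (idx v) div p)) ^ p else 1) else 0)"
        by (rule sum.cong[OF refl]) (use p0 in \<open>auto simp: g_def zero_power\<close>)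
      also have "\<dots> = (if v \<in> set l then t v ^ (\<pi> (idx v) mod p) * (t v ^ (\<pi> (idx v) div p)) ^ p else 1)"
        using p0 by (subst sum.delta') auto
      also have "\<dots> = (if v \<in> set l then t v ^ \<pi> (idx v) else 1)"
        by (simp add: mult.commute flip: power_mult power_add)
      finally show "(\<Sum>r<p. t v ^ r * g \<pi> v r ^ p) = (if v \<in> set l then t v ^ \<pi> (idx v) else 1)" .
    qed
    also have "\<dots> = (\<Prod>v\<in>set l. t v ^ \<pi> (idx v))"
      using V by (simp add: prod.If_cases Int_absorb1)
    also have "\<dots> = (\<Prod>i = 0..<n. t (l ! i) ^ \<pi> i)"
      unfolding prodl[symmetric] by (rule prod.cong) (auto simp: idx)
    also have "\<dots> = (\<Prod>i = 0..<n. mat n n (\<lambda>(i, j). t (l ! i) ^ j) $$ (i, \<pi> i))"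
      by (rule prod.cong[OF refl]) (use pi permutes_in_image[of \<pi> "{0..<n}"] in auto)
    finally show "of_int (sign \<pi>) * (\<Sum>\<epsilon> \<in> V \<rightarrow>\<^sub>E {..<p}. \<Prod>v\<in>V. t v ^ \<epsilon> v * g \<pi> v (\<epsilon> v) ^ p) =
      of_int (sign \<pi>) * (\<Prod>i = 0..<n. mat n n (\<lambda>(i, j). t (l ! i) ^ j) $$ (i, \<pi> i))" by simp
  qed
  also have "\<dots> = det (mat n n (\<lambda>(i, j). t (l ! i) ^ j))"
    by (rule det_def'[symmetric]) simp
  finally show ?thesis by simp
qed

section \<open>Vandermonde products over vertex sets and shuffle signs\<close>

lemma vander_cong: "(\<And>i. i < n \<Longrightarrow> x i = y i) \<Longrightarrow> vander x n = vander y n"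
  unfolding vander_def by (intro prod.cong arg_cong2[of _ _ _ _ "(-)"]) auto

lemma vander_append:
  "vander x (a + b) = vander x a * vander (\<lambda>i. x (a + i)) b * (\<Prod>j<b. \<Prod>i<a. x (a + j) - x i)"
proof (induction b)
  case (Suc b)
  have "(\<Prod>i<a + b. x (a + b) - x i) = (\<Prod>i<a. x (a + b) - x i) * (\<Prod>i<b. x (a + b) - x (a + i))"
  proof -
    have "{..<a + b} = {..<a} \<union> (+) a ` {..<b}"
      using image_add_atLeastLessThan[of a 0 b] by (auto simp: atLeast0LessThan)
    then have "(\<Prod>i<a + b. x (a + b) - x i) =
      (\<Prod>i<a. x (a + b) - x i) * (\<Prod>i\<in>(+) a ` {..<b}. x (a + b) - x i)"
      by (simp only:) (rule prod.union_disjoint; auto)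
    then show ?thesis by (simp add: prod.reindex)
  qed
  moreover have "vander x (a + Suc b) = vander x (a + b) * (\<Prod>i<a + b. x (a + b) - x i)"
    "vander (\<lambda>i. x (a + i)) (Suc b) = vander (\<lambda>i. x (a + i)) b * (\<Prod>i<b. x (a + b) - x (a + i))"
    by (simp_all add: vander_def)
  ultimately show ?case using Suc.IH by (simp add: mult_ac)
qed (simp add: vander_def)

definition vdm :: "('v::linorder \<Rightarrow> 'a::comm_ring_1) \<Rightarrow> 'v set \<Rightarrow> 'a" where
  "vdm t F = (\<Prod>w\<in>F. \<Prod>v | v \<in> F \<and> v < w. t w - t v)"

lemma vdm_singleton [simp]: "vdm t {u} = 1"
  unfolding vdm_def by (intro prod.neutral ballI) auto

text \<open>For disjoint finite A and B this is the sign of the permutation that sorts the list of B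
  followed by the list of A. It is a ring element so that it can be used both in the field of \<mu>
  and in its extension.\<close>

definition shuffle_sign :: "'v::linorder set \<Rightarrow> 'v set \<Rightarrow> 'a::comm_ring_1" where
  "shuffle_sign A B = (\<Prod>v\<in>A. \<Prod>w\<in>B. if v < w then -1 else 1)"

text \<open>The sorted enumeration is strictly increasing, so pairs of positions i < j correspond to
  pairs of vertices v < w.\<close>

lemma prod_pairs_sorted_list:
  assumes "finite F"
  shows "(\<Prod>j<card F. \<Prod>i<j. f (sorted_list_of_set F ! j) (sorted_list_of_set F ! i)) =
    (\<Prod>w\<in>F. \<Prod>v | v \<in> F \<and> v < w. f w v :: 'a::comm_monoid_mult)"
proof -
  define l where "l = sorted_list_of_set F"
  have l: "distinct l" "set l = F" "length l = card F" "sorted l"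
    using assms by (auto simp: l_def)
  have mono: "l ! i < l ! j \<longleftrightarrow> i < j" if "i < card F" "j < card F" for i j
    using l that strict_sorted_iff[of l]
    by (metis linorder_not_less nth_eq_iff_index_eq order_less_le sorted_nth_mono)
  have bij: "bij_betw (nth l) {..<card F} F"
    by (rule bij_betw_nth) (simp_all only: l)
  have "(\<Prod>j<card F. \<Prod>i<j. f (l ! j) (l ! i)) = (\<Prod>j<card F. \<Prod>v | v \<in> F \<and> v < l ! j. f (l ! j) v)"
  proof (rule prod.cong[OF refl])
    fix j assume j: "j \<in> {..<card F}"
    have "bij_betw (nth l) {..<j} {v. v \<in> F \<and> v < l ! j}"
    proof (rule bij_betw_subset[OF bij])
      show "{..<j} \<subseteq> {..<card F}" using j by auto
      show "nth l ` {..<j} = {v. v \<in> F \<and> v < l ! j}"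
      proof safe
        fix v assume v: "v \<in> F" "v < l ! j"
        then obtain i where "i < card F" "v = l ! i" by (metis in_set_conv_nth l(2,3))
        with v mono j show "v \<in> nth l ` {..<j}" by auto
      qed (use j l(2,3) mono nth_mem[of _ l] in auto)
    qed
    then show "(\<Prod>i<j. f (l ! j) (l ! i)) = (\<Prod>v | v \<in> F \<and> v < l ! j. f (l ! j) v)"
      by (rule prod.reindex_bij_betw)
  qed
  also have "\<dots> = (\<Prod>w\<in>F. \<Prod>v | v \<in> F \<and> v < w. f w v)"
    by (rule prod.reindex_bij_betw[OF bij])
  finally show ?thesis by (simp add: l_def)
qed

lemma vander_sorted_list:
  assumes "finite F"
  shows "vander (\<lambda>i. t (sorted_list_of_set F ! i)) (card F) = vdm t F"
  unfolding vander_def vdm_def by (rule prod_pairs_sorted_list[OF assms])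

text \<open>Each mixed pair enters the ordered product once, as t v - t w up to a sign that is
  negative exactly when v < w; \<open>shuffle_sign\<close> collects these signs.\<close>

lemma vdm_Un:
  assumes "finite A" "finite B" "A \<inter> B = {}"
  shows "vdm t (A \<union> B) = shuffle_sign A B * (vdm t A * vdm t B * (\<Prod>v\<in>A. \<Prod>w\<in>B. t v - t w))"
proof -
  let ?q = "\<lambda>v w. if v < w then t w - t v else 1"
  have D: "vdm t F = (\<Prod>w\<in>F. \<Prod>v\<in>F. ?q v w)" if "finite F" for F
    unfolding vdm_def by (intro prod.cong refl prod.mono_neutral_cong_left) (use that in auto)
  have "vdm t (A \<union> B) = (\<Prod>w\<in>A. (\<Prod>v\<in>A. ?q v w) * (\<Prod>v\<in>B. ?q v w)) *
      (\<Prod>w\<in>B. (\<Prod>v\<in>A. ?q v w) * (\<Prod>v\<in>B. ?q v w))"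
    using assms by (simp add: D prod.union_disjoint)
  also have "\<dots> = vdm t A * vdm t B * ((\<Prod>v\<in>A. \<Prod>w\<in>B. ?q w v) * (\<Prod>v\<in>A. \<Prod>w\<in>B. ?q v w))"
    using assms by (simp add: D prod.distrib mult_ac prod.swap[of _ A B])
  also have "\<dots> = vdm t A * vdm t B * (\<Prod>v\<in>A. \<Prod>w\<in>B. (if v < w then -1 else 1) * (t v - t w))"
  proof -
    have "?q w v * ?q v w = (if v < w then -1 else 1) * (t v - t w)" if "v \<in> A" "w \<in> B" for v w
      using that assms(3) by (cases v w rule: linorder_cases) auto
    then have "(\<Prod>v\<in>A. \<Prod>w\<in>B. ?q w v * ?q v w) = (\<Prod>v\<in>A. \<Prod>w\<in>B. (if v < w then -1 else 1) * (t v - t w))"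
      by (intro prod.cong refl)
    then show ?thesis by (simp only: prod.distrib)
  qed
  also have "\<dots> = shuffle_sign A B * (vdm t A * vdm t B * (\<Prod>v\<in>A. \<Prod>w\<in>B. t v - t w))"
    by (simp only: shuffle_sign_def prod.distrib mult_ac)
  finally show ?thesis .
qed

lemma shuffle_sign_Un_left:
  "\<lbrakk>finite A; finite A'; A \<inter> A' = {}\<rbrakk> \<Longrightarrow> shuffle_sign (A \<union> A') B = shuffle_sign A B * shuffle_sign A' B"
  unfolding shuffle_sign_def by (rule prod.union_disjoint)

lemma shuffle_sign_Un_right:
  "\<lbrakk>finite B; finite B'; B \<inter> B' = {}\<rbrakk> \<Longrightarrow> shuffle_sign A (B \<union> B') = shuffle_sign A B * shuffle_sign A B'"
  unfolding shuffle_sign_def by (simp add: prod.union_disjoint prod.distrib)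

lemma shuffle_sign_cases:
  "shuffle_sign A B = (1 :: 'a::comm_ring_1) \<or> shuffle_sign A B = (-1 :: 'a)"
proof -
  have *: "prod f S = 1 \<or> prod f S = -1" if "\<And>x. x \<in> S \<Longrightarrow> f x = 1 \<or> f x = -1"
    for f :: "'c \<Rightarrow> 'a" and S
    using that by (induction S rule: infinite_finite_induct) fastforce+
  show ?thesis unfolding shuffle_sign_def by (intro *) auto
qed

lemma shuffle_sign_neq_0 [simp]: "shuffle_sign A B \<noteq> (0 :: 'a::comm_ring_1)"
  using shuffle_sign_cases[of A B, where 'a = 'a] by auto

lemma shuffle_sign_squared [simp]:
  "shuffle_sign A B * shuffle_sign A B = (1 :: 'a::comm_ring_1)"
  "shuffle_sign A B * (shuffle_sign A B * x) = (x :: 'a::comm_ring_1)"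
  using shuffle_sign_cases[of A B, where 'a = 'a] by auto

lemma vdm_neq_0:
  fixes t :: "'v::linorder \<Rightarrow> 'a::idom"
  assumes "finite F" "inj_on t F" shows "vdm t F \<noteq> 0"
  unfolding vdm_def using assms by (auto simp: prod_zero_iff inj_on_def)

text \<open>By the Leibniz formula. It keeps the expansion coefficients inside K, where independence
  over p-th powers is available.\<close>

lemma det_closed:
  assumes "\<And>i j. i < n \<Longrightarrow> j < n \<Longrightarrow> f (i, j) \<in> K"
    and "\<And>a b. a \<in> K \<Longrightarrow> b \<in> K \<Longrightarrow> a + b \<in> K" "\<And>a b. a \<in> K \<Longrightarrow> b \<in> K \<Longrightarrow> a * b \<in> K"
    and "0 \<in> K" "1 \<in> K" "-1 \<in> K"
  shows "det (mat n n f) \<in> K"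
proof -
  have sum: "sum g S \<in> K" if "\<And>x. x \<in> S \<Longrightarrow> g x \<in> K" for g :: "(nat \<Rightarrow> nat) \<Rightarrow> 'a" and S
    using that by (induction S rule: infinite_finite_induct) (auto intro: assms)
  have prod: "prod g S \<in> K" if "\<And>x. x \<in> S \<Longrightarrow> g x \<in> K" for g :: "nat \<Rightarrow> 'a" and S
    using that by (induction S rule: infinite_finite_induct) (auto intro: assms)
  have "det (mat n n f) = (\<Sum>\<pi> | \<pi> permutes {0..<n}. of_int (sign \<pi>) * (\<Prod>i = 0..<n. mat n n f $$ (i, \<pi> i)))"
    by (rule det_def') simp
  also have "\<dots> \<in> K"
  proof (rule sum)
    fix \<pi> assume pi: "\<pi> \<in> {\<pi>. \<pi> permutes {0..<n}}"
    have "(\<Prod>i = 0..<n. mat n n f $$ (i, \<pi> i)) \<in> K"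
    proof (rule prod)
      fix i assume "i \<in> {0..<n}"
      then show "mat n n f $$ (i, \<pi> i) \<in> K"
        using permutes_in_image[of \<pi> "{0..<n}" i] pi by (auto intro: assms)
    qed
    moreover have "of_int (sign \<pi>) \<in> K" by (simp add: sign_def assms)
    ultimately show "of_int (sign \<pi>) * (\<Prod>i = 0..<n. mat n n f $$ (i, \<pi> i)) \<in> K"
      by (rule assms(3)[rotated])
  qed
  finally show ?thesis .
qed

text \<open>The exponent \<open>\<epsilon>\<^sub>0\<close> takes each of the values \<open>1, \<dots>, p - 1\<close> on \<open>k\<close> vertices of \<open>T\<close> and vanishes
  elsewhere.  For this exponent the matrix in \<open>frob_coeff\<close> is block diagonal after sorting its columns by
  residues, and the block that belongs to \<open>G - T\<close> is again of Vandermonde type.\<close>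

lemma vdm_frobenius_expansion:
  fixes t :: "'v::linorder \<Rightarrow> 'a::idom"
  assumes p: "prime p" "CHAR('a) = p" and V: "finite V" and T: "T \<subseteq> V" "card T = (p - 1) * k" "k > 0"
    and t: "inj_on t V" "\<And>v. v \<in> V \<Longrightarrow> t v \<in> K"
    and K: "\<And>a b. a \<in> K \<Longrightarrow> b \<in> K \<Longrightarrow> a + b \<in> K" "\<And>a b. a \<in> K \<Longrightarrow> b \<in> K \<Longrightarrow> a * b \<in> K"
      "0 \<in> K" "1 \<in> K" "-1 \<in> K"
  obtains \<kappa> :: 'a and \<epsilon>\<^sub>0 W where "\<kappa> \<noteq> 0" "\<epsilon>\<^sub>0 \<in> V \<rightarrow>\<^sub>E {..<p}"
    "\<And>G \<epsilon>. G \<subseteq> V \<Longrightarrow> W G \<epsilon> \<in> K"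
    "\<And>G. G \<subseteq> V \<Longrightarrow> card G = p * k \<Longrightarrow>
      vdm t G = (\<Sum>\<epsilon> \<in> V \<rightarrow>\<^sub>E {..<p}. (\<Prod>v\<in>V. t v ^ \<epsilon> v) * W G \<epsilon> ^ p)"
    "\<And>G. G \<subseteq> V \<Longrightarrow> card G = p * k \<Longrightarrow>
      W G \<epsilon>\<^sub>0 = (if T \<subseteq> G then shuffle_sign T (G - T) * \<kappa> * vdm t (G - T) else 0)"
proof -
  have p0: "p > 0" using p(1) prime_gt_0_nat by blast
  note fin = finite_subset[OF _ V]
  have finT: "finite T" by (rule fin[OF T(1)])
  define lT where "lT = sorted_list_of_set T"
  have lT: "distinct lT" "set lT = T" "length lT = (p - 1) * k"
    using finT T by (auto simp: lT_def)
  have bij: "bij_betw (nth lT) {..<(p - 1) * k} T"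
    by (rule bij_betw_nth) (simp_all only: lT)
  define idx where "idx = the_inv_into {..<(p - 1) * k} (nth lT)"
  have idx: "idx (lT ! i) = i" if "i < (p - 1) * k" for i
    using bij that by (simp add: idx_def bij_betw_def the_inv_into_f_f)
  have idx_lt: "idx v < (p - 1) * k" if "v \<in> T" for v
    using bij that by (auto simp: bij_betw_def idx_def dest: the_inv_into_into)
  define \<epsilon>\<^sub>0 where "\<epsilon>\<^sub>0 = restrict (\<lambda>v. if v \<in> T then Suc (idx v div k) else 0) V"
  have eps_mem: "\<epsilon>\<^sub>0 \<in> V \<rightarrow>\<^sub>E {..<p}"
  proof -
    have "Suc (idx v div k) < p" if "v \<in> T" for v
      using less_mult_imp_div_less[OF idx_lt[OF that]] by simp
    then show ?thesis using p0 by (auto simp: \<epsilon>\<^sub>0_def)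
  qed
  obtain s :: 'a where s: "s = 1 \<or> s = -1"
    "\<And>x. det (mat (p * k) (p * k) (\<lambda>(i, j). if j mod p = i div k then x i ^ (j div p) else 0)) =
      s * block_vander p k x"
    using det_residue_sort[OF T(3) p0] by blast
  \<comment> \<open>The blocks that belong to T and the sorting sign are the same for every G;
    together they form this constant.\<close>
  define \<kappa> where "\<kappa> = s * block_vander (p - 1) k (\<lambda>i. t (lT ! i))"
  have "inj_on (\<lambda>i. t (lT ! i)) {..<(p - 1) * k}"
    using comp_inj_on[of "nth lT" "{..<(p - 1) * k}" t] bij t(1) T(1)
    by (auto simp: bij_betw_def comp_def inj_on_subset)
  then have kappa: "\<kappa> \<noteq> 0"
    using s(1) block_vander_neq_0[OF T(3), of "\<lambda>i. t (lT ! i)" "p - 1"] by (auto simp: \<kappa>_def)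
  \<comment> \<open>Listing T last makes G - T the block number 0 and cuts T into the blocks 1, ...,
    p - 1, in agreement with the values of \<open>\<epsilon>\<^sub>0\<close>. The sign in
    \<open>W\<close> undoes the reordering and equals its own p-th power.\<close>
  define L where "L G = (if T \<subseteq> G then sorted_list_of_set (G - T) @ lT else sorted_list_of_set G)" for G
  define W where "W G \<epsilon> = (if T \<subseteq> G then shuffle_sign T (G - T) else 1) * frob_coeff p t V (L G) \<epsilon>" for G \<epsilon>
  have L: "distinct (L G)" "set (L G) = G" "length (L G) = card G" if "G \<subseteq> V" for G
  proof -
    have "finite G" by (rule fin[OF that])
    then show "distinct (L G)" "set (L G) = G"
      using lT(1,2) finT by (auto simp: L_def)
    then show "length (L G) = card G" using distinct_card[of "L G"] by simp
  qed
  have W1: "W G \<epsilon> \<in> K" if G: "G \<subseteq> V" for G \<epsilon>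
  proof -
    have pow: "a ^ n \<in> K" if "a \<in> K" for a n
      using that by (induction n) (auto intro: K)
    have "t (L G ! i) \<in> K" if "i < length (L G)" for i
      using nth_mem[OF that] L(2)[OF G] G t(2) by blast
    then have "frob_coeff p t V (L G) \<epsilon> \<in> K"
      unfolding frob_coeff_def by (auto intro!: det_closed K pow)
    moreover have "(if T \<subseteq> G then shuffle_sign T (G - T) else 1) \<in> K"
      using shuffle_sign_cases[of T "G - T", where 'a = 'a] K by auto
    ultimately show ?thesis by (simp only: W_def K(2))
  qed
  have split: "vander (\<lambda>i. t (L G ! i)) (card G) = shuffle_sign T (G - T) * vdm t G"
    if G: "G \<subseteq> V" and TG: "T \<subseteq> G" for G
  proof -
    have finG: "finite G" by (rule fin[OF G])
    let ?l0 = "sorted_list_of_set (G - T)"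
    have len: "length ?l0 = card (G - T)" "card G = card (G - T) + card T"
      using finG finT TG by (auto simp: card_Diff_subset card_mono)
    have Lnth: "L G ! i = (if i < card (G - T) then ?l0 ! i else lT ! (i - card (G - T)))" for i
      using TG len by (simp add: L_def nth_append)
    have "vander (\<lambda>i. t (L G ! i)) (card G) = vander (\<lambda>i. t (?l0 ! i)) (card (G - T)) *
        vander (\<lambda>i. t (lT ! i)) (card T) *
        (\<Prod>j<card T. \<Prod>i<card (G - T). t (lT ! j) - t (?l0 ! i))"
      unfolding len(2) vander_append
      by (intro arg_cong2[of _ _ _ _ "(*)"] vander_cong prod.cong) (auto simp: Lnth)
    also have "\<dots> = vdm t (G - T) * vdm t T * (\<Prod>j<card T. \<Prod>i<card (G - T). t (lT ! j) - t (?l0 ! i))"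
      unfolding lT_def using finG finT by (simp add: vander_sorted_list)
    also have "(\<Prod>j<card T. \<Prod>i<card (G - T). t (lT ! j) - t (?l0 ! i)) = (\<Prod>v\<in>T. \<Prod>w\<in>G - T. t v - t w)"
    proof -
      have b: "bij_betw (nth ?l0) {..<card (G - T)} (G - T)"
        by (rule bij_betw_nth) (use finG in auto)
      have "(\<Prod>j<card T. \<Prod>i<card (G - T). t (lT ! j) - t (?l0 ! i)) =
        (\<Prod>j<card T. \<Prod>w\<in>G - T. t (lT ! j) - t w)"
        by (intro prod.cong refl prod.reindex_bij_betw[OF b])
      also have "\<dots> = (\<Prod>v\<in>T. \<Prod>w\<in>G - T. t v - t w)"
        by (rule prod.reindex_bij_betw[OF bij[folded T(2)]])
      finally show ?thesis .
    qed
    finally have *: "vander (\<lambda>i. t (L G ! i)) (card G) =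
      vdm t (G - T) * vdm t T * (\<Prod>v\<in>T. \<Prod>w\<in>G - T. t v - t w)" .
    have "vdm t G = shuffle_sign T (G - T) * (vdm t T * vdm t (G - T) * (\<Prod>v\<in>T. \<Prod>w\<in>G - T. t v - t w))"
      using vdm_Un[of T "G - T" t] finT finG TG by (simp add: Un_absorb1)
    then show ?thesis unfolding * by (simp add: mult_ac)
  qed
  have W2: "vdm t G = (\<Sum>\<epsilon> \<in> V \<rightarrow>\<^sub>E {..<p}. (\<Prod>v\<in>V. t v ^ \<epsilon> v) * W G \<epsilon> ^ p)"
    if G: "G \<subseteq> V" for G
  proof -
    let ?s = "if T \<subseteq> G then shuffle_sign T (G - T) else 1 :: 'a"
    have sp: "?s ^ p = ?s"
      using shuffle_sign_cases[of T "G - T", where 'a = 'a] freshmans_dream_minus_one[where 'a = 'a] p by auto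
    have "vdm t G = ?s * vander (\<lambda>i. t (L G ! i)) (card G)"
    proof (cases "T \<subseteq> G")
      case True then show ?thesis by (simp add: split[OF G True])
    next
      case False
      then show ?thesis using vander_sorted_list[OF fin[OF G], of t] by (simp add: L_def)
    qed
    also have "vander (\<lambda>i. t (L G ! i)) (card G) =
      (\<Sum>\<epsilon> \<in> V \<rightarrow>\<^sub>E {..<p}. (\<Prod>v\<in>V. t v ^ \<epsilon> v) * frob_coeff p t V (L G) \<epsilon> ^ p)"
      unfolding det_vandermonde[symmetric]
      using det_vandermonde_frob_coeff[OF p V, of "L G" t] L[OF G] G by simp
    also have "?s * \<dots> = (\<Sum>\<epsilon> \<in> V \<rightarrow>\<^sub>E {..<p}. (\<Prod>v\<in>V. t v ^ \<epsilon> v) * W G \<epsilon> ^ p)"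
      unfolding W_def power_mult_distrib sp sum_distrib_left by (simp only: mult.left_commute)
    finally show ?thesis .
  qed
  have W3: "W G \<epsilon>\<^sub>0 = (if T \<subseteq> G then shuffle_sign T (G - T) * \<kappa> * vdm t (G - T) else 0)"
    if G: "G \<subseteq> V" "card G = p * k" for G
  proof (cases "T \<subseteq> G")
    case False
    \<comment> \<open>A vertex of T missing from G carries a nonzero exponent outside the list,
      which is the case where \<open>frob_coeff\<close> is 0.\<close>
    then obtain v where "v \<in> T" "v \<notin> G" by blast
    then have "\<epsilon>\<^sub>0 v \<noteq> 0" "v \<in> V - set (L G)" using T(1) L[OF G(1)] by (auto simp: \<epsilon>\<^sub>0_def)
    then show ?thesis using False by (auto simp: W_def frob_coeff_def)
  next
    case True
    let ?l0 = "sorted_list_of_set (G - T)"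
    have finG: "finite G" by (rule fin[OF G(1)])
    have cG: "card (G - T) = k"
    proof -
      have "card (G - T) = p * k - (p - 1) * k"
        using True finT G(2) T(2) by (simp add: card_Diff_subset)
      also have "\<dots> = k" using p0 by (cases p) auto
      finally show ?thesis .
    qed
    have Lnth: "L G ! i = (if i < k then ?l0 ! i else lT ! (i - k))" for i
      using True cG finG by (simp add: L_def nth_append)
    have lenL: "length (L G) = p * k" using L[OF G(1)] G(2) by simp
    \<comment> \<open>The positions below k hold G - T, where the exponent is 0; the shift by k for
      the rest accounts for the \<open>Suc\<close> in \<open>\<epsilon>\<^sub>0\<close>.\<close>
    have eps: "\<epsilon>\<^sub>0 (L G ! i) = i div k" if i: "i < p * k" for i
    proof (cases "i < k")
      case True
      then have "L G ! i \<in> G - T"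
        using nth_mem[of i ?l0] finG cG by (simp add: Lnth)
      then show ?thesis using True G(1) by (auto simp: \<epsilon>\<^sub>0_def)
    next
      case False
      have "k + (p - 1) * k = p * k" using p0 by (cases p) auto
      then have i': "i - k < (p - 1) * k" using i False by linarith
      then have "lT ! (i - k) \<in> T" using nth_mem[of "i - k" lT] lT by simp
      then show ?thesis
        using False i' T(1,3) by (auto simp: \<epsilon>\<^sub>0_def Lnth idx le_div_geq)
    qed
    have "frob_coeff p t V (L G) \<epsilon>\<^sub>0 =
      det (mat (p * k) (p * k) (\<lambda>(i, j). if j mod p = \<epsilon>\<^sub>0 (L G ! i) then t (L G ! i) ^ (j div p) else 0))"
      using L[OF G(1)] True by (auto simp: frob_coeff_def lenL \<epsilon>\<^sub>0_def)
    also have "\<dots> = det (mat (p * k) (p * k) (\<lambda>(i, j). if j mod p = i div k then t (L G ! i) ^ (j div p) else 0))"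
      by (intro arg_cong[of _ _ det] eq_matI) (auto simp: eps)
    also have "\<dots> = s * block_vander p k (\<lambda>i. t (L G ! i))" by (rule s(2))
    also have "block_vander p k (\<lambda>i. t (L G ! i)) =
      vander (\<lambda>i. t (L G ! i)) k * block_vander (p - 1) k (\<lambda>i. t (L G ! (i + k)))"
      using block_vander_Suc[OF T(3), of "p - 1" "\<lambda>i. t (L G ! i)"] p0 by simp
    also have "vander (\<lambda>i. t (L G ! i)) k = vdm t (G - T)"
      using vander_sorted_list[of "G - T" t] finG cG vander_cong[of k "\<lambda>i. t (L G ! i)" "\<lambda>i. t (?l0 ! i)"]
      by (simp add: Lnth)
    also have "(\<lambda>i. t (L G ! (i + k))) = (\<lambda>i. t (lT ! i))" by (simp add: Lnth)
    finally show ?thesis using True by (simp add: W_def \<kappa>_def mult_ac)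
  qed
  show thesis by (rule that[OF kappa eps_mem W1 W2 W3])
qed

section \<open>Monomials\<close>

(* Both rules loop together with in_keys_iff. *)
declare lookup_not_eq_zero_eq_in_keys [simp del] lookup_eq_zero_in_keys_contradict [rule del]

definition mdeg :: "('v \<Rightarrow>\<^sub>0 nat) \<Rightarrow> nat" where
  "mdeg m = (\<Sum>v \<in> keys m. lookup m v)"

abbreviation mon :: "('v \<Rightarrow>\<^sub>0 nat) \<Rightarrow> ('v, 'l::field) mpoly" where
  "mon m \<equiv> Poly_Mapping.single m 1"

lemma keys_add_nat:
  "keys (m + n :: 'v \<Rightarrow>\<^sub>0 nat) = keys m \<union> keys n"
  by (auto simp: in_keys_iff lookup_add)

lemma mdeg_superset:
  "\<lbrakk>finite A; keys m \<subseteq> A\<rbrakk> \<Longrightarrow> mdeg m = (\<Sum>v\<in>A. lookup m v)"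
  unfolding mdeg_def by (rule sum.mono_neutral_left) (auto simp: in_keys_iff)

lemma mdeg_add: "mdeg (m + n) = mdeg m + mdeg n"
proof -
  let ?A = "keys m \<union> keys n"
  have "mdeg (m + n) = (\<Sum>v\<in>?A. lookup (m + n) v)" "mdeg m = (\<Sum>v\<in>?A. lookup m v)"
    "mdeg n = (\<Sum>v\<in>?A. lookup n v)"
    by (auto intro!: mdeg_superset simp: keys_add_nat)
  then show ?thesis by (simp add: lookup_add sum.distrib)
qed

lemma mdeg_zero [simp]: "mdeg 0 = 0"
  by (simp add: mdeg_def)

lemma mdeg_single [simp]: "mdeg (Poly_Mapping.single v a) = a"
  by (simp add: mdeg_def)

lemma card_keys_le_mdeg: "card (keys m) \<le> mdeg m"
proof -
  have "card (keys m) = (\<Sum>v \<in> keys m. 1)" by simp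
  also have "\<dots> \<le> mdeg m"
    unfolding mdeg_def by (rule sum_mono) (simp add: in_keys_iff)
  finally show ?thesis .
qed

lemma lookup_eq_one_if_card_keys_eq_mdeg:
  assumes "card (keys m) = mdeg m" "v \<in> keys m"
  shows "lookup m v = 1"
proof -
  have "(\<Sum>w \<in> keys m. lookup m w) = (\<Sum>w \<in> keys m. 1)"
    using assms(1) by (simp add: mdeg_def)
  then have "(\<Sum>w \<in> keys m. lookup m w - 1) = 0"
    by (subst sum_subtractf_nat) (auto simp: in_keys_iff)
  then have "lookup m v - 1 = 0" using assms(2) by simp
  then show ?thesis using assms(2) by (simp add: in_keys_iff)
qed

lemma exists_lookup_ge_two:
  assumes "card (keys m) \<noteq> mdeg m"
  obtains v where "v \<in> keys m" "lookup m v \<ge> 2"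
proof -
  have "\<exists>v \<in> keys m. lookup m v \<ge> 2"
  proof (rule ccontr)
    assume no: "\<not> ?thesis"
    have "lookup m v = 1" if "v \<in> keys m" for v
    proof -
      have "\<not> 2 \<le> lookup m v" "lookup m v \<noteq> 0"
        using that no by (auto simp: in_keys_iff)
      then show ?thesis by linarith
    qed
    then show False using assms by (simp add: mdeg_def)
  qed
  then show thesis using that by blast
qed

definition set_mon :: "'v set \<Rightarrow> ('v \<Rightarrow>\<^sub>0 nat)" where
  "set_mon S = (\<Sum>v\<in>S. Poly_Mapping.single v 1)"

lemma lookup_set_mon: "finite S \<Longrightarrow> lookup (set_mon S) v = (if v \<in> S then 1 else 0)"
  by (simp add: set_mon_def lookup_sum lookup_single when_def)

lemma keys_set_mon [simp]:
  assumes "finite S"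
  shows "keys (set_mon S) = S"
  unfolding set_eq_iff in_keys_iff lookup_set_mon[OF assms] by simp

lemma mdeg_set_mon [simp]: "finite S \<Longrightarrow> mdeg (set_mon S) = card S"
  by (simp add: mdeg_def lookup_set_mon)

lemma squarefree_monomial:
  assumes "card (keys m) = mdeg m"
  shows "m = set_mon (keys m)"
proof (rule poly_mapping_eqI)
  fix v
  show "lookup m v = lookup (set_mon (keys m)) v"
    using lookup_eq_one_if_card_keys_eq_mdeg[OF assms, of v]
    by (cases "v \<in> keys m") (simp_all add: lookup_set_mon in_keys_iff)
qed

lemma mon_add: "mon (m + n) = mon m * mon n"
  by (simp add: mult_single)

lemma mon_sum: "finite S \<Longrightarrow> mon (sum f S) = (\<Prod>v\<in>S. mon (f v))"
  by (induction S rule: finite_induct) (simp_all add: mon_add)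

lemma face_monomial_eq_mon: "finite S \<Longrightarrow> face_monomial S = mon (set_mon S)"
  by (simp add: face_monomial_def set_mon_def mon_sum Var_def)

lemma Const_mult_mon: "Const c * mon m = Poly_Mapping.single m c"
  by (simp add: Const_def mult_single)

lemma Const_0 [simp]: "Const 0 = 0"
  by (simp add: Const_def)

lemma Const_1 [simp]: "Const 1 = 1"
  by (simp add: Const_def)

lemma Const_add: "Const (a + b) = Const a + Const b"
  by (simp add: Const_def single_add)

lemma Const_mult: "Const (a * b) = Const a * Const b"
  by (simp add: Const_def mult_single)

lemma Const_sum: "Const (sum f S) = (\<Sum>x\<in>S. Const (f x))"
  by (induction S rule: infinite_finite_induct) (simp_all add: Const_add)

lemma Const_power: "Const (a ^ n) = Const a ^ n"
  by (induction n) (simp_all add: Const_mult)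

section \<open>Linear functionals on polynomials\<close>

lemma poly_mapping_sum_singles:
  "(\<Sum>m \<in> keys f. Poly_Mapping.single m (lookup f m)) = f"
  by (rule poly_mapping_eqI) (auto simp: lookup_sum lookup_single when_def in_keys_iff)

text \<open>Both the evaluation at a facet and the degree functional are defined as instances of
  this extension from monomials.\<close>

definition linext :: "('a \<Rightarrow> 'l) \<Rightarrow> ('a \<Rightarrow>\<^sub>0 'l::comm_ring_1) \<Rightarrow> 'l" where
  "linext g f = (\<Sum>m \<in> keys f. lookup f m * g m)"

lemma linext_superset:
  "\<lbrakk>finite A; keys f \<subseteq> A\<rbrakk> \<Longrightarrow> linext g f = (\<Sum>m\<in>A. lookup f m * g m)"
  unfolding linext_def by (rule sum.mono_neutral_left) (auto simp: in_keys_iff)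

lemma linext_add: "linext g (f + f') = linext g f + linext g f'"
proof -
  let ?A = "keys f \<union> keys f'"
  have "linext g (f + f') = (\<Sum>v\<in>?A. lookup (f + f') v * g v)"
    "linext g f = (\<Sum>v\<in>?A. lookup f v * g v)"
    "linext g f' = (\<Sum>v\<in>?A. lookup f' v * g v)"
    using Poly_Mapping.keys_add[of f f'] by (auto intro!: linext_superset)
  then show ?thesis by (simp add: lookup_add sum.distrib algebra_simps)
qed

lemma linext_single [simp]: "linext g (Poly_Mapping.single m c) = c * g m"
  by (cases "c = 0") (simp_all add: linext_def)

lemma linext_zero [simp]: "linext g 0 = 0"
  by (simp add: linext_def)

lemma linext_sum: "linext g (sum f S) = (\<Sum>x\<in>S. linext g (f x))"
  by (induction S rule: infinite_finite_induct) (simp_all add: linext_add)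

lemma linext_Const_mult [simp]: "linext g (Const c * f) = c * linext g f"
proof -
  have "Const c * f = (\<Sum>m \<in> keys f. Poly_Mapping.single m (c * lookup f m))"
    by (subst poly_mapping_sum_singles[of f, symmetric])
      (simp add: Const_def sum_distrib_left mult_single)
  then have "linext g (Const c * f) = (\<Sum>m \<in> keys f. c * lookup f m * g m)"
    by (simp only: linext_sum linext_single)
  then show ?thesis by (simp add: linext_def sum_distrib_left mult.assoc)
qed

lemma linext_minus: "linext g (f - f') = linext g f - linext g f'"
  using linext_add[of g "f - f'" f'] by simp

lemma linext_mult:
  "linext g (f * f') = (\<Sum>m \<in> keys f. \<Sum>n \<in> keys f'.
     lookup f m * lookup f' n * g (m + n))"
proof -
  have "f * f' = (\<Sum>m \<in> keys f. Poly_Mapping.single m (lookup f m)) *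
      (\<Sum>n \<in> keys f'. Poly_Mapping.single n (lookup f' n))"
    by (simp only: poly_mapping_sum_singles)
  then show ?thesis by (simp add: sum_product mult_single linext_sum)
qed

lemma linext_mult_hom:
  assumes "\<And>m n. g (m + n) = g m * g n"
  shows "linext g (f * f') = linext g f * linext g f'"
  unfolding linext_mult by (simp add: assms linext_def sum_product mult_ac)

lemma linext_sum_fun:
  "linext (\<lambda>m. \<Sum>x\<in>A. c x * g x m) f = (\<Sum>x\<in>A. c x * linext (g x) f)"
  unfolding linext_def sum_distrib_left by (subst sum.swap) (simp add: mult_ac)

section \<open>Lagrange interpolation\<close>

lemma prod_linear_factor_coeffs:
  fixes t :: "'v \<Rightarrow> 'l::field"
  assumes "\<And>v. v \<in> A \<Longrightarrow> t v \<in> K"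
    and "0 \<in> K" "1 \<in> K" "\<And>a b. a \<in> K \<Longrightarrow> b \<in> K \<Longrightarrow> a - b \<in> K" "\<And>a b. a \<in> K \<Longrightarrow> b \<in> K \<Longrightarrow> a * b \<in> K"
  shows "poly.coeff (\<Prod>v\<in>A. [:- t v, 1:]) i \<in> K"
  using assms(1)
proof (induction A arbitrary: i rule: infinite_finite_induct)
  case (insert x F)
  let ?q = "\<Prod>v\<in>F. [:- t v, 1:]"
  have q: "poly.coeff ?q i \<in> K" for i using insert by auto
  have "(\<Prod>v\<in>insert x F. [:- t v, 1:]) = pCons 0 ?q - Polynomial.smult (t x) ?q"
    using insert by (simp add: minus_pCons)
  moreover have "- a \<in> K" if "a \<in> K" for a
    using assms(4)[OF assms(2) that] by simp
  ultimately show ?case using q insert.prems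
    by (cases i) (auto simp: assms)
qed (use assms in \<open>auto simp: coeff_pCons split: nat.splits\<close>)

text \<open>The \<open>b i\<close> are the coefficients of X times the Lagrange basis polynomial of
  v, suitably normalized. The factor X removes the constant term, as the moment curve starts with
  exponent 1; it does not vanish at the nodes because they are nonzero.\<close>

lemma interpolation_coeffs:
  fixes t :: "'v \<Rightarrow> 'l::field"
  assumes "\<And>v. v \<in> A \<Longrightarrow> t v \<in> K"
    and K: "0 \<in> K" "1 \<in> K" "\<And>a b. a \<in> K \<Longrightarrow> b \<in> K \<Longrightarrow> a - b \<in> K" "\<And>a b. a \<in> K \<Longrightarrow> b \<in> K \<Longrightarrow> a * b \<in> K"
      "\<And>a. a \<in> K \<Longrightarrow> inverse a \<in> K"
    and A: "finite A" "card A \<le> n" "v \<in> A" "inj_on t A" "\<And>v. v \<in> A \<Longrightarrow> t v \<noteq> 0"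
  obtains b :: "nat \<Rightarrow> 'l" where "\<And>i. b i \<in> K"
    "\<And>w. w \<in> A \<Longrightarrow> (\<Sum>i\<in>{1..n}. b i * t w ^ i) = (if w = v then 1 else 0)"
proof -
  define q where "q = pCons 0 (\<Prod>w\<in>A - {v}. [:- t w, 1:])"
  have poly_q: "poly q x = x * (\<Prod>w\<in>A - {v}. x - t w)" for x
    by (simp add: q_def poly_prod)
  have deg: "Polynomial.degree q \<le> n"
  proof -
    have "Polynomial.degree (\<Prod>w\<in>A - {v}. [:- t w, 1:]) \<le> card (A - {v})"
      using degree_prod_sum_le[of "A - {v}" "\<lambda>w. [:- t w, 1:]"] A(1) by simp
    then have "Polynomial.degree q \<le> Suc (card (A - {v}))"
      unfolding q_def by (meson Suc_le_mono degree_pCons_le le_trans)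
    also have "\<dots> = card A" by (rule card_Suc_Diff1[OF A(1,3)])
    finally show ?thesis using A(2) by simp
  qed
  have coeff_q: "poly.coeff q i \<in> K" for i
    unfolding q_def using K prod_linear_factor_coeffs[of "A - {v}" t K] assms(1)
    by (cases i) auto
  have ne: "poly q (t v) \<noteq> 0"
    using A by (auto simp: poly_q prod_zero_iff inj_on_def)
  have pK: "poly q (t v) \<in> K"
    unfolding poly_q using assms(1) A(3)
  proof -
    have "(\<Prod>w\<in>B. t v - t w) \<in> K" if "B \<subseteq> A" for B
      using that by (induction B rule: infinite_finite_induct) (use assms(1) A(3) in \<open>auto intro!: K\<close>)
    then show "t v * (\<Prod>w\<in>A - {v}. t v - t w) \<in> K" using assms(1) A(3) K by auto
  qed
  have sum: "(\<Sum>i\<in>{1..n}. poly.coeff q i * x ^ i) = poly q x" for x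
  proof -
    have "poly q x = (\<Sum>i\<le>n. poly.coeff q i * x ^ i)"
      unfolding poly_altdef by (rule sum.mono_neutral_left) (use deg in \<open>auto simp: coeff_eq_0\<close>)
    also have "\<dots> = (\<Sum>i\<in>{1..n}. poly.coeff q i * x ^ i)"
      by (rule sum.mono_neutral_right) (auto simp: q_def not_le coeff_pCons split: nat.splits)
    finally show ?thesis by simp
  qed
  show thesis
  proof (rule that[of "\<lambda>i. poly.coeff q i * inverse (poly q (t v))"])
    show "poly.coeff q i * inverse (poly q (t v)) \<in> K" for i
      by (intro K coeff_q pK)
    fix w assume w: "w \<in> A"
    have "(\<Sum>i\<in>{1..n}. poly.coeff q i * inverse (poly q (t v)) * t w ^ i) = poly q (t w) * inverse (poly q (t v))"
      unfolding sum[symmetric] by (simp add: sum_distrib_right mult_ac)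
    also have "\<dots> = (if w = v then 1 else 0)"
    proof (cases "w = v")
      case False
      then have "poly q (t w) = 0" using w A(1) by (auto simp: poly_q prod_zero_iff)
      then show ?thesis using False by simp
    qed (use ne in auto)
    finally show "(\<Sum>i\<in>{1..n}. poly.coeff q i * inverse (poly q (t v)) * t w ^ i) = (if w = v then 1 else 0)" .
  qed
qed

text \<open>Interpolating the values of X ^ i at the nodes gives back X ^ i, since i is below the
  number of nodes. The sum is the coefficient of this interpolation polynomial in degree
  \<open>card F - 1\<close>.\<close>

lemma power_sum_over_lagrange_denominators:
  fixes t :: "'v \<Rightarrow> 'l::field"
  assumes "finite F" "inj_on t F" "i < card F"
  shows "(\<Sum>v\<in>F. t v ^ i * inverse (\<Prod>w\<in>F - {v}. t v - t w)) = (if Suc i = card F then 1 else 0)"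
proof -
  let ?L = "\<lambda>v. \<Prod>w\<in>F - {v}. [:- t w, 1:]"
  let ?D = "\<lambda>v. \<Prod>w\<in>F - {v}. t v - t w"
  have D: "?D v \<noteq> 0" if "v \<in> F" for v
    using that assms by (auto simp: prod_zero_iff inj_on_def)
  define q where "q = (\<Sum>v\<in>F. Polynomial.smult (t v ^ i * inverse (?D v)) (?L v))"
  have degL: "Polynomial.degree (?L v) = card F - 1" if "v \<in> F" for v
    using that assms(1) by (subst degree_prod_eq_sum_degree) auto
  have coeffL: "poly.coeff (?L v) (card F - 1) = 1" if "v \<in> F" for v
  proof -
    have "lead_coeff (?L v) = 1" unfolding lead_coeff_prod by simp
    then show ?thesis by (simp only: degL[OF that])
  qed
  have pq: "poly q (t w) = t w ^ i" if w: "w \<in> F" for w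
  proof -
    have "poly q (t w) = (\<Sum>v\<in>F. t v ^ i * inverse (?D v) * (\<Prod>u\<in>F - {v}. t w - t u))"
      by (simp add: q_def poly_sum poly_prod)
    also have "\<dots> = (\<Sum>v\<in>F. if v = w then t w ^ i else 0)"
    proof (rule sum.cong[OF refl])
      fix v assume v: "v \<in> F"
      show "t v ^ i * inverse (?D v) * (\<Prod>u\<in>F - {v}. t w - t u) = (if v = w then t w ^ i else 0)"
      proof (cases "v = w")
        case False
        then have "(\<Prod>u\<in>F - {v}. t w - t u) = 0" using w assms(1) by (auto simp: prod_zero_iff)
        then show ?thesis using False by simp
      qed (use D v in auto)
    qed
    finally show ?thesis using w assms(1) by simp
  qed
  have "q = Polynomial.monom 1 i"
  proof (rule poly_eqI_degree[of "t ` F"])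
    show "poly q x = poly (Polynomial.monom 1 i) x" if "x \<in> t ` F" for x
      using that pq by (auto simp: poly_monom)
    have card: "card (t ` F) = card F" by (rule card_image[OF assms(2)])
    have "Polynomial.degree q \<le> card F - 1"
      unfolding q_def by (rule degree_sum_le) (use assms(1) degL in \<open>auto intro: order.trans[OF degree_smult_le]\<close>)
    then show "Polynomial.degree q < card (t ` F)" using assms(3) card by simp
    show "Polynomial.degree (Polynomial.monom (1::'l) i) < card (t ` F)"
      using assms(3) card by (simp add: degree_monom_eq)
  qed
  then have "poly.coeff q (card F - 1) = poly.coeff (Polynomial.monom 1 i) (card F - 1)"
    by (rule arg_cong)
  also have "\<dots> = (if Suc i = card F then 1 else 0)"
    using assms(3) by (cases "card F") simp_all
  finally have "poly.coeff q (card F - 1) = (if Suc i = card F then 1 else 0)" .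
  moreover have "poly.coeff q (card F - 1) = (\<Sum>v\<in>F. t v ^ i * inverse (?D v))"
    unfolding q_def coeff_sum by (rule sum.cong[OF refl]) (simp only: coeff_smult coeffL mult_1_right)
  ultimately show ?thesis by simp
qed

section \<open>The degree functional on polynomials\<close>

text \<open>The position of the removed vertex u counts the elements of S below u, which gives the
  sign \<open>shuffle_sign S {u}\<close>. In this form the boundary signs can be matched with those
  of \<open>vdm_Un\<close>.\<close>

lemma lookup_boundary:
  fixes c :: "'v::linorder set \<Rightarrow>\<^sub>0 'k::field"
  assumes "\<And>F. F \<in> keys c \<Longrightarrow> finite F"
  shows "lookup (boundary c) S =
    (\<Sum>F | F \<in> keys c \<and> S \<subseteq> F \<and> card (F - S) = 1.
       shuffle_sign S (F - S) * lookup c F)"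
proof -
  let ?a = "\<lambda>F v. (-1) ^ card {w \<in> F. w < v} * lookup c F"
  have "lookup (boundary c) S =
      (\<Sum>F \<in> keys c. \<Sum>v\<in>F. if F - {v} = S then ?a F v else 0)"
    unfolding boundary_def lookup_sum by (simp add: lookup_single when_def)
  also have "\<dots> = (\<Sum>F \<in> keys c. if S \<subseteq> F \<and> card (F - S) = 1
      then shuffle_sign S (F - S) * lookup c F else 0)"
  proof (rule sum.cong[OF refl])
    fix F assume F: "F \<in> keys c"
    then have finF: "finite F" by (rule assms)
    show "(\<Sum>v\<in>F. if F - {v} = S then ?a F v else 0) = (if S \<subseteq> F \<and> card (F - S) = 1
      then shuffle_sign S (F - S) * lookup c F else 0)"
    proof (cases "S \<subseteq> F \<and> card (F - S) = 1")
      case True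
      then obtain u where u: "F - S = {u}" by (auto simp: card_1_singleton_iff)
      have finS: "finite S" using True finF by (auto dest: finite_subset)
      have "(\<Sum>v\<in>F. if F - {v} = S then ?a F v else 0) = (\<Sum>v\<in>F. if v = u then ?a F u else 0)"
        by (rule sum.cong[OF refl]) (use True u in auto)
      also have "\<dots> = ?a F u" using finF u by auto
      also have "{w \<in> F. w < u} = {w \<in> S. w < u}" using True u by auto
      also have "(-1 :: 'k) ^ card {w \<in> S. w < u} = shuffle_sign S (F - S)"
      proof -
        have "shuffle_sign S (F - S) = (\<Prod>w\<in>S. if w < u then -1 else 1 :: 'k)"
          unfolding shuffle_sign_def u by simp
        also have "\<dots> = (-1) ^ card {w \<in> S. w < u}"
          using finS by (simp add: prod.If_cases Int_def)
        finally show ?thesis by simp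
      qed
      finally show ?thesis using True by simp
    next
      case False
      have "F - {v} \<noteq> S" if v: "v \<in> F" for v
      proof
        assume "F - {v} = S"
        then have "S \<subseteq> F" "F - S = {v}" using v by auto
        with False show False by simp
      qed
      then have "(\<Sum>v\<in>F. if F - {v} = S then ?a F v else 0) = 0"
        by (intro sum.neutral) auto
      then show ?thesis using False by auto
    qed
  qed
  also have "\<dots> = (\<Sum>F | F \<in> keys c \<and> S \<subseteq> F \<and> card (F - S) = 1.
       shuffle_sign S (F - S) * lookup c F)"
    by (simp add: sum.If_cases Int_def)
  finally show ?thesis .
qed

lemma minus_single_plus_single:
  fixes m :: "'v \<Rightarrow>\<^sub>0 nat"
  shows "lookup m v > 0 \<Longrightarrow> m = (m - Poly_Mapping.single v 1) + Poly_Mapping.single v 1"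
  by (rule poly_mapping_eqI) (auto simp: lookup_add lookup_minus lookup_single when_def)

section \<open>Subfields as sets, and the moment curve over such a field\<close>

locale subfield_type =
  fixes K :: "'l::field set"
  assumes K_0 [simp, intro]: "0 \<in> K" and K_1 [simp, intro]: "1 \<in> K"
    and K_diff [intro]: "\<And>a b. a \<in> K \<Longrightarrow> b \<in> K \<Longrightarrow> a - b \<in> K"
    and K_mult [intro]: "\<And>a b. a \<in> K \<Longrightarrow> b \<in> K \<Longrightarrow> a * b \<in> K"
    and K_inverse [intro]: "\<And>a. a \<in> K \<Longrightarrow> inverse a \<in> K"
begin

lemma K_uminus [intro]: "a \<in> K \<Longrightarrow> - a \<in> K"
  using K_diff[of 0 a] by simp

lemma K_add [intro]: "a \<in> K \<Longrightarrow> b \<in> K \<Longrightarrow> a + b \<in> K"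
  using K_diff[of a "- b"] by auto

lemma K_divide [intro]: "a \<in> K \<Longrightarrow> b \<in> K \<Longrightarrow> a / b \<in> K"
  by (auto simp: divide_inverse)

lemma K_power [intro]: "a \<in> K \<Longrightarrow> a ^ n \<in> K"
  by (induction n) auto

lemma K_sum [intro]: "(\<And>x. x \<in> A \<Longrightarrow> f x \<in> K) \<Longrightarrow> sum f A \<in> K"
  by (induction A rule: infinite_finite_induct) auto

lemma K_prod [intro]: "(\<And>x. x \<in> A \<Longrightarrow> f x \<in> K) \<Longrightarrow> prod f A \<in> K"
  by (induction A rule: infinite_finite_induct) auto

lemmas K_closed = K_0 K_1 K_add K_diff K_uminus K_mult K_inverse K_divide K_power K_sum K_prod

end

text \<open>The parameters are only required to be distinct and nonzero. Their algebraic
  independence enters later, through the assumption \<open>indep\<close> of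
  \<open>power_notin_I0\<close>.\<close>

locale moment_curve = subfield_type K for K :: "'l::field set" +
  fixes h :: "'k::field \<Rightarrow> 'l" and \<mu> :: "'v::linorder set \<Rightarrow>\<^sub>0 'k" and d :: nat and t :: "'v \<Rightarrow> 'l"
  assumes h_0 [simp]: "h 0 = 0" and h_1 [simp]: "h 1 = 1" and h_add: "\<And>a b. h (a + b) = h a + h b"
    and h_mult: "\<And>a b. h (a * b) = h a * h b" and h_K [intro]: "\<And>a. h a \<in> K"
    and cycle: "simplicial_cycle (int d - 1) \<mu>"
    and t_inj: "inj_on t (\<Union>(chain_support \<mu>))"
    and t_K [intro]: "\<And>v. v \<in> \<Union>(chain_support \<mu>) \<Longrightarrow> t v \<in> K"
    and t_0: "\<And>v. v \<in> \<Union>(chain_support \<mu>) \<Longrightarrow> t v \<noteq> 0"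
begin

definition "\<Delta> = chain_support \<mu>"
definition "V = \<Union>\<Delta>"

lemma h_uminus: "h (- a) = - h a"
  using h_add[of a "- a"] by (simp add: eq_neg_iff_add_eq_0 add.commute)

lemma h_eq_0_iff [simp]: "h a = 0 \<longleftrightarrow> a = 0"
proof
  assume "h a = 0"
  then have "h (a * inverse a) = 0" by (simp add: h_mult)
  then show "a = 0" by (cases "a = 0") auto
qed simp

lemma h_sum: "h (sum f A) = (\<Sum>x\<in>A. h (f x))"
  by (induction A rule: infinite_finite_induct) (simp_all add: h_add)

lemma facet: "F \<in> keys \<mu> \<Longrightarrow> finite F \<and> card F = d"
  using cycle by (fastforce simp: simplicial_cycle_def chains_def)

lemma facet_V: "F \<in> keys \<mu> \<Longrightarrow> F \<subseteq> V"
  by (auto simp: V_def \<Delta>_def chain_support_def)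

lemma mem_Delta_iff: "S \<in> \<Delta> \<longleftrightarrow> (\<exists>F \<in> keys \<mu>. S \<subseteq> F)"
  by (simp add: \<Delta>_def chain_support_def)

lemma finite_V: "finite V"
proof -
  have "V = \<Union>(keys \<mu>)" by (auto simp: V_def \<Delta>_def chain_support_def)
  then show ?thesis using facet by auto
qed

lemma finite_subset_V: "S \<subseteq> V \<Longrightarrow> finite S"
  using finite_V finite_subset by blast

lemma t_inj_V: "S \<subseteq> V \<Longrightarrow> inj_on t S"
  using t_inj by (auto simp: V_def \<Delta>_def intro: inj_on_subset)

lemma t_V: "v \<in> V \<Longrightarrow> t v \<in> K" "v \<in> V \<Longrightarrow> t v \<noteq> 0"
  using t_K t_0 by (auto simp: V_def \<Delta>_def)

definition theta :: "nat \<Rightarrow> ('v, 'l) mpoly" where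
  "theta i = (\<Sum>v\<in>V. Const (t v ^ i) * Var v)"

text \<open>\<open>lcoef F\<close> are the coordinates of the last unit vector in the basis \<open>(t v, \<dots>, t v ^ d)\<close>, \<open>v \<in> F\<close>.\<close>

definition lcoef :: "'v set \<Rightarrow> 'v \<Rightarrow> 'l" where
  "lcoef F v = (if v \<in> F then inverse (t v * (\<Prod>w\<in>F - {v}. t v - t w)) else 0)"

definition emon :: "'v set \<Rightarrow> ('v \<Rightarrow>\<^sub>0 nat) \<Rightarrow> 'l" where
  "emon F m = (\<Prod>v \<in> keys m. lcoef F v ^ lookup m v)"

lemma emon_superset:
  "\<lbrakk>finite A; keys m \<subseteq> A\<rbrakk> \<Longrightarrow> emon F m = (\<Prod>v\<in>A. lcoef F v ^ lookup m v)"
  unfolding emon_def by (rule prod.mono_neutral_left) (auto simp: in_keys_iff)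

lemma emon_add: "emon F (m + n) = emon F m * emon F n"
proof -
  let ?A = "keys m \<union> keys n"
  have "emon F (m + n) = (\<Prod>v\<in>?A. lcoef F v ^ lookup (m + n) v)"
    "emon F m = (\<Prod>v\<in>?A. lcoef F v ^ lookup m v)"
    "emon F n = (\<Prod>v\<in>?A. lcoef F v ^ lookup n v)"
    by (auto intro!: emon_superset simp: keys_add_nat)
  then show ?thesis by (simp add: lookup_add power_add prod.distrib)
qed

lemma emon_zero [simp]: "emon F 0 = 1"
  by (simp add: emon_def)

lemma emon_single [simp]: "emon F (Poly_Mapping.single v (Suc 0)) = lcoef F v"
  by (simp add: emon_def)

lemma emon_set_mon: "finite S \<Longrightarrow> emon F (set_mon S) = (\<Prod>v\<in>S. lcoef F v)"
  by (simp add: emon_def lookup_set_mon)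

lemma emon_eq_0: "\<not> keys m \<subseteq> F \<Longrightarrow> emon F m = 0"
  by (auto simp: emon_def lcoef_def in_keys_iff intro!: prod_zero)

lemma lcoef_K: "F \<in> keys \<mu> \<Longrightarrow> lcoef F v \<in> K"
  using facet_V[of F] t_V(1) by (auto simp: lcoef_def intro!: K_closed)

lemma emon_K: "F \<in> keys \<mu> \<Longrightarrow> emon F m \<in> K"
  unfolding emon_def by (intro K_closed lcoef_K)

lemma vdm_K: "F \<subseteq> V \<Longrightarrow> vdm t F \<in> K"
  using t_V(1) by (auto simp: vdm_def intro!: K_closed)

text \<open>The extra factor \<open>t v\<close> in the denominator of \<open>lcoef\<close> shifts
  the exponents 1, ..., d of the moment curve to the exponents 0, ..., d - 1 of the Lagrange
  identity.\<close>

lemma sum_power_lcoef: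
  assumes F: "F \<in> keys \<mu>" and i: "i \<in> {1..d}"
  shows "(\<Sum>v\<in>F. t v ^ i * lcoef F v) = (if i = d then 1 else 0)"
proof -
  have "(\<Sum>v\<in>F. t v ^ i * lcoef F v) = (\<Sum>v\<in>F. t v ^ (i - 1) * inverse (\<Prod>w\<in>F - {v}. t v - t w))"
  proof (rule sum.cong[OF refl])
    fix v assume v: "v \<in> F"
    then have "t v \<noteq> 0" using facet_V[OF F] t_V(2) by auto
    moreover have "t v ^ i = t v ^ (i - 1) * t v"
      using i by (cases i) auto
    ultimately show "t v ^ i * lcoef F v = t v ^ (i - 1) * inverse (\<Prod>w\<in>F - {v}. t v - t w)"
      using v by (simp add: lcoef_def)
  qed
  also have "\<dots> = (if Suc (i - 1) = card F then 1 else 0)"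
    by (rule power_sum_over_lagrange_denominators) (use facet[OF F] t_inj_V[OF facet_V[OF F]] i in auto)
  finally show ?thesis using facet[OF F] i by simp
qed

text \<open>Interpolating in the \<open>t v\<close> shows that, modulo the linear forms, a variable of a
  non-squarefree monomial can be replaced by variables outside the support.\<close>

lemma monomial_mem_if_squarefree_mem:
  fixes N :: "('v, 'l) mpoly set"
  assumes N_add: "\<And>f g. f \<in> N \<Longrightarrow> g \<in> N \<Longrightarrow> f + g \<in> N"
    and N_scale: "\<And>c f. c \<in> K \<Longrightarrow> f \<in> N \<Longrightarrow> Const c * f \<in> N"
    and N_0: "0 \<in> N"
    and N_theta: "\<And>i m. i \<in> {1..n} \<Longrightarrow> keys m \<subseteq> V \<Longrightarrow> Suc (mdeg m) = j \<Longrightarrow> theta i * mon m \<in> N"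
    and base: "\<And>m. keys m \<subseteq> V \<Longrightarrow> mdeg m = j \<Longrightarrow>
      card (keys m) = j \<or> n < card (keys m) \<Longrightarrow> mon m \<in> N"
    and m: "keys m \<subseteq> V" "mdeg m = j"
  shows "mon m \<in> N"
  using m
\<comment> \<open>Every replacement adds a vertex to the support, so the number of vertices outside
  it decreases.\<close>
proof (induction "card V - card (keys m)" arbitrary: m rule: less_induct)
  case less
  have N_sum: "sum f A \<in> N" if "\<And>x. x \<in> A \<Longrightarrow> f x \<in> N" for f :: "'b \<Rightarrow> _" and A
    using that by (induction A rule: infinite_finite_induct) (auto intro: N_add N_0)
  show ?case
  proof (cases "card (keys m) = j \<or> n < card (keys m)")
    case True
    then show ?thesis using base less.prems by blast
  next
    case False
    let ?A = "keys m"
    obtain v where v: "v \<in> ?A" "lookup m v \<ge> 2"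
      using exists_lookup_ge_two[of m] False less.prems by auto
    \<comment> \<open>The support has at most n vertices here, so some combination of the n linear
      forms has coefficient 1 at v and 0 at the other vertices of the support.\<close>
    obtain b where b: "\<And>i. b i \<in> K"
      "\<And>w. w \<in> ?A \<Longrightarrow> (\<Sum>i\<in>{1..n}. b i * t w ^ i) = (if w = v then 1 else 0)"
      by (rule interpolation_coeffs[of ?A t K n v])
        (use less.prems t_V v False t_inj_V[of ?A] in auto)
    define L where "L w = (\<Sum>i\<in>{1..n}. b i * t w ^ i)" for w
    have L_K: "L w \<in> K" if "w \<in> V" for w
      unfolding L_def by (intro K_closed b(1) t_V(1) that)
    define m' where "m' = m - Poly_Mapping.single v 1"
    have m': "m = m' + Poly_Mapping.single v 1"
      unfolding m'_def using v by (intro minus_single_plus_single) auto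
    \<comment> \<open>The exponent of v is at least two, so v survives the removal of one factor and
      a new vertex strictly enlarges the support.\<close>
    have keys_m': "keys m' = ?A"
      using v by (auto simp: m'_def in_keys_iff lookup_minus lookup_single when_def)
    have deg_m': "Suc (mdeg m') = j"
      using less.prems(2) by (subst (asm) m') (simp add: mdeg_add)
    have "(\<Sum>i\<in>{1..n}. Const (b i) * theta i) = (\<Sum>w\<in>V. Const (L w) * Var w)"
      unfolding theta_def L_def Const_sum sum_distrib_left sum_distrib_right Const_mult mult.assoc
      by (rule sum.swap)
    also have "\<dots> = (\<Sum>w\<in>?A. Const (L w) * Var w) + (\<Sum>w\<in>V - ?A. Const (L w) * Var w)"
      by (rule sum.subset_diff[OF less.prems(1) finite_V, unfolded add.commute[of "sum _ (V - ?A)"]])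
    also have "(\<Sum>w\<in>?A. Const (L w) * Var w) = (\<Sum>w\<in>?A. if w = v then Var v else 0 :: ('v, 'l) mpoly)"
    proof (rule sum.cong[OF refl])
      fix w assume "w \<in> ?A"
      then have "L w = (if w = v then 1 else 0)" unfolding L_def by (rule b(2))
      then show "Const (L w) * Var w = (if w = v then Var v else 0 :: ('v, 'l) mpoly)" by simp
    qed
    also have "\<dots> = Var v" using v by simp
    finally have eq: "(\<Sum>i\<in>{1..n}. Const (b i) * theta i) = Var v + (\<Sum>w\<in>V - ?A. Const (L w) * Var w)" .
    have "mon m = Var v * mon m'"
      by (subst m') (simp add: mon_add Var_def mult.commute)
    also have "Var v = (\<Sum>i\<in>{1..n}. Const (b i) * theta i) - (\<Sum>w\<in>V - ?A. Const (L w) * Var w)"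
      using eq by simp
    also have "\<dots> * mon m' = (\<Sum>i\<in>{1..n}. Const (b i) * (theta i * mon m')) +
        (\<Sum>w\<in>V - ?A. Const (- L w) * mon (Poly_Mapping.single w 1 + m'))"
      by (simp add: left_diff_distrib sum_distrib_right mult.assoc mon_add Var_def Const_def
          single_uminus sum_negf)
    also have "\<dots> \<in> N"
    proof (intro N_add N_sum)
      fix i assume "i \<in> {1..n}"
      then show "Const (b i) * (theta i * mon m') \<in> N"
        using less.prems keys_m' deg_m' b(1) by (intro N_scale N_theta) auto
    next
      fix w assume w: "w \<in> V - ?A"
      let ?m = "Poly_Mapping.single w 1 + m'"
      have k: "keys ?m = insert w ?A" by (simp add: keys_add_nat keys_m')
      have "mon ?m \<in> N"
      proof (rule less.hyps)
        have "card (insert w ?A) \<le> card V"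
          using w less.prems finite_V by (intro card_mono) auto
        then show "card V - card (keys ?m) < card V - card ?A"
          unfolding k using w by simp
        show "keys ?m \<subseteq> V" unfolding k using w less.prems by auto
        show "mdeg ?m = j" using deg_m' by (simp add: mdeg_add)
      qed
      then show "Const (- L w) * mon ?m \<in> N"
        using w L_K by (intro N_scale) auto
    qed
    finally show ?thesis .
  qed
qed

end

section \<open>The degree functional as a sum over facets\<close>

lemma det_vandermonde_shifted:
  fixes x :: "nat \<Rightarrow> 'a::idom"
  shows "det (mat n n (\<lambda>(i, j). x j ^ Suc i)) = (\<Prod>i<n. x i) * vander x n"
proof -
  let ?A = "mat n n (\<lambda>(i, j). x i ^ Suc j)" and ?B = "mat n n (\<lambda>(i, j). x i ^ j)"
  have "det (mat n n (\<lambda>(i, j). x j ^ Suc i)) = det ?A\<^sup>T"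
    by (intro arg_cong[of _ _ det] eq_matI) auto
  also have "\<dots> = det ?A" by (rule det_transpose[of _ n]) simp
  also have "\<dots> = (\<Sum>\<pi> | \<pi> permutes {0..<n}. of_int (sign \<pi>) * (\<Prod>i = 0..<n. ?A $$ (i, \<pi> i)))"
    by (rule det_def') simp
  also have "\<dots> = (\<Sum>\<pi> | \<pi> permutes {0..<n}. (\<Prod>i<n. x i) * (of_int (sign \<pi>) * (\<Prod>i = 0..<n. ?B $$ (i, \<pi> i))))"
  proof (rule sum.cong[OF refl])
    fix \<pi> assume pi: "\<pi> \<in> {\<pi>. \<pi> permutes {0..<n}}"
    have "(\<Prod>i = 0..<n. ?A $$ (i, \<pi> i)) = (\<Prod>i = 0..<n. x i * ?B $$ (i, \<pi> i))"
      by (rule prod.cong[OF refl]) (use pi permutes_in_image[of \<pi> "{0..<n}"] in auto)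
    then show "of_int (sign \<pi>) * (\<Prod>i = 0..<n. ?A $$ (i, \<pi> i)) =
      (\<Prod>i<n. x i) * (of_int (sign \<pi>) * (\<Prod>i = 0..<n. ?B $$ (i, \<pi> i)))"
      by (simp only: prod.distrib atLeast0LessThan mult_ac)
  qed
  also have "\<dots> = (\<Prod>i<n. x i) * det ?B"
    unfolding sum_distrib_left[symmetric] by (subst det_def'[of ?B n]) simp_all
  finally show ?thesis by (simp add: det_vandermonde)
qed

context moment_curve
begin

text \<open>\<open>phi\<close> is the degree map written as a sum over facets (localization at the last unit vector): on the facet \<open>F\<close> each
  variable is evaluated at the corresponding coordinate \<open>lcoef F v\<close>.  This evaluation annihilates all
  linear forms but the last one, which it sends to 1.\<close>

definition wt :: "'v set \<Rightarrow> 'l" where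
  "wt F = h (lookup \<mu> F) * vdm t F"

text \<open>The sign between \<open>\<Prod>v\<in>F. \<Prod>w\<in>F - {v}. t v - t w\<close> and \<open>(vdm t F)\<^sup>2\<close>.\<close>

definition pairsign :: 'l where
  "pairsign = (\<Prod>j<d. \<Prod>i<j. -1)"

definition phi :: "('v, 'l) mpoly \<Rightarrow> 'l" where
  "phi = linext (\<lambda>m. if mdeg m = d then pairsign * (\<Sum>F \<in> keys \<mu>. wt F * emon F m) else 0)"

definition ev :: "'v set \<Rightarrow> ('v, 'l) mpoly \<Rightarrow> 'l" where
  "ev F = linext (emon F)"

lemma ev_mult: "ev F (f * g) = ev F f * ev F g"
  unfolding ev_def by (rule linext_mult_hom) (rule emon_add)

lemma ev_mon [simp]: "ev F (mon m) = emon F m"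
  by (simp add: ev_def)

lemma ev_power: "ev F (f ^ n) = ev F f ^ n"
proof (induction n)
  case 0
  show ?case using ev_mon[of F 0] by simp
qed (simp add: ev_mult)

lemma ev_theta:
  assumes F: "F \<in> keys \<mu>" and i: "i \<in> {1..d}"
  shows "ev F (theta i) = (if i = d then 1 else 0)"
proof -
  have "ev F (theta i) = (\<Sum>v\<in>V. t v ^ i * lcoef F v)"
    by (simp add: theta_def ev_def linext_sum Var_def)
  also have "\<dots> = (\<Sum>v\<in>F. t v ^ i * lcoef F v)"
    by (rule sum.mono_neutral_right) (use finite_V facet_V[OF F] in \<open>auto simp: lcoef_def\<close>)
  finally show ?thesis using sum_power_lcoef[OF F i] by simp
qed

lemma phi_add: "phi (f + g) = phi f + phi g"
  unfolding phi_def by (rule linext_add)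

lemma phi_minus: "phi (f - g) = phi f - phi g"
  unfolding phi_def by (rule linext_minus)

lemma phi_zero [simp]: "phi 0 = 0"
  by (simp add: phi_def)

lemma phi_sum: "phi (sum f A) = (\<Sum>x\<in>A. phi (f x))"
  unfolding phi_def by (rule linext_sum)

lemma phi_Const_mult [simp]: "phi (Const c * f) = c * phi f"
  unfolding phi_def by simp

lemma phi_single: "phi (Poly_Mapping.single m c) = c * phi (mon m)"
  unfolding phi_def by simp

lemma phi_hom:
  assumes "\<And>m. m \<in> keys f \<Longrightarrow> mdeg m = d"
  shows "phi f = pairsign * (\<Sum>F \<in> keys \<mu>. wt F * ev F f)"
proof -
  have "phi f = linext (\<lambda>m. pairsign * (\<Sum>F \<in> keys \<mu>. wt F * emon F m)) f"
    unfolding phi_def linext_def by (rule sum.cong) (use assms in auto)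
  also have "\<dots> = pairsign * (\<Sum>F \<in> keys \<mu>. wt F * ev F f)"
    unfolding ev_def linext_sum_fun[symmetric] by (simp add: linext_def sum_distrib_left mult_ac)
  finally show ?thesis .
qed

lemma phi_other_degree:
  assumes "\<And>m. m \<in> keys f \<Longrightarrow> mdeg m \<noteq> d"
  shows "phi f = 0"
  unfolding phi_def linext_def by (rule sum.neutral) (use assms in auto)

lemma pairsign_cases: "pairsign = 1 \<or> pairsign = -1"
proof -
  have "(-1 :: 'l) ^ n = 1 \<or> (-1 :: 'l) ^ n = -1" for n by (induction n) auto
  moreover have "pairsign = (-1) ^ (\<Sum>j<d. j)"
    by (simp add: pairsign_def power_sum)
  ultimately show ?thesis by simp
qed

lemma pairsign_K [intro]: "pairsign \<in> K" and pairsign_neq_0 [simp]: "pairsign \<noteq> 0"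
  using pairsign_cases K_uminus[OF K_1] by auto

lemma wt_K: "F \<in> keys \<mu> \<Longrightarrow> wt F \<in> K"
  unfolding wt_def by (intro K_mult h_K vdm_K facet_V)

lemma phi_K:
  assumes "\<And>m. lookup f m \<in> K"
  shows "phi f \<in> K"
  unfolding phi_def linext_def
proof (rule K_sum)
  fix m
  have "pairsign * (\<Sum>F \<in> keys \<mu>. wt F * emon F m) \<in> K"
    by (intro K_mult K_sum pairsign_K wt_K emon_K)
  then show "lookup f m *
    (if mdeg m = d then pairsign * (\<Sum>F \<in> keys \<mu>. wt F * emon F m) else 0) \<in> K"
    by (intro K_mult assms) (simp del: mult_eq_0_iff)
qed

text \<open>The factor of \<open>vdm t F * (\<Prod>v\<in>S. lcoef F v)\<close> that is common to all
  facets F containing S.\<close>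

definition face_const :: "'v set \<Rightarrow> 'l" where
  "face_const S = vdm t S * (\<Prod>v\<in>S. inverse (t v * (\<Prod>u\<in>S - {v}. t v - t u)))"

lemma face_const_neq_0: "S \<subseteq> V \<Longrightarrow> face_const S \<noteq> 0"
proof -
  assume S: "S \<subseteq> V"
  have "finite S" by (rule finite_subset_V[OF S])
  then show ?thesis
    using S vdm_neq_0[OF _ t_inj_V[OF S]] t_V(2) t_inj_V[OF S]
    by (fastforce simp: face_const_def prod_zero_iff inj_on_def)
qed

text \<open>The mixed factors t v - t w with v in S and w in F - S, which \<open>vdm_Un\<close>
  splits off, cancel against the same factors in the denominators of \<open>lcoef\<close>.\<close>

lemma vdm_mult_lcoef:
  assumes "F \<subseteq> V" "S \<subseteq> F"
  shows "vdm t F * (\<Prod>v\<in>S. lcoef F v) = shuffle_sign S (F - S) * vdm t (F - S) * face_const S"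
proof -
  have fin: "finite F" "finite S" using assms finite_subset_V by blast+
  have F: "S \<union> (F - S) = F" using assms by auto
  have "vdm t F = shuffle_sign S (F - S) * (vdm t S * vdm t (F - S) * (\<Prod>v\<in>S. \<Prod>w\<in>F - S. t v - t w))"
    using vdm_Un[of S "F - S" t] fin F by auto
  moreover have "(\<Prod>v\<in>S. \<Prod>w\<in>F - S. t v - t w) * (\<Prod>v\<in>S. lcoef F v) =
      (\<Prod>v\<in>S. inverse (t v * (\<Prod>u\<in>S - {v}. t v - t u)))"
    unfolding prod.distrib[symmetric]
  proof (rule prod.cong[OF refl])
    fix v assume v: "v \<in> S"
    have eq: "F - {v} = (S - {v}) \<union> (F - S)" using v assms by auto
    have split: "(\<Prod>w\<in>F - {v}. t v - t w) = (\<Prod>u\<in>S - {v}. t v - t u) * (\<Prod>w\<in>F - S. t v - t w)"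
      unfolding eq by (rule prod.union_disjoint) (use fin in auto)
    have "(\<Prod>w\<in>F - S. t v - t w) \<noteq> 0"
      using v assms fin by (subst prod_zero_iff) (auto dest!: inj_onD[OF t_inj_V[OF assms(1)]])
    then show "(\<Prod>w\<in>F - S. t v - t w) * lcoef F v = inverse (t v * (\<Prod>u\<in>S - {v}. t v - t u))"
      using v assms by (auto simp: lcoef_def split)
  qed
  ultimately show ?thesis by (simp add: face_const_def mult_ac)
qed

lemma emon_set_mon_eq_0: "finite S \<Longrightarrow> \<not> S \<subseteq> F \<Longrightarrow> emon F (set_mon S) = 0"
  by (rule emon_eq_0) simp

lemma wt_emon_set_mon:
  assumes F: "F \<in> keys \<mu>" and S: "S \<subseteq> V"
  shows "wt F * emon F (set_mon S) = (if S \<subseteq> F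
    then face_const S * (h (lookup \<mu> F) * (shuffle_sign S (F - S) * vdm t (F - S))) else 0)"
proof (cases "S \<subseteq> F")
  case True
  then show ?thesis using vdm_mult_lcoef[OF facet_V[OF F] True] finite_subset_V[OF S]
    by (simp add: wt_def emon_set_mon mult.assoc)
qed (use S in \<open>auto simp: emon_set_mon_eq_0 finite_subset_V\<close>)

text \<open>For each facet F through S the set F - S is a single vertex, so its Vandermonde product
  is 1 and the sum becomes \<open>face_const S\<close> times the coefficient of the boundary of
  \<mu> at S.\<close>

lemma sum_wt_emon_codim_one:
  assumes S: "S \<subseteq> V" "Suc (card S) = d"
  shows "(\<Sum>F \<in> keys \<mu>. wt F * emon F (set_mon S)) = 0"
proof -
  have fin: "finite S" by (rule finite_subset_V[OF S(1)])
  let ?X = "{F \<in> keys \<mu>. S \<subseteq> F}"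
  have X: "?X = {F \<in> keys \<mu>. S \<subseteq> F \<and> card (F - S) = 1}"
    using facet S(2) fin by (auto simp: card_Diff_subset)
  have vdm1: "vdm t (F - S) = 1" if F: "F \<in> ?X" for F
  proof -
    obtain u where "F - S = {u}" using F X by (auto simp: card_1_singleton_iff)
    then show ?thesis by simp
  qed
  have sgn: "h (shuffle_sign A B) = shuffle_sign A B" for A B :: "'v set"
  proof -
    have "h (prod f A) = (\<Prod>x\<in>A. h (f x))" for f :: "'v \<Rightarrow> 'k" and A
      by (induction A rule: infinite_finite_induct) (simp_all add: h_mult)
    then show ?thesis by (simp add: shuffle_sign_def if_distrib h_uminus cong: if_cong)
  qed
  have "(\<Sum>F \<in> keys \<mu>. wt F * emon F (set_mon S)) =
    (\<Sum>F \<in> ?X. face_const S * (h (lookup \<mu> F) * (shuffle_sign S (F - S) * vdm t (F - S))))"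
    by (simp add: wt_emon_set_mon[OF _ S(1)] sum.If_cases Int_def cong: sum.cong)
  also have "\<dots> = (\<Sum>F \<in> ?X. face_const S * h (shuffle_sign S (F - S) * lookup \<mu> F))"
    by (rule sum.cong[OF refl]) (simp add: vdm1 sgn h_mult mult_ac)
  also have "\<dots> = face_const S * h (lookup (boundary \<mu>) S)"
    by (subst lookup_boundary) (simp_all only: X h_sum sum_distrib_left facet)
  also have "\<dots> = 0" using cycle by (simp add: simplicial_cycle_def)
  finally show ?thesis .
qed

text \<open>For squarefree monomials this is the cycle condition; the linear forms other than the last one
  reduce the general case to it.\<close>

lemma sum_wt_emon_eq_0:
  assumes m: "keys m \<subseteq> V" "Suc (mdeg m) = d"
  shows "(\<Sum>F \<in> keys \<mu>. wt F * emon F m) = 0"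
proof -
  define N where "N = {f. (\<Sum>F \<in> keys \<mu>. wt F * ev F f) = 0}"
  have "mon m \<in> N"
  \<comment> \<open>The last linear form evaluates to 1 and cannot be used here, hence n = d - 1. As
    the degree is also d - 1, a support with more than n vertices does not occur, and only
    squarefree monomials remain.\<close>
  proof (rule monomial_mem_if_squarefree_mem[where n = "d - 1" and j = "mdeg m"])
    fix f g assume "f \<in> N" "g \<in> N"
    then show "f + g \<in> N" by (simp add: N_def ev_def linext_add distrib_left sum.distrib)
  next
    fix c :: 'l and f :: "('v, 'l) mpoly" assume f: "f \<in> N"
    have "(\<Sum>F \<in> keys \<mu>. wt F * ev F (Const c * f)) =
      c * (\<Sum>F \<in> keys \<mu>. wt F * ev F f)"
      by (simp add: ev_def sum_distrib_left mult.left_commute)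
    then show "Const c * f \<in> N" using f by (simp add: N_def)
  next
    show "0 \<in> N" by (simp add: N_def ev_def)
  next
    fix i m' assume i: "i \<in> {1..d - 1}"
    have "ev F (theta i) = 0" if F: "F \<in> keys \<mu>" for F
      using ev_theta[OF F, of i] i by auto
    then show "theta i * mon m' \<in> N" by (simp add: N_def ev_mult)
  next
    fix m' :: "'v \<Rightarrow>\<^sub>0 nat"
    assume m': "keys m' \<subseteq> V" "mdeg m' = mdeg m"
      "card (keys m') = mdeg m \<or> d - 1 < card (keys m')"
    then have eq: "card (keys m') = mdeg m'"
      using card_keys_le_mdeg[of m'] m by auto
    show "mon m' \<in> N"
      using sum_wt_emon_codim_one[OF m'(1)] squarefree_monomial[OF eq] eq m' m by (simp add: N_def)
  qed (use m in auto)
  then show ?thesis by (simp add: N_def)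
qed

text \<open>For i < d the linear form evaluates to 0 at every facet. For i = d it evaluates to 1,
  which leaves the sum for a monomial of degree d - 1, and this vanishes by the cycle
  condition.\<close>

lemma phi_theta_mult:
  assumes i: "i \<in> {1..d}" and m: "keys m \<subseteq> V"
  shows "phi (theta i * mon m) = 0"
proof -
  have eq: "theta i * mon m = (\<Sum>v\<in>V. Poly_Mapping.single (Poly_Mapping.single v 1 + m) (t v ^ i))"
    by (simp add: theta_def sum_distrib_right Const_def Var_def mult_single)
  have keys: "mdeg n = Suc (mdeg m)" if n: "n \<in> keys (theta i * mon m)" for n
  proof -
    have "lookup (theta i * mon m) n \<noteq> 0" using n by (simp add: in_keys_iff)
    then have "\<exists>v\<in>V. lookup (Poly_Mapping.single (Poly_Mapping.single v 1 + m) (t v ^ i)) n \<noteq> 0"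
      unfolding eq lookup_sum by (rule contrapos_np) (simp add: sum.neutral)
    then obtain v where "n = Poly_Mapping.single v 1 + m"
      by (auto simp: lookup_single when_def split: if_splits)
    then show ?thesis by (simp add: mdeg_add)
  qed
  show ?thesis
  proof (cases "Suc (mdeg m) = d")
    case False
    then show ?thesis using keys by (intro phi_other_degree) auto
  next
    case True
    have "phi (theta i * mon m) = pairsign * (\<Sum>F \<in> keys \<mu>. wt F * ev F (theta i * mon m))"
      by (rule phi_hom) (use keys True in auto)
    also have "(\<Sum>F \<in> keys \<mu>. wt F * ev F (theta i * mon m)) =
      (\<Sum>F \<in> keys \<mu>. (if i = d then 1 else 0) * (wt F * emon F m))"
      by (rule sum.cong[OF refl]) (simp add: ev_mult ev_theta[OF _ i])
    also have "\<dots> = 0"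
      unfolding sum_distrib_left[symmetric] sum_wt_emon_eq_0[OF m True] by simp
    finally show ?thesis by simp
  qed
qed

lemma phi_nonface_mult:
  assumes S: "S \<subseteq> V" "S \<notin> \<Delta>"
  shows "phi (face_monomial S * mon m) = 0"
proof -
  have "emon F (set_mon S + m) = 0" if "F \<in> keys \<mu>" for F
    using that S finite_subset_V[OF S(1)] mem_Delta_iff[of S]
    by (intro emon_eq_0) (auto simp: keys_add_nat)
  then show ?thesis
    by (simp add: face_monomial_eq_mon[OF finite_subset_V[OF S(1)]] phi_def flip: mon_add)
qed

text \<open>Facets have equal size, so only F itself contributes. Its Lagrange denominators multiply
  to the square of the Vandermonde product up to \<open>pairsign\<close>, and one Vandermonde factor
  cancels against the weight.\<close>

lemma phi_facet:
  assumes F: "F \<in> \<Delta>" "card F = d"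
    and a: "\<And>i v. i \<in> {1..d} \<Longrightarrow> v \<in> V \<Longrightarrow> a i v = t v ^ i"
  shows "phi (face_monomial F) = h (lookup \<mu> F) / theta_minor d a F"
    and "theta_minor d a F \<noteq> 0" and "F \<in> keys \<mu>"
proof -
  obtain F' where F': "F' \<in> keys \<mu>" "F \<subseteq> F'" using F mem_Delta_iff by auto
  have "F = F'" using F' F(2) facet[OF F'(1)] by (intro card_subset_eq) auto
  then show FK: "F \<in> keys \<mu>" using F' by simp
  note fin = facet[OF FK, THEN conjunct1] and FV = facet_V[OF FK]
  let ?x = "\<lambda>j. t (sorted_list_of_set F ! j)"
  have nth: "sorted_list_of_set F ! j \<in> F" if "j < d" for j
    using that nth_mem[of j "sorted_list_of_set F"] fin F(2) by simp
  have a_nth: "a (Suc i) (sorted_list_of_set F ! j) = ?x j ^ Suc i" if "i < d" "j < d" for i j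
    by (rule a) (use that nth[OF that(2)] FV in auto)
  have bij: "bij_betw (nth (sorted_list_of_set F)) {..<d} F"
    by (rule bij_betw_nth) (use fin F(2) in auto)
  have "theta_minor d a F = det (mat d d (\<lambda>(i, j). ?x j ^ Suc i))"
    unfolding theta_minor_def
    by (intro arg_cong[of _ _ det] eq_matI) (simp_all add: a_nth del: power_Suc)
  also have "\<dots> = (\<Prod>j<d. ?x j) * vander ?x d" by (rule det_vandermonde_shifted)
  also have "(\<Prod>j<d. ?x j) = prod t F" by (rule prod.reindex_bij_betw[OF bij])
  also have "vander ?x d = vdm t F" using vander_sorted_list[OF fin, of t] F(2) by simp
  finally have minor: "theta_minor d a F = prod t F * vdm t F" .
  have "prod t F \<noteq> 0" using fin FV t_V(2) by (subst prod_zero_iff) auto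
  moreover have vne: "vdm t F \<noteq> 0" by (rule vdm_neq_0[OF fin t_inj_V[OF FV]])
  ultimately show "theta_minor d a F \<noteq> 0" by (simp add: minor)
  \<comment> \<open>Each pair occurs in both orders: once with the orientation of
    \<open>vdm\<close>, and once with the opposite one, at the cost of a factor -1.\<close>
  have sq: "(\<Prod>v\<in>F. \<Prod>w\<in>F - {v}. t v - t w) = pairsign * vdm t F * vdm t F"
  proof -
    have split: "(\<Prod>w\<in>F - {v}. t v - t w) =
        (\<Prod>w | w \<in> F \<and> w < v. t v - t w) * (\<Prod>w | w \<in> F \<and> v < w. t v - t w)" for v
    proof -
      have eq: "F - {v} = {w \<in> F. w < v} \<union> {w \<in> F. v < w}" by auto
      have "finite {w \<in> F. w < v}" "finite {w \<in> F. v < w}" using fin by simp_all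
      moreover have "{w \<in> F. w < v} \<inter> {w \<in> F. v < w} = {}" by auto
      ultimately show ?thesis by (subst eq) (rule prod.union_disjoint)
    qed
    have "(\<Prod>v\<in>F. \<Prod>w | w \<in> F \<and> v < w. t v - t w) = (\<Prod>v\<in>F. \<Prod>w\<in>F. if v < w then t v - t w else 1)"
      using fin by (intro prod.cong refl prod.mono_neutral_cong_left) auto
    also have "\<dots> = (\<Prod>w\<in>F. \<Prod>v\<in>F. if v < w then t v - t w else 1)"
      by (rule prod.swap)
    also have "\<dots> = (\<Prod>w\<in>F. \<Prod>v | v \<in> F \<and> v < w. (-1) * (t w - t v))"
      using fin by (intro prod.cong refl prod.mono_neutral_cong_right) auto
    also have "\<dots> = (\<Prod>w\<in>F. \<Prod>v | v \<in> F \<and> v < w. -1) * vdm t F"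
      by (simp only: prod.distrib vdm_def)
    also have "(\<Prod>w\<in>F. \<Prod>v | v \<in> F \<and> v < w. -1 :: 'l) = pairsign"
      using prod_pairs_sorted_list[OF fin, of "\<lambda>_ _. -1 :: 'l"] F(2) by (simp only: pairsign_def)
    finally have "(\<Prod>v\<in>F. \<Prod>w | w \<in> F \<and> v < w. t v - t w) = pairsign * vdm t F" .
    then show ?thesis
      unfolding split prod.distrib by (simp add: vdm_def mult_ac)
  qed
  have phi0: "phi (face_monomial F) = pairsign * (\<Sum>G \<in> keys \<mu>. wt G * emon G (set_mon F))"
    by (simp add: face_monomial_eq_mon[OF fin] phi_def fin F(2))
  have "(\<Sum>G \<in> keys \<mu>. wt G * emon G (set_mon F)) =
      (\<Sum>G \<in> keys \<mu>. if G = F then wt F * emon F (set_mon F) else 0)"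
  proof (rule sum.cong[OF refl])
    fix G assume G: "G \<in> keys \<mu>"
    have "\<not> F \<subseteq> G" if "G \<noteq> F" using that card_subset_eq[of G F] facet[OF G] F(2) by auto
    then show "wt G * emon G (set_mon F) = (if G = F then wt F * emon F (set_mon F) else 0)"
      using emon_set_mon_eq_0[OF fin] by auto
  qed
  also have "\<dots> = wt F * (\<Prod>v\<in>F. lcoef F v)"
    using FK by (simp add: emon_set_mon[OF fin])
  also have "(\<Prod>v\<in>F. lcoef F v) = inverse (prod t F * (pairsign * vdm t F * vdm t F))"
    unfolding sq[symmetric] prod.distrib[symmetric] prod_inversef[symmetric]
    by (rule prod.cong) (auto simp: lcoef_def)
  finally have s: "(\<Sum>G \<in> keys \<mu>. wt G * emon G (set_mon F)) =
    wt F * inverse (prod t F * (pairsign * vdm t F * vdm t F))" .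
  show "phi (face_monomial F) = h (lookup \<mu> F) / theta_minor d a F"
  proof -
    have ps: "pairsign * inverse pairsign = 1" by simp
    have "phi (face_monomial F) = pairsign * (wt F * inverse (prod t F * (pairsign * vdm t F * vdm t F)))"
      by (simp only: phi0 s)
    also have "\<dots> = (pairsign * inverse pairsign) * (vdm t F * inverse (vdm t F)) *
        (h (lookup \<mu> F) * (inverse (prod t F) * inverse (vdm t F)))"
      by (simp only: wt_def inverse_mult_distrib mult_ac)
    also have "\<dots> = h (lookup \<mu> F) / theta_minor d a F"
      using vne by (simp add: ps minor divide_inverse)
    finally show ?thesis .
  qed
qed

end

section \<open>The quotient rings\<close>

context moment_curve
begin

definition "R = poly_ring K V"
definition "Pol = carrier R"

lemma Pol_iff: "f \<in> Pol \<longleftrightarrow> (\<forall>m. lookup f m \<in> K) \<and> (\<forall>m \<in> keys f. keys m \<subseteq> V)"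
  by (auto simp: Pol_def R_def poly_ring_def)

lemma R_simps: "f \<otimes>\<^bsub>R\<^esub> g = f * g" "f \<oplus>\<^bsub>R\<^esub> g = f + g" "\<zero>\<^bsub>R\<^esub> = 0" "\<one>\<^bsub>R\<^esub> = 1" "carrier R = Pol"
  by (simp_all add: R_def poly_ring_def ring_of_type_algebra_def Pol_def)

lemma Pol_0 [simp]: "0 \<in> Pol"
  by (simp add: Pol_iff)

lemma Pol_single [intro]: "c \<in> K \<Longrightarrow> keys m \<subseteq> V \<Longrightarrow> Poly_Mapping.single m c \<in> Pol"
  by (auto simp: Pol_iff lookup_single when_def split: if_splits)

lemma Pol_1 [simp]: "1 \<in> Pol"
  using Pol_single[of 1 0] by simp

lemma Pol_add [intro]: "f \<in> Pol \<Longrightarrow> g \<in> Pol \<Longrightarrow> f + g \<in> Pol"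
  unfolding Pol_iff lookup_add using Poly_Mapping.keys_add[of f g] by (metis K_add UnE subsetD)

lemma Pol_uminus [intro]: "f \<in> Pol \<Longrightarrow> - f \<in> Pol"
  by (auto simp: Pol_iff in_keys_iff)

lemma Pol_diff [intro]: "f \<in> Pol \<Longrightarrow> g \<in> Pol \<Longrightarrow> f - g \<in> Pol"
  using Pol_add[of f "- g"] by auto

lemma Pol_sum [intro]: "(\<And>x. x \<in> A \<Longrightarrow> f x \<in> Pol) \<Longrightarrow> sum f A \<in> Pol"
  by (induction A rule: infinite_finite_induct) auto

lemma Pol_mult [intro]:
  assumes f: "f \<in> Pol" and g: "g \<in> Pol"
  shows "f * g \<in> Pol"
proof -
  have "f * g = (\<Sum>m \<in> keys f. Poly_Mapping.single m (lookup f m)) *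
      (\<Sum>n \<in> keys g. Poly_Mapping.single n (lookup g n))"
    by (simp only: poly_mapping_sum_singles)
  also have "\<dots> = (\<Sum>m \<in> keys f. \<Sum>n \<in> keys g.
      Poly_Mapping.single (m + n) (lookup f m * lookup g n))"
    by (simp add: sum_product mult_single)
  also have "\<dots> \<in> Pol"
    using f g by (intro Pol_sum Pol_single) (auto simp: Pol_iff keys_add_nat)
  finally show ?thesis .
qed

lemma Pol_power [intro]: "f \<in> Pol \<Longrightarrow> f ^ n \<in> Pol"
  by (induction n) auto

lemma Pol_Const [intro]: "c \<in> K \<Longrightarrow> Const c \<in> Pol"
  unfolding Const_def by (rule Pol_single) auto

lemma Pol_mon [intro]: "keys m \<subseteq> V \<Longrightarrow> mon m \<in> Pol"
  by (rule Pol_single) auto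

lemma Pol_Var [intro]: "v \<in> V \<Longrightarrow> Var v \<in> Pol"
  unfolding Var_def by (rule Pol_mon) simp

lemma Pol_theta [intro]: "theta i \<in> Pol"
  unfolding theta_def using t_V by (intro Pol_sum Pol_mult Pol_Const Pol_Var K_power) auto

lemma Pol_face_monomial [intro]: "S \<subseteq> V \<Longrightarrow> face_monomial S \<in> Pol"
  using finite_subset_V[of S] by (auto simp: face_monomial_eq_mon intro!: Pol_mon)

lemma Pol_induct:
  assumes f: "f \<in> Pol" and "0 \<in> N" "\<And>f g. f \<in> N \<Longrightarrow> g \<in> N \<Longrightarrow> f + g \<in> N"
    and "\<And>c f. c \<in> K \<Longrightarrow> f \<in> N \<Longrightarrow> Const c * f \<in> N"
    and mon: "\<And>m. m \<in> keys f \<Longrightarrow> keys m \<subseteq> V \<Longrightarrow> mon m \<in> N"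
  shows "f \<in> N"
proof -
  have sum: "sum g A \<in> N" if "\<And>x. x \<in> A \<Longrightarrow> g x \<in> N" for g :: "'b \<Rightarrow> _" and A
    using that by (induction A rule: infinite_finite_induct) (auto intro: assms)
  have "(\<Sum>m \<in> keys f. Const (lookup f m) * mon m) \<in> N"
    using f by (intro sum assms(4) mon) (auto simp: Pol_iff)
  then show ?thesis by (simp only: Const_mult_mon poly_mapping_sum_singles)
qed

lemma cring_R: "cring R"
proof (rule cringI)
  show "abelian_group R"
  proof (rule abelian_groupI; (unfold R_simps)?)
    show "\<exists>y\<in>Pol. y + x = 0" if "x \<in> Pol" for x
      using that by (intro bexI[of _ "- x"]) auto
  qed (auto simp: ac_simps)
  show "comm_monoid R"
    by (rule comm_monoidI; (unfold R_simps)?) (auto simp: ac_simps)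
qed (auto simp: R_simps distrib_right)

lemma ring_R: "ring R"
  using cring_R by (rule cring.axioms(1))

lemma R_minus: "f \<in> Pol \<Longrightarrow> g \<in> Pol \<Longrightarrow> f \<ominus>\<^bsub>R\<^esub> g = f - g"
proof -
  assume fg: "f \<in> Pol" "g \<in> Pol"
  interpret ring R by (rule ring_R)
  have "\<ominus>\<^bsub>R\<^esub> g = - g"
    by (rule minus_equality) (use fg in \<open>auto simp: R_simps\<close>)
  then show ?thesis by (simp add: a_minus_def R_simps)
qed

text \<open>\<open>I0\<close> is the preimage of \<open>L\<close> in the polynomial ring; see \<open>L_ideal_eq\<close> below.\<close>

definition "I0 = {f \<in> Pol. \<forall>g \<in> Pol. phi (f * g) = 0}"

lemma I0_iff: "f \<in> I0 \<longleftrightarrow> f \<in> Pol \<and> (\<forall>m. keys m \<subseteq> V \<longrightarrow> phi (f * mon m) = 0)"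
proof safe
  assume f: "f \<in> Pol" "\<forall>m. keys m \<subseteq> V \<longrightarrow> phi (f * mon m) = 0"
  have "g \<in> {g. phi (f * g) = 0}" if "g \<in> Pol" for g
    using that by (rule Pol_induct) (use f in \<open>auto simp: distrib_left phi_add mult.left_commute[of f]\<close>)
  then show "f \<in> I0" using f by (auto simp: I0_def)
qed (auto simp: I0_def)

lemma I0_Pol: "f \<in> I0 \<Longrightarrow> f \<in> Pol"
  by (simp add: I0_def)

lemma I0_0 [simp]: "0 \<in> I0"
  by (simp add: I0_def)

lemma I0_add: "f \<in> I0 \<Longrightarrow> g \<in> I0 \<Longrightarrow> f + g \<in> I0"
  by (auto simp: I0_def distrib_right phi_add)

lemma I0_sum: "(\<And>x. x \<in> B \<Longrightarrow> g x \<in> I0) \<Longrightarrow> sum g B \<in> I0"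
  by (induction B rule: infinite_finite_induct) (auto intro: I0_add)

lemma I0_uminus: "f \<in> I0 \<Longrightarrow> - f \<in> I0"
proof -
  assume f: "f \<in> I0"
  have "phi (- f * g) = 0" if "g \<in> Pol" for g
    using f that phi_minus[of 0 "f * g"] by (simp add: I0_def)
  then show ?thesis using f by (auto simp: I0_def)
qed

lemma I0_mult: "f \<in> I0 \<Longrightarrow> g \<in> Pol \<Longrightarrow> f * g \<in> I0"
  by (auto simp: I0_def mult.assoc)

lemma I0_diff_cong: "f - g \<in> I0 \<Longrightarrow> g \<in> I0 \<Longrightarrow> f \<in> I0"
  using I0_add[of "f - g" g] by simp

lemma ideal_I0: "ideal I0 R"
proof (rule idealI[OF ring_R])
  interpret ring R by (rule ring_R)
  show "subgroup I0 (add_monoid R)"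
  proof (rule add.subgroupI)
    show "I0 \<subseteq> carrier R" using I0_Pol by (auto simp: R_simps)
    show "I0 \<noteq> {}" using I0_0 by blast
    show "\<ominus>\<^bsub>R\<^esub> f \<in> I0" if "f \<in> I0" for f
    proof -
      have "\<ominus>\<^bsub>R\<^esub> f = - f"
        by (rule minus_equality) (use that I0_Pol in \<open>auto simp: R_simps\<close>)
      then show ?thesis using I0_uminus[OF that] by simp
    qed
  qed (auto simp: R_simps I0_add)
qed (auto simp: R_simps I0_mult mult.commute)

lemma theta_I0: "i \<in> {1..d} \<Longrightarrow> theta i \<in> I0"
  by (auto simp: I0_iff phi_theta_mult)

lemma nonface_I0: "S \<subseteq> V \<Longrightarrow> S \<notin> \<Delta> \<Longrightarrow> face_monomial S \<in> I0"
  by (auto simp: I0_iff phi_nonface_mult)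

definition "FI = face_ideal K \<Delta>"
definition "FR = face_ring K \<Delta>"

lemma FI_eq: "FI = genideal R (face_monomial ` {S. S \<subseteq> V \<and> S \<notin> \<Delta>})"
  by (simp add: FI_def face_ideal_def R_def V_def)

lemma FI_gens: "face_monomial ` {S. S \<subseteq> V \<and> S \<notin> \<Delta>} \<subseteq> carrier R"
  by (auto simp: R_simps)

lemma ideal_FI: "ideal FI R"
  unfolding FI_eq by (rule ring.genideal_ideal[OF ring_R FI_gens])

lemma FI_I0: "FI \<subseteq> I0"
  unfolding FI_eq by (rule ring.genideal_minimal[OF ring_R ideal_I0]) (auto simp: nonface_I0)

lemma nonface_FI: "S \<subseteq> V \<Longrightarrow> S \<notin> \<Delta> \<Longrightarrow> face_monomial S \<in> FI"
  unfolding FI_eq using ring.genideal_self[OF ring_R FI_gens] by auto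

lemma FR_eq: "FR = R Quot FI"
  by (simp add: FR_def face_ring_def R_def FI_def V_def)

lemma cring_FR: "cring FR"
  unfolding FR_eq by (rule ideal.quotient_is_cring[OF ideal_FI cring_R])

abbreviation "to_FR \<equiv> to_face_ring K \<Delta>"

lemma to_FR_eq: "to_FR = (\<lambda>f. FI +>\<^bsub>R\<^esub> f)"
  by (simp add: to_face_ring_def FI_def R_def V_def fun_eq_iff)

lemma to_FR_hom: "ring_hom_ring R FR to_FR"
  unfolding FR_eq to_FR_eq using ideal.rcos_ring_hom_ring[OF ideal_FI] by (simp add: eta_contract_eq)

lemma carrier_FR: "carrier FR = to_FR ` Pol"
  unfolding FR_eq to_FR_eq by (auto simp: FactRing_def A_RCOSETS_def' R_simps)

lemma to_FR_eq_iff: "f \<in> Pol \<Longrightarrow> g \<in> Pol \<Longrightarrow> to_FR f = to_FR g \<longleftrightarrow> f - g \<in> FI"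
  unfolding to_FR_eq using ring.quotient_eq_iff_same_a_r_cos[OF ring_R ideal_FI, of f g]
  by (simp add: R_simps R_minus)

end

locale moment_lsop = moment_curve K h \<mu> d t
  for K :: "'l::field set" and h :: "'k::field \<Rightarrow> 'l" and \<mu> :: "'v::linorder set \<Rightarrow>\<^sub>0 'k" and d t +
  fixes a :: "nat \<Rightarrow> 'v \<Rightarrow> 'l"
  assumes a: "\<And>i v. i \<in> {1..d} \<Longrightarrow> v \<in> \<Union>(chain_support \<mu>) \<Longrightarrow> a i v = t v ^ i"
begin

lemma linear_form_eq: "i \<in> {1..d} \<Longrightarrow> linear_form K \<Delta> (a i) = to_FR (theta i)"
  unfolding linear_form_def theta_def V_def[symmetric]
  by (intro arg_cong[of _ _ to_FR] sum.cong) (auto simp: a V_def \<Delta>_def)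

definition "TI = theta_ideal K \<Delta> d a"
definition "A = artin_ring K \<Delta> d a"

lemma TI_eq: "TI = genideal FR (to_FR ` theta ` {1..d})"
  unfolding TI_def theta_ideal_def FR_def[symmetric] image_image
  by (intro arg_cong[of _ _ "genideal FR"] image_cong refl) (rule linear_form_eq)

lemma ring_FR: "ring FR"
  using cring_FR by (rule cring.axioms(1))

lemma TI_gens: "to_FR ` theta ` {1..d} \<subseteq> carrier FR"
  unfolding carrier_FR by auto

lemma ideal_TI: "ideal TI FR"
  unfolding TI_eq by (rule ring.genideal_ideal[OF ring_FR TI_gens])

lemma ideal_to_FR_I0: "ideal (to_FR ` I0) FR"
  using ring.ring_ideal_imp_quot_ideal[OF ring_R ideal_FI ideal_I0]
  by (simp add: FR_eq to_FR_eq)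

lemma TI_I0: "TI \<subseteq> to_FR ` I0"
  unfolding TI_eq by (rule ring.genideal_minimal[OF ring_FR ideal_to_FR_I0]) (use theta_I0 in auto)

lemma theta_TI: "i \<in> {1..d} \<Longrightarrow> to_FR (theta i) \<in> TI"
  unfolding TI_eq using ring.genideal_self[OF ring_FR TI_gens] by auto

lemma A_eq: "A = FR Quot TI"
  by (simp add: A_def artin_ring_def FR_def TI_def)

lemma cring_A: "cring A"
  unfolding A_eq by (rule ideal.quotient_is_cring[OF ideal_TI cring_FR])

lemma ring_A: "ring A"
  using cring_A by (rule cring.axioms(1))

abbreviation "to_A \<equiv> to_artin K \<Delta> d a"

lemma to_A_eq: "to_A = (\<lambda>f. TI +>\<^bsub>FR\<^esub> to_FR f)"
  by (simp add: to_artin_def TI_def FR_def fun_eq_iff)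

lemma carrier_A: "carrier A = to_A ` Pol"
  unfolding A_eq to_A_eq by (auto simp: FactRing_def A_RCOSETS_def' carrier_FR)

lemma to_A_hom: "ring_hom_ring R A to_A"
proof -
  have "(+>\<^bsub>FR\<^esub>) TI \<in> Ring.ring_hom FR A"
    unfolding A_eq by (rule ideal.rcos_ring_hom[OF ideal_TI])
  moreover have "to_FR \<in> Ring.ring_hom R FR"
    using to_FR_hom by (rule ring_hom_ring.homh)
  ultimately have "(+>\<^bsub>FR\<^esub>) TI \<circ> to_FR \<in> Ring.ring_hom R A"
    by (rule ring_hom_trans[rotated])
  then have "to_A \<in> Ring.ring_hom R A"
    by (simp add: to_A_eq comp_def)
  then show ?thesis
    by (rule ring_hom_ringI2[OF ring_R ring_A])
qed

lemma to_A_simps: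
  "f \<in> Pol \<Longrightarrow> g \<in> Pol \<Longrightarrow> to_A f \<oplus>\<^bsub>A\<^esub> to_A g = to_A (f + g)"
  "f \<in> Pol \<Longrightarrow> g \<in> Pol \<Longrightarrow> to_A f \<otimes>\<^bsub>A\<^esub> to_A g = to_A (f * g)"
  "\<zero>\<^bsub>A\<^esub> = to_A 0" "\<one>\<^bsub>A\<^esub> = to_A 1"
proof -
  interpret ring_hom_ring R A to_A by (rule to_A_hom)
  show "f \<in> Pol \<Longrightarrow> g \<in> Pol \<Longrightarrow> to_A f \<oplus>\<^bsub>A\<^esub> to_A g = to_A (f + g)"
    "f \<in> Pol \<Longrightarrow> g \<in> Pol \<Longrightarrow> to_A f \<otimes>\<^bsub>A\<^esub> to_A g = to_A (f * g)"
    "\<zero>\<^bsub>A\<^esub> = to_A 0" "\<one>\<^bsub>A\<^esub> = to_A 1"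
    using hom_add[of f g] hom_mult[of f g] hom_zero hom_one by (simp_all add: R_simps)
qed

text \<open>The kernel of the projection to the Artinian reduction lies in \<open>I0\<close>, since
  the generators of the face ideal and the linear forms do. Hence \<open>phi\<close> is well defined
  on the quotient.\<close>

lemma to_A_eq_imp:
  assumes "f \<in> Pol" "g \<in> Pol" "to_A f = to_A g"
  shows "f - g \<in> I0"
proof -
  have c: "to_FR f \<in> carrier FR" "to_FR g \<in> carrier FR" using assms by (auto simp: carrier_FR)
  interpret P: ring_hom_ring R FR to_FR by (rule to_FR_hom)
  have "to_FR f \<ominus>\<^bsub>FR\<^esub> to_FR g \<in> TI"
    using ring.quotient_eq_iff_same_a_r_cos[OF ring_FR ideal_TI c] assms(3) by (simp add: to_A_eq)
  also have "to_FR f \<ominus>\<^bsub>FR\<^esub> to_FR g = to_FR (f - g)"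
  proof -
    have "to_FR (f \<ominus>\<^bsub>R\<^esub> g) = to_FR f \<ominus>\<^bsub>FR\<^esub> to_FR g"
    proof -
      have "f \<in> carrier R" "g \<in> carrier R" using assms by (simp_all add: R_simps)
      then show ?thesis by (simp add: a_minus_def)
    qed
    then show ?thesis using assms by (simp add: R_minus)
  qed
  finally obtain q where q: "q \<in> I0" "to_FR (f - g) = to_FR q" using TI_I0 by auto
  then have "f - g - q \<in> FI" using to_FR_eq_iff[of "f - g" q] assms I0_Pol by auto
  then have "f - g - q \<in> I0" using FI_I0 by auto
  then show ?thesis using q(1) by (rule I0_diff_cong)
qed

lemma to_A_theta_mult: "i \<in> {1..d} \<Longrightarrow> f \<in> Pol \<Longrightarrow> to_A (theta i * f) = to_A 0"
proof -
  assume i: "i \<in> {1..d}" and f: "f \<in> Pol"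
  interpret A: cring A by (rule cring_A)
  have "to_A (theta i) = \<zero>\<^bsub>A\<^esub>"
    using ring.a_rcos_zero[OF ring_FR ideal_TI theta_TI[OF i]]
    by (simp add: to_A_eq A_eq FactRing_def)
  then have "to_A (theta i) \<otimes>\<^bsub>A\<^esub> to_A f = \<zero>\<^bsub>A\<^esub>"
    using f by (simp add: carrier_A)
  then show ?thesis using f by (simp add: to_A_simps Pol_theta)
qed

lemma to_A_nonface: "S \<subseteq> V \<Longrightarrow> S \<notin> \<Delta> \<Longrightarrow> to_A (face_monomial S) = to_A 0"
proof -
  assume S: "S \<subseteq> V" "S \<notin> \<Delta>"
  have "to_FR (face_monomial S) = to_FR 0"
    using to_FR_eq_iff[of "face_monomial S" 0] nonface_FI[OF S] S by auto
  then show ?thesis by (simp add: to_A_eq)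
qed

end

section \<open>The grading, the degree map and the Gorensteinification\<close>

context moment_lsop
begin

abbreviation "hom_part \<equiv> hom_polys K V"

lemma hom_iff: "f \<in> hom_part k \<longleftrightarrow> f \<in> Pol \<and> (\<forall>m \<in> keys f. mdeg m = k)"
  by (simp add: hom_polys_def Pol_def R_def mdeg_def)

lemma hom_Pol: "f \<in> hom_part k \<Longrightarrow> f \<in> Pol"
  by (simp add: hom_iff)

lemma hom_0 [simp]: "0 \<in> hom_part k"
  by (simp add: hom_iff)

lemma hom_add: "f \<in> hom_part k \<Longrightarrow> g \<in> hom_part k \<Longrightarrow> f + g \<in> hom_part k"
  unfolding hom_iff using Poly_Mapping.keys_add[of f g] by (metis Pol_add UnE subsetD)

lemma hom_sum: "(\<And>x. x \<in> B \<Longrightarrow> g x \<in> hom_part k) \<Longrightarrow> sum g B \<in> hom_part k"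
  by (induction B rule: infinite_finite_induct) (auto intro: hom_add)

lemma keys_mult_mdeg:
  assumes "\<And>m. m \<in> keys f \<Longrightarrow> mdeg m = i" "\<And>m. m \<in> keys g \<Longrightarrow> mdeg m = j"
    and "m \<in> keys (f * g)"
  shows "mdeg m = i + j"
  using assms Poly_Mapping.keys_mult[of f g] by (auto simp: mdeg_add)

lemma hom_mult: "f \<in> hom_part i \<Longrightarrow> g \<in> hom_part j \<Longrightarrow> f * g \<in> hom_part (i + j)"
  unfolding hom_iff using keys_mult_mdeg[of f i g j] by auto

lemma hom_power: "f \<in> hom_part i \<Longrightarrow> f ^ n \<in> hom_part (n * i)"
proof (induction n)
  case 0
  show ?case by (auto simp: hom_iff)
next
  case (Suc n)
  then show ?case using hom_mult[of f i "f ^ n" "n * i"] by simp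
qed

lemma hom_single: "c \<in> K \<Longrightarrow> keys m \<subseteq> V \<Longrightarrow> Poly_Mapping.single m c \<in> hom_part (mdeg m)"
  by (auto simp: hom_iff split: if_splits)

lemma hom_mon: "keys m \<subseteq> V \<Longrightarrow> mon m \<in> hom_part (mdeg m)"
  by (rule hom_single) auto

lemma hom_Const: "c \<in> K \<Longrightarrow> Const c \<in> hom_part 0"
  unfolding Const_def using hom_single[of c 0] by simp

lemma hom_Const_mult: "c \<in> K \<Longrightarrow> f \<in> hom_part k \<Longrightarrow> Const c * f \<in> hom_part k"
  using hom_mult[OF hom_Const] by fastforce

lemma hom_face_monomial: "S \<subseteq> V \<Longrightarrow> face_monomial S \<in> hom_part (card S)"
  using hom_mon[of "set_mon S"] finite_subset_V[of S] by (simp add: face_monomial_eq_mon)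

lemma hom_theta: "theta i \<in> hom_part 1"
proof -
  have "Const (t v ^ i) * Var v \<in> hom_part 1" if "v \<in> V" for v
    unfolding Var_def using that t_V hom_mon[of "Poly_Mapping.single v 1"]
    by (intro hom_Const_mult) auto
  then show ?thesis unfolding theta_def by (rule hom_sum)
qed

lemma phi_K_Pol: "f \<in> Pol \<Longrightarrow> phi f \<in> K"
  by (rule phi_K) (simp add: Pol_iff)

definition "Ad = artin_part K \<Delta> d a d"

lemma Ad_eq: "Ad = to_A ` hom_part d"
  by (simp add: Ad_def artin_part_def V_def)

text \<open>\<open>phi\<close> on an arbitrary homogeneous representative, legitimate by
  \<open>phi_cong\<close>. The restriction to the top degree provides the extensionality that
  \<open>is_degree_map\<close> demands for uniqueness.\<close>

definition deg0 :: "('v, 'l) mpoly set set \<Rightarrow> 'l" where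
  "deg0 = restrict (\<lambda>x. phi (SOME f. f \<in> hom_part d \<and> to_A f = x)) Ad"

lemma phi_cong:
  assumes "f \<in> Pol" "g \<in> Pol" "to_A f = to_A g"
  shows "phi f = phi g"
proof -
  have "phi ((f - g) * 1) = 0" using to_A_eq_imp[OF assms] Pol_1 unfolding I0_def by blast
  then show ?thesis by (simp add: phi_minus)
qed

lemma deg0_to_A: "f \<in> hom_part d \<Longrightarrow> deg0 (to_A f) = phi f"
proof -
  assume f: "f \<in> hom_part d"
  let ?g = "SOME g. g \<in> hom_part d \<and> to_A g = to_A f"
  have "?g \<in> hom_part d \<and> to_A ?g = to_A f" by (rule someI[of _ f]) (simp add: f)
  then have "phi ?g = phi f" using f by (intro phi_cong) (auto simp: hom_Pol)
  then show ?thesis using f by (simp add: deg0_def Ad_eq)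
qed

lemma a_V: "i \<in> {1..d} \<Longrightarrow> v \<in> V \<Longrightarrow> a i v = t v ^ i"
  using a by (simp add: V_def \<Delta>_def)

lemma Delta_V: "S \<in> \<Delta> \<Longrightarrow> S \<subseteq> V"
  by (auto simp: V_def)

lemma exists_facet: "\<exists>F \<in> \<Delta>. card F = d \<and> phi (face_monomial F) \<noteq> 0"
proof -
  have "keys \<mu> \<noteq> {}" using cycle by (simp add: simplicial_cycle_def)
  then obtain F where F: "F \<in> keys \<mu>" by blast
  then have F': "F \<in> \<Delta>" "card F = d" using facet mem_Delta_iff by auto
  have "phi (face_monomial F) \<noteq> 0"
    using phi_facet[OF F' a_V] F by (simp add: in_keys_iff)
  then show ?thesis using F' by blast
qed

lemma is_degree_map_iff: "is_degree_map h K d \<mu> a f \<longleftrightarrow>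
  f \<in> extensional Ad \<and> f ` Ad = K \<and>
        (\<forall>x \<in> Ad. \<forall>y \<in> Ad. f (x \<oplus>\<^bsub>A\<^esub> y) = f x + f y) \<and>
        (\<forall>c \<in> K. \<forall>x \<in> Ad. f (to_A (Const c) \<otimes>\<^bsub>A\<^esub> x) = c * f x) \<and>
        (\<forall>F \<in> \<Delta>. card F = d \<longrightarrow>
           f (to_A (face_monomial F)) = h (lookup \<mu> F) / theta_minor d a F)"
  unfolding is_degree_map_def Let_def \<Delta>_def[symmetric] A_def[symmetric] Ad_def[symmetric] ..

lemma is_degree_map_deg0: "is_degree_map h K d \<mu> a deg0"
  unfolding is_degree_map_iff
proof (intro conjI ballI impI)
  show "deg0 \<in> extensional Ad" by (simp add: deg0_def)
  show "deg0 ` Ad = K"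
  proof
    show "deg0 ` Ad \<subseteq> K" by (auto simp: Ad_eq deg0_to_A phi_K_Pol hom_Pol)
    show "K \<subseteq> deg0 ` Ad"
    proof
      fix c assume c: "c \<in> K"
      obtain F where F: "F \<in> \<Delta>" "card F = d" "phi (face_monomial F) \<noteq> 0"
        using exists_facet by blast
      have FV: "F \<subseteq> V" by (rule Delta_V[OF F(1)])
      let ?f = "Const (c / phi (face_monomial F)) * face_monomial F"
      have "?f \<in> hom_part d"
        using F(2) hom_face_monomial[OF FV] phi_K_Pol[OF Pol_face_monomial[OF FV]] c
        by (intro hom_Const_mult K_divide) auto
      moreover from this have "deg0 (to_A ?f) = c" using F(3) by (simp add: deg0_to_A)
      ultimately show "c \<in> deg0 ` Ad" unfolding Ad_eq by (metis image_eqI)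
    qed
  qed
next
  fix x y assume "x \<in> Ad" "y \<in> Ad"
  then obtain f g where "f \<in> hom_part d" "g \<in> hom_part d" "x = to_A f" "y = to_A g" by (auto simp: Ad_eq)
  then show "deg0 (x \<oplus>\<^bsub>A\<^esub> y) = deg0 x + deg0 y"
    by (simp add: to_A_simps hom_Pol deg0_to_A hom_add phi_add)
next
  fix c x assume "c \<in> K" "x \<in> Ad"
  then obtain f where "f \<in> hom_part d" "x = to_A f" by (auto simp: Ad_eq)
  then show "deg0 (to_A (Const c) \<otimes>\<^bsub>A\<^esub> x) = c * deg0 x"
    using \<open>c \<in> K\<close> by (simp add: to_A_simps hom_Pol deg0_to_A hom_Const_mult Pol_Const)
next
  fix F assume F: "F \<in> \<Delta>" "card F = d"
  have "face_monomial F \<in> hom_part d" using hom_face_monomial[OF Delta_V[OF F(1)]] F(2) by simp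
  then show "deg0 (to_A (face_monomial F)) = h (lookup \<mu> F) / theta_minor d a F"
    using phi_facet(1)[OF F a_V] by (simp add: deg0_to_A)
qed

text \<open>Modulo the linear forms, squarefree monomials span the top degree. Their values are
  prescribed on facets, and nonfaces are zero in the quotient. Thus the description in
  \<open>degree_map_def\<close> determines \<open>deg0\<close>.\<close>

lemma degree_map_unique:
  assumes f: "is_degree_map h K d \<mu> a f"
  shows "f = deg0"
proof (rule extensionalityI[of _ Ad])
  show "f \<in> extensional Ad" using f by (simp add: is_degree_map_iff)
  show "deg0 \<in> extensional Ad" by (simp add: deg0_def)
  have f_add: "f (to_A (p + q)) = f (to_A p) + f (to_A q)" if "p \<in> hom_part d" "q \<in> hom_part d" for p q
  proof -
    have "f (to_A p \<oplus>\<^bsub>A\<^esub> to_A q) = f (to_A p) + f (to_A q)"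
      using f that unfolding is_degree_map_iff Ad_eq by blast
    then show ?thesis using that by (simp add: to_A_simps hom_Pol)
  qed
  have f_scale: "f (to_A (Const c * p)) = c * f (to_A p)" if "c \<in> K" "p \<in> hom_part d" for c p
  proof -
    have "f (to_A (Const c) \<otimes>\<^bsub>A\<^esub> to_A p) = c * f (to_A p)"
      using f that unfolding is_degree_map_iff Ad_eq by blast
    then show ?thesis using that by (simp add: to_A_simps hom_Pol Pol_Const)
  qed
  have f_0: "f (to_A 0) = 0" using f_scale[of 0 0] by simp
  define N where "N = {q \<in> hom_part d. f (to_A q) = phi q}"
  have N: "0 \<in> N" "\<And>p q. p \<in> N \<Longrightarrow> q \<in> N \<Longrightarrow> p + q \<in> N" "\<And>c p. c \<in> K \<Longrightarrow> p \<in> N \<Longrightarrow> Const c * p \<in> N"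
    by (auto simp: N_def f_0 f_add f_scale hom_add hom_Const_mult phi_add)
  fix x assume "x \<in> Ad"
  then obtain p where p: "p \<in> hom_part d" "x = to_A p" by (auto simp: Ad_eq)
  have "p \<in> N"
  proof (rule Pol_induct[OF hom_Pol[OF p(1)] N])
    fix m assume m: "m \<in> keys p" "keys m \<subseteq> V"
    have md: "mdeg m = d" using m(1) p(1) by (simp add: hom_iff)
    show "mon m \<in> N"
    proof (rule monomial_mem_if_squarefree_mem[where n = d and j = d, OF N(2,3,1) _ _ m(2) md])
      fix i n assume n: "i \<in> {1..d}" "keys n \<subseteq> V" "Suc (mdeg n) = d"
      have "theta i * mon n \<in> hom_part d" using hom_mult[OF hom_theta hom_mon[OF n(2)]] n(3) by simp
      then show "theta i * mon n \<in> N"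
        using to_A_theta_mult[OF n(1) Pol_mon[OF n(2)]] phi_theta_mult[OF n(1,2)]
        by (simp add: N_def f_0)
    next
      fix n assume n: "keys n \<subseteq> V" "mdeg n = d"
        "card (keys n) = d \<or> d < card (keys n)"
      let ?S = "keys n"
      have c: "card ?S = mdeg n" using n card_keys_le_mdeg[of n] by auto
      have eq: "mon n = face_monomial ?S"
        using squarefree_monomial[OF c] by (simp add: face_monomial_eq_mon)
      show "mon n \<in> N"
      proof (cases "?S \<in> \<Delta>")
        case True
        have "f (to_A (face_monomial ?S)) = h (lookup \<mu> ?S) / theta_minor d a ?S"
          using f True c n(2) by (simp add: is_degree_map_iff)
        also have "\<dots> = phi (face_monomial ?S)"
          using phi_facet(1)[OF True _ a_V] c n(2) by simp
        finally show ?thesis using hom_mon[OF n(1)] n(2) by (simp add: N_def eq)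
      next
        case False
        have "phi (face_monomial ?S) = 0"
          using phi_nonface_mult[OF n(1) False, of 0] by simp
        then show ?thesis
          using to_A_nonface[OF n(1) False] hom_mon[OF n(1)] n(2) f_0 by (simp add: N_def eq)
      qed
    qed
  qed
  then show "f x = deg0 x" using p by (simp add: N_def deg0_to_A)
qed

lemma degree_map_eq: "degree_map h K d \<mu> a = deg0"
  unfolding degree_map_def
  by (rule the_equality) (rule is_degree_map_deg0, rule degree_map_unique)

lemma degree_map_to_A: "f \<in> hom_part d \<Longrightarrow> degree_map h K d \<mu> a (to_A f) = phi f"
  by (simp add: degree_map_eq deg0_to_A)

text \<open>\<open>phi\<close> ignores all degrees but d, so a homogeneous f has to be tested in the
  complementary degree only; for k > d both sides hold trivially.\<close>

lemma I0_hom_iff: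
  assumes f: "f \<in> hom_part k"
  shows "f \<in> I0 \<longleftrightarrow> (\<forall>j. k + j = d \<longrightarrow> (\<forall>g \<in> hom_part j. phi (f * g) = 0))"
proof
  assume "f \<in> I0"
  then show "\<forall>j. k + j = d \<longrightarrow> (\<forall>g \<in> hom_part j. phi (f * g) = 0)"
    by (auto simp: I0_def hom_Pol)
next
  assume *: "\<forall>j. k + j = d \<longrightarrow> (\<forall>g \<in> hom_part j. phi (f * g) = 0)"
  have "phi (f * mon m) = 0" if m: "keys m \<subseteq> V" for m
  proof (cases "k + mdeg m = d")
    case True
    then show ?thesis using * hom_mon[OF m] by blast
  next
    case False
    show ?thesis
    proof (rule phi_other_degree)
      fix n assume "n \<in> keys (f * mon m)"
      then have "mdeg n = k + mdeg m"
        using hom_mult[OF f hom_mon[OF m]] by (simp add: hom_iff)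
      then show "mdeg n \<noteq> d" using False by simp
    qed
  qed
  then show "f \<in> I0" using f by (auto simp: I0_iff hom_Pol)
qed

lemma I0_to_A: "f \<in> Pol \<Longrightarrow> to_A f \<in> to_A ` I0 \<longleftrightarrow> f \<in> I0"
  using to_A_eq_imp I0_diff_cong I0_Pol by blast

lemma artin_part_eq: "artin_part K \<Delta> d a k = to_A ` hom_part k"
  by (simp add: artin_part_def V_def)

lemma L_part_iff:
  assumes f: "f \<in> hom_part k"
  shows "to_A f \<in> L_part h K d \<mu> a k \<longleftrightarrow> f \<in> I0"
proof -
  have "degree_map h K d \<mu> a (to_A f \<otimes>\<^bsub>A\<^esub> to_A g) = phi (f * g)" if "k + j = d" "g \<in> hom_part j" for g j
  proof -
    have "f * g \<in> hom_part d" using hom_mult[OF f that(2)] that(1) by simp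
    then show ?thesis using f that by (simp add: to_A_simps hom_Pol degree_map_to_A)
  qed
  then show ?thesis
    unfolding L_part_def \<Delta>_def[symmetric] A_def[symmetric] artin_part_eq I0_hom_iff[OF f]
    using f by fastforce
qed

definition hom_component :: "nat \<Rightarrow> ('v, 'l) mpoly \<Rightarrow> ('v, 'l) mpoly" where
  "hom_component k f = (\<Sum>m | m \<in> keys f \<and> mdeg m = k. Poly_Mapping.single m (lookup f m))"

lemma hom_component_hom: "f \<in> Pol \<Longrightarrow> hom_component k f \<in> hom_part k"
proof -
  assume f: "f \<in> Pol"
  have "Poly_Mapping.single m (lookup f m) \<in> hom_part k"
    if "m \<in> keys f" "mdeg m = k" for m
    using hom_single[of "lookup f m" m] f that by (auto simp: Pol_iff)
  then show ?thesis unfolding hom_component_def by (intro hom_sum) auto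
qed

lemma sum_hom_component:
  obtains n where "f = (\<Sum>k\<le>n. hom_component k f)"
proof
  let ?n = "\<Sum>m \<in> keys f. mdeg m"
  have n: "mdeg m \<le> ?n" if "m \<in> keys f" for m
    using that by (intro member_le_sum) auto
  have "f = (\<Sum>m \<in> keys f. Poly_Mapping.single m (lookup f m))"
    by (simp only: poly_mapping_sum_singles)
  also have "\<dots> = (\<Sum>k\<le>?n. hom_component k f)"
    unfolding hom_component_def by (rule sum.group[symmetric]) (use n in auto)
  finally show "f = (\<Sum>k\<le>?n. hom_component k f)" .
qed

text \<open>Against a monomial of complementary degree, f and its component have the same value
  under \<open>phi\<close>, so \<open>I0\<close> is a homogeneous ideal.\<close>

lemma hom_component_I0:
  assumes f: "f \<in> I0" shows "hom_component k f \<in> I0"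
proof -
  have "phi (hom_component k f * mon m) = 0" if m: "keys m \<subseteq> V" for m
  proof (cases "k + mdeg m = d")
    case True
    have "phi (hom_component k f * mon m) = (\<Sum>n | n \<in> keys f \<and> mdeg n = k.
        lookup f n * phi (mon (n + m)))"
      by (simp add: hom_component_def sum_distrib_right mult_single phi_sum phi_single[of _ "lookup f _"])
    also have "\<dots> = (\<Sum>n \<in> keys f. lookup f n * phi (mon (n + m)))"
      by (rule sum.mono_neutral_left) (use True in \<open>auto simp: phi_def mdeg_add\<close>)
    also have "\<dots> = phi ((\<Sum>n \<in> keys f. Poly_Mapping.single n (lookup f n)) * mon m)"
      by (simp add: sum_distrib_right mult_single phi_sum phi_single[of _ "lookup f _"])
    also have "\<dots> = 0" using f m by (simp add: poly_mapping_sum_singles I0_iff)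
    finally show ?thesis .
  next
    case False
    have "hom_component k f * mon m \<in> hom_part (k + mdeg m)"
      by (intro hom_mult hom_component_hom I0_Pol f hom_mon m)
    then show ?thesis using False by (intro phi_other_degree) (auto simp: hom_iff)
  qed
  moreover have "hom_component k f \<in> Pol"
    by (rule hom_Pol[OF hom_component_hom[OF I0_Pol[OF f]]])
  ultimately show ?thesis by (simp add: I0_iff)
qed

text \<open>Homogeneous elements agree by \<open>L_part_iff\<close>; decomposing elements of
  \<open>I0\<close> into components, which stay in \<open>I0\<close>, gives the rest.\<close>

lemma L_ideal_eq: "L_ideal h K d \<mu> a = to_A ` I0"
proof -
  interpret A: cring A by (rule cring_A)
  have fin: "finsum A (\<lambda>k. to_A (g k)) {..n} = to_A (\<Sum>k\<le>n. g k)" if "\<And>k. k \<le> n \<Longrightarrow> g k \<in> Pol" for g and n :: nat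
    using that
  proof (induction n)
    case 0
    have "to_A (g 0) \<in> carrier A" using 0 by (auto simp: carrier_A)
    then show ?case by simp
  next
    case (Suc n)
    have "(\<Sum>k\<le>n. g k) \<in> Pol" using Suc.prems by (intro Pol_sum) auto
    moreover have "(\<lambda>k. to_A (g k)) \<in> {..Suc n} \<rightarrow> carrier A"
      using Suc.prems by (auto simp: carrier_A)
    ultimately show ?case using Suc by (simp add: to_A_simps add.commute)
  qed
  have L: "L_ideal h K d \<mu> a = {finsum A x {..n} | n x. \<forall>k \<le> n. x k \<in> L_part h K d \<mu> a k}"
    by (simp add: L_ideal_def A_def \<Delta>_def)
  show ?thesis
  proof
    show "L_ideal h K d \<mu> a \<subseteq> to_A ` I0"
    proof
      fix y assume "y \<in> L_ideal h K d \<mu> a"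
      then obtain n x where x: "y = finsum A x {..n}" "\<And>k. k \<le> n \<Longrightarrow> x k \<in> L_part h K d \<mu> a k"
        unfolding L by blast
      have "\<exists>f \<in> I0. x k = to_A f" if "k \<le> n" for k
      proof -
        have "x k \<in> to_A ` hom_part k" using x(2)[OF that] by (simp add: L_part_def artin_part_eq flip: \<Delta>_def)
        then obtain f where "f \<in> hom_part k" "x k = to_A f" by blast
        then show ?thesis using x(2)[OF that] L_part_iff[of f k] by auto
      qed
      then obtain f where f: "\<And>k. k \<le> n \<Longrightarrow> f k \<in> I0 \<and> x k = to_A (f k)" by metis
      have "y = finsum A (\<lambda>k. to_A (f k)) {..n}"
        unfolding x(1) by (rule A.finsum_cong') (use f I0_Pol in \<open>auto simp: carrier_A\<close>)
      also have "\<dots> = to_A (\<Sum>k\<le>n. f k)" by (rule fin) (use f I0_Pol in auto)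
      finally have "y = to_A (\<Sum>k\<le>n. f k)" .
      moreover have "(\<Sum>k\<le>n. f k) \<in> I0"
        by (rule I0_sum) (use f in auto)
      ultimately show "y \<in> to_A ` I0" by blast
    qed
    show "to_A ` I0 \<subseteq> L_ideal h K d \<mu> a"
    proof
      fix y assume "y \<in> to_A ` I0"
      then obtain f where f: "f \<in> I0" "y = to_A f" by blast
      obtain n where n: "f = (\<Sum>k\<le>n. hom_component k f)" by (rule sum_hom_component)
      have "y = finsum A (\<lambda>k. to_A (hom_component k f)) {..n}"
        using fin[of n "\<lambda>k. hom_component k f"] hom_component_hom[OF I0_Pol[OF f(1)]] hom_Pol f(2) n
        by auto
      moreover have "to_A (hom_component k f) \<in> L_part h K d \<mu> a k" for k
        using L_part_iff hom_component_hom[OF I0_Pol[OF f(1)]] hom_component_I0[OF f(1)] by blast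
      ultimately show "y \<in> L_ideal h K d \<mu> a" unfolding L by blast
    qed
  qed
qed

lemma ideal_L: "ideal (L_ideal h K d \<mu> a) A"
  using ring.ring_ideal_imp_quot_ideal[OF ring_FR ideal_TI ideal_to_FR_I0]
  by (simp add: L_ideal_eq A_eq to_A_eq image_image)

text \<open>Reduction to polynomials: by \<open>L_ideal_eq\<close> an element of the
  Gorensteinification is zero exactly when a representative lies in \<open>I0\<close>.\<close>

lemma anisotropicI:
  assumes q: "q > 0"
    and *: "\<And>k f. q * k \<le> d \<Longrightarrow> f \<in> hom_part k \<Longrightarrow> f \<notin> I0 \<Longrightarrow> f ^ q \<notin> I0"
  shows "anisotropic q h K d \<mu> a"
  unfolding anisotropic_def
proof (intro allI impI ballI)
  fix k u
  let ?L = "L_ideal h K d \<mu> a" and ?G = "gorenstein_ring h K d \<mu> a"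
  assume k: "real k \<le> real d / real q" and u: "u \<in> gorenstein_part h K d \<mu> a k" "u \<noteq> \<zero>\<^bsub>?G\<^esub>"
  have G: "?G = A Quot ?L" by (simp add: gorenstein_ring_def A_def \<Delta>_def)
  have zero: "\<zero>\<^bsub>?G\<^esub> = ?L" by (simp add: G FactRing_def)
  interpret L: ideal ?L A by (rule ideal_L)
  let ?\<pi> = "\<lambda>f. ?L +>\<^bsub>A\<^esub> to_A f"
  have hom: "(+>\<^bsub>A\<^esub>) ?L \<in> Ring.ring_hom A ?G" unfolding G by (rule L.rcos_ring_hom)
  have zero_iff: "?\<pi> f = \<zero>\<^bsub>?G\<^esub> \<longleftrightarrow> f \<in> I0" if "f \<in> Pol" for f
  proof -
    have "to_A f \<in> carrier A" using that by (auto simp: carrier_A)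
    then have "?\<pi> f = ?L \<longleftrightarrow> to_A f \<in> ?L"
      using L.rcos_const_imp_mem ring.a_rcos_zero[OF ring_A ideal_L] by blast
    then show ?thesis using I0_to_A[OF that] by (simp add: zero L_ideal_eq)
  qed
  have pow: "?\<pi> f [^]\<^bsub>?G\<^esub> n = ?\<pi> (f ^ n)" if "f \<in> Pol" for f and n :: nat
  proof (induction n)
    case 0
    have "\<one>\<^bsub>?G\<^esub> = ?L +>\<^bsub>A\<^esub> \<one>\<^bsub>A\<^esub>" by (simp add: G FactRing_def)
    then show ?case by (simp add: to_A_simps nat_pow_def)
  next
    case (Suc n)
    have c: "to_A f \<in> carrier A" "to_A (f ^ n) \<in> carrier A" using that by (auto simp: carrier_A)
    have "?\<pi> f [^]\<^bsub>?G\<^esub> Suc n = ?\<pi> (f ^ n) \<otimes>\<^bsub>?G\<^esub> ?\<pi> f"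
      using Suc.IH by (simp add: nat_pow_def)
    also have "\<dots> = ?L +>\<^bsub>A\<^esub> (to_A (f ^ n) \<otimes>\<^bsub>A\<^esub> to_A f)"
      using ring_hom_mult[OF hom c(2,1)] by simp
    also have "\<dots> = ?\<pi> (f ^ Suc n)"
      using that by (simp add: to_A_simps Pol_power mult.commute)
    finally show ?case .
  qed
  obtain f where f: "f \<in> hom_part k" "u = ?\<pi> f"
    using u(1) unfolding gorenstein_part_def A_def[symmetric] \<Delta>_def[symmetric] artin_part_eq by auto
  have fP: "f \<in> Pol" by (rule hom_Pol[OF f(1)])
  have "real (q * k) \<le> real d" using k q by (simp add: field_simps)
  then have "q * k \<le> d" by (simp only: of_nat_le_iff)
  then have "f ^ q \<notin> I0" using *[OF _ f(1)] u(2) zero_iff[OF fP] f(2) by auto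
  then show "u [^]\<^bsub>?G\<^esub> q \<noteq> \<zero>\<^bsub>?G\<^esub>"
    using pow[OF fP, of q] zero_iff[OF Pol_power[OF fP, of q]] f(2) by simp
qed

section \<open>Powers along the moment curve form a linear system of parameters\<close>

lemma subfield_K: "subfield K ring_of_type_algebra"
proof -
  interpret field "ring_of_type_algebra :: 'l ring" by auto
  let ?R = "ring_of_type_algebra :: 'l ring"
  have s: "carrier ?R = UNIV" "\<And>x y. x \<otimes>\<^bsub>?R\<^esub> y = x * y" "\<And>x y. x \<oplus>\<^bsub>?R\<^esub> y = x + y" "\<zero>\<^bsub>?R\<^esub> = 0" "\<one>\<^bsub>?R\<^esub> = 1"
    by (simp_all add: ring_of_type_algebra_def)
  have ai: "\<ominus>\<^bsub>?R\<^esub> x = - x" for x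
    by (rule minus_equality) (simp_all add: s)
  show ?thesis
  proof (rule subfieldI')
    show "subring K ?R"
      by (rule subringI) (auto simp: s ai)
    show "inv\<^bsub>?R\<^esub> k \<in> K" if "k \<in> K - {\<zero>\<^bsub>?R\<^esub>}" for k
    proof -
      have "inv\<^bsub>?R\<^esub> k = inverse k"
        by (rule comm_inv_char) (use that in \<open>auto simp: s\<close>)
      then show ?thesis using that by auto
    qed
  qed
qed

text \<open>The finitely many squarefree monomials span the quotient: supports of more than d
  vertices are nonfaces and give zero, and other monomials are reduced by interpolation.\<close>

lemma is_lsop: "is_lsop K \<Delta> d a"
proof -
  interpret A: cring A by (rule cring_A)
  let ?R = "ring_of_type_algebra :: 'l ring"
  let ?K = "?R\<lparr>carrier := K\<rparr>"
  let ?c = "\<lambda>c. to_A (Const c)"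
  have ringR: "ring ?R" by (rule comm_ring_1_class.ring_from_type_algebra)
  have fieldK: "field ?K" by (rule ring.subfield_iff(2)[OF ringR subfield_K])
  interpret KK: field ?K by (rule fieldK)
  have sK: "carrier ?K = K" "\<And>x y. x \<otimes>\<^bsub>?K\<^esub> y = x * y" "\<And>x y. x \<oplus>\<^bsub>?K\<^esub> y = x + y" "\<one>\<^bsub>?K\<^esub> = 1"
    by (simp_all add: ring_of_type_algebra_def)
  have homc: "?c \<in> Ring.ring_hom ?K A"
    by (rule ring_hom_memI) (simp_all add: sK carrier_A to_A_simps Const_add Const_mult Pol_Const ring_of_type_algebra_def)
  \<comment> \<open>A trivial quotient would put 1 into \<open>I0\<close> and make
    \<open>phi\<close> vanish on all facet monomials. Nontriviality makes the image of K a
    subfield.\<close>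
  have one: "\<one>\<^bsub>A\<^esub> \<noteq> \<zero>\<^bsub>A\<^esub>"
  proof
    assume "\<one>\<^bsub>A\<^esub> = \<zero>\<^bsub>A\<^esub>"
    then have "1 - 0 \<in> I0" using to_A_eq_imp[of 1 0] by (simp add: to_A_simps)
    moreover obtain F where "F \<in> \<Delta>" "phi (face_monomial F) \<noteq> 0" using exists_facet by blast
    ultimately show False using Delta_V by (auto simp: I0_def)
  qed
  have sub: "subfield (?c ` K) A"
    using ring_hom_ring.img_is_subfield(2)[OF ring_hom_ringI2[OF KK.is_ring A.ring_axioms homc] KK.carrier_is_subfield one]
    by (simp add: sK)
  obtain Ss where Ss: "set Ss = Pow V" using finite_list finite_V by (metis finite_Pow_iff)
  let ?Us = "map (\<lambda>S. to_A (face_monomial S)) Ss"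
  have Us: "set ?Us \<subseteq> carrier A" using Ss by (auto simp: carrier_A)
  note sp = A.Span_subgroup_props[OF sub Us]
  define N where "N = {f \<in> Pol. to_A f \<in> A.Span (?c ` K) ?Us}"
  have N: "0 \<in> N" "\<And>p q. p \<in> N \<Longrightarrow> q \<in> N \<Longrightarrow> p + q \<in> N" "\<And>c p. c \<in> K \<Longrightarrow> p \<in> N \<Longrightarrow> Const c * p \<in> N"
  proof -
    show "0 \<in> N" using sp(2) by (simp add: N_def to_A_simps)
    show "p + q \<in> N" if "p \<in> N" "q \<in> N" for p q
      using sp(3)[of "to_A p" "to_A q"] that by (auto simp: N_def to_A_simps)
    show "Const c * p \<in> N" if "c \<in> K" "p \<in> N" for c p
      using A.Span_smult_closed[OF sub Us, of "?c c" "to_A p"] that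
      by (auto simp: N_def to_A_simps Pol_Const)
  qed
  have "mon m \<in> N" if m: "keys m \<subseteq> V" for m
  proof (rule monomial_mem_if_squarefree_mem[where n = d and j = "mdeg m", OF N(2,3,1) _ _ m refl])
    fix i :: nat and n :: "'v \<Rightarrow>\<^sub>0 nat"
    assume "i \<in> {1..d}" "keys n \<subseteq> V"
    then have "to_A (theta i * mon n) = to_A 0" "theta i * mon n \<in> Pol"
      by (auto intro!: to_A_theta_mult)
    then show "theta i * mon n \<in> N"
      using N(1) by (simp add: N_def)
  next
    fix n :: "'v \<Rightarrow>\<^sub>0 nat" assume n: "keys n \<subseteq> V" "mdeg n = mdeg m"
      "card (keys n) = mdeg m \<or> d < card (keys n)"
    let ?S = "keys n"
    show "mon n \<in> N"
    proof (cases "card ?S = mdeg n")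
      case True
      then have eq: "mon n = face_monomial ?S"
        using squarefree_monomial[OF True] by (simp add: face_monomial_eq_mon)
      have "to_A (face_monomial ?S) \<in> set ?Us" using n(1) Ss by auto
      then have "to_A (face_monomial ?S) \<in> A.Span (?c ` K) ?Us"
        using A.Span_base_incl[OF sub Us] by blast
      then show ?thesis
        unfolding N_def eq using Pol_face_monomial[OF n(1)] by blast
    next
      case False
      \<comment> \<open>The support is now too large to be a face, and its face monomial divides the
        given monomial.\<close>
      then have "d < card ?S" using n by auto
      have "?S \<notin> \<Delta>"
      proof
        assume "?S \<in> \<Delta>"
        then obtain F where "F \<in> keys \<mu>" "?S \<subseteq> F" by (auto simp: mem_Delta_iff)
        then have "card ?S \<le> d" using facet card_mono by metis
        then show False using \<open>d < card ?S\<close> by simp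
      qed
      have "n = set_mon ?S + (n - set_mon ?S)"
        by (rule poly_mapping_eqI) (auto simp: lookup_add lookup_minus lookup_set_mon in_keys_iff)
      then have eq: "mon n = face_monomial ?S * mon (n - set_mon ?S)"
        by (metis face_monomial_eq_mon finite_keys mon_add)
      have sub': "keys (n - set_mon ?S) \<subseteq> V"
        using n(1) by (auto simp: in_keys_iff lookup_minus)
      have "to_A (face_monomial ?S) \<otimes>\<^bsub>A\<^esub> to_A (mon (n - set_mon ?S)) = \<zero>\<^bsub>A\<^esub>"
        using to_A_nonface[OF n(1) \<open>?S \<notin> \<Delta>\<close>] Pol_mon[OF sub']
        by (simp add: carrier_A flip: to_A_simps(3))
      then have "to_A (mon n) = to_A 0"
        using n(1) sub' by (simp add: to_A_simps eq Pol_face_monomial Pol_mon)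
      moreover have "mon n \<in> Pol" using n(1) by (rule Pol_mon)
      ultimately show ?thesis using N(1) by (simp add: N_def)
    qed
  qed
  then have "Pol \<subseteq> N" using Pol_induct[OF _ N] by blast
  then have "carrier A \<subseteq> A.Span (?c ` K) ?Us" by (auto simp: carrier_A N_def)
  then have "carrier A = A.Span (?c ` K) ?Us" using sp(1) by blast
  then have "A.finite_dimension (?c ` K) (carrier A)"
    using A.Span_finite_dimension[OF sub Us] by simp
  moreover have "a i v \<in> K" if "i \<in> {1..d}" "v \<in> V" for i v
    unfolding a_V[OF that] by (intro K_power t_V(1) that)
  ultimately show ?thesis
    by (simp add: is_lsop_def A_def V_def)
qed

end

section \<open>Links of vertices\<close>

lemma boundary_zero [simp]: "boundary 0 = 0"
  by (simp add: boundary_def)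

lemma sign_power_CHAR:
  assumes "prime p" "CHAR('a::comm_ring_1) = p" "s = 1 \<or> s = (-1 :: 'a)"
  shows "s ^ p = s"
  using freshmans_dream_minus_one[where 'a = 'a] assms by auto

lemma shuffle_sign_power_CHAR:
  assumes "prime p" "CHAR('a::comm_ring_1) = p"
  shows "shuffle_sign A B ^ p = (shuffle_sign A B :: 'a)"
  using assms by (rule sign_power_CHAR) (rule shuffle_sign_cases)

text \<open>The link of a vertex carries the link cycle of \<open>\<mu>\<close> and its Frobenius twist; they are
  proportional because the top homology of the link is a line.\<close>

lemma cycle_frobenius_on_star:
  fixes \<mu> :: "'v::linorder set \<Rightarrow>\<^sub>0 'k::field"
  assumes p: "prime p" "CHAR('k) = p"
    and cycle: "simplicial_cycle (int d - 1) \<mu>"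
    and v: "v \<in> \<Union>(chain_support \<mu>)"
    and iso: "linearly_isomorphic
        (reduced_homology (link {v} (chain_support \<mu>)) (int d - 2) :: ('k, ('v set \<Rightarrow>\<^sub>0 'k) set) module)
        scalar_module"
  obtains c where "c \<noteq> 0"
    "\<And>F. F \<in> keys \<mu> \<Longrightarrow> v \<in> F \<Longrightarrow> lookup \<mu> F ^ p = c * lookup \<mu> F"
proof -
  have p0: "p > 0" using p(1) prime_gt_0_nat by blast
  let ?L = "link {v} (chain_support \<mu>)"
  have facet: "finite F" "int (card F) = int d" if "F \<in> keys \<mu>" for F
    using cycle that by (auto simp: simplicial_cycle_def chains_def)
  \<comment> \<open>Coefficients of the link cycle. The sign is the one with which G occurs in the
    boundary of \<open>insert v G\<close>.\<close>
  define g :: "'v set \<Rightarrow> 'k" where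
    "g G = (if v \<notin> G then shuffle_sign G {v} * lookup \<mu> (insert v G) else 0)" for G
  define z where "z = Abs_poly_mapping g"
  have g_supp: "{G. g G \<noteq> 0} = {G. v \<notin> G \<and> insert v G \<in> keys \<mu>}"
    by (auto simp: g_def in_keys_iff)
  have "{G. g G \<noteq> 0} \<subseteq> (\<lambda>F. F - {v}) ` keys \<mu>"
  proof
    fix G assume "G \<in> {G. g G \<noteq> 0}"
    then have "G = insert v G - {v}" "insert v G \<in> keys \<mu>" unfolding g_supp by auto
    then show "G \<in> (\<lambda>F. F - {v}) ` keys \<mu>" by (rule image_eqI)
  qed
  then have fin: "finite {G. g G \<noteq> 0}" by (rule finite_subset) simp
  have z: "lookup z = g" unfolding z_def by (rule lookup_Abs_poly_mapping[OF fin])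
  have keys_z: "G \<in> keys z \<longleftrightarrow> v \<notin> G \<and> insert v G \<in> keys \<mu>" for G
    using g_supp by (auto simp: in_keys_iff z)
  define zp where "zp = Poly_Mapping.map (\<lambda>x. x ^ p) z"
  have zp: "lookup zp G = g G ^ p" for G
    using p0 by (simp add: zp_def Poly_Mapping.map.rep_eq z when_def zero_power)
  have keys_zp: "keys zp = keys z"
    using p0 by (auto simp: in_keys_iff zp z)
  have keys_fin: "finite G" "int (card G) = int d - 1" "G \<in> ?L" if "G \<in> keys z" for G
  proof -
    have G: "v \<notin> G" "insert v G \<in> keys \<mu>" using that keys_z by auto
    show "finite G" using facet(1)[OF G(2)] by simp
    then show "int (card G) = int d - 1" using facet(2)[OF G(2)] G(1) by simp
    show "G \<in> ?L" using G by (auto simp: link_def chain_support_def)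
  qed
  have chains: "z \<in> chains ?L (int d - 2)" "zp \<in> chains ?L (int d - 2)"
    using keys_fin by (auto simp: chains_def keys_zp)
  \<comment> \<open>If v is in S, no face of \<open>z\<close> contains S. Otherwise the coefficient
    is, up to a sign depending on S only, that of the boundary of \<mu> at
    \<open>insert v S\<close>: exchanging v with the other removed vertex changes the sign
    uniformly.\<close>
  have bz: "lookup (boundary z) S = 0" for S
  proof -
    let ?I = "{G. G \<in> keys z \<and> S \<subseteq> G \<and> card (G - S) = 1}"
    have eq: "lookup (boundary z) S = (\<Sum>G\<in>?I. shuffle_sign S (G - S) * g G)"
      by (subst lookup_boundary) (auto simp: keys_fin z)
    show ?thesis
    proof (cases "v \<in> S")
      case True
      then have "?I = {}" using keys_z by auto
      then show ?thesis unfolding eq by (simp only: sum.empty)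
    next
      case False
      let ?J = "{F. F \<in> keys \<mu> \<and> insert v S \<subseteq> F \<and> card (F - insert v S) = 1}"
      have bij: "bij_betw (insert v) ?I ?J"
      proof (rule bij_betw_byWitness[where f' = "\<lambda>F. F - {v}"])
        show "\<forall>G\<in>?I. insert v G - {v} = G" using keys_z by auto
        show "\<forall>F\<in>?J. insert v (F - {v}) = F" by auto
        show "insert v ` ?I \<subseteq> ?J"
        proof safe
          fix G assume G: "G \<in> keys z" "S \<subseteq> G" "card (G - S) = 1"
          show "insert v G \<in> keys \<mu>" using G keys_z by auto
          have "insert v G - insert v S = G - S" using G keys_z by auto
          then show "card (insert v G - insert v S) = 1" using G by simp
        qed (use False in auto)
        show "(\<lambda>F. F - {v}) ` ?J \<subseteq> ?I"
        proof safe
          fix F assume F: "F \<in> keys \<mu>" "insert v S \<subseteq> F" "card (F - insert v S) = 1"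
          have "insert v (F - {v}) = F" using F by auto
          then show "F - {v} \<in> keys z" using F by (simp add: keys_z)
          have "F - {v} - S = F - insert v S" by auto
          then show "card (F - {v} - S) = 1" using F by simp
        qed (use False in auto)
      qed
      have summand: "shuffle_sign S (G - S) * g G = - shuffle_sign S {v} *
          (shuffle_sign (insert v S) (insert v G - insert v S) * lookup \<mu> (insert v G))"
        if G: "G \<in> ?I" for G
      proof -
        have Gk: "G \<in> keys z" "S \<subseteq> G" "card (G - S) = 1" using G by blast+
        have vG: "v \<notin> G" "finite G" using keys_z[of G] Gk(1) keys_fin(1)[OF Gk(1)] by blast+
        obtain w where w: "G - S = {w}" using Gk(3) by (auto simp: card_1_singleton_iff)
        have fS: "finite S" by (rule finite_subset[OF Gk(2) vG(2)])
        have Gw: "G = S \<union> {w}" "w \<notin> S" "w \<noteq> v" "insert v G - insert v S = {w}"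
          using w Gk(2) vG(1) by blast+
        have "shuffle_sign G {v} = shuffle_sign S {v} * (shuffle_sign {w} {v} :: 'k)"
          unfolding Gw(1) by (rule shuffle_sign_Un_left) (use fS Gw(2) in auto)
        moreover have "shuffle_sign (insert v S) {w} = shuffle_sign {v} {w} * (shuffle_sign S {w} :: 'k)"
          using shuffle_sign_Un_left[of "{v}" S "{w}"] fS False by simp
        moreover have "shuffle_sign {w} {v} = - (shuffle_sign {v} {w} :: 'k)"
          using Gw(3) by (auto simp: shuffle_sign_def)
        ultimately show ?thesis
          unfolding Gw(4) w by (simp add: g_def vG mult_ac)
      qed
      have "lookup (boundary z) S = (\<Sum>G\<in>?I. - shuffle_sign S {v} *
          (shuffle_sign (insert v S) (insert v G - insert v S) * lookup \<mu> (insert v G)))"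
        unfolding eq by (rule sum.cong[OF refl]) (rule summand)
      also have "\<dots> = - shuffle_sign S {v} * (\<Sum>F\<in>?J. shuffle_sign (insert v S) (F - insert v S) * lookup \<mu> F)"
        unfolding sum_distrib_left[symmetric]
        by (intro arg_cong2[of _ _ _ _ "(*)"] refl sum.reindex_bij_betw[OF bij])
      also have "(\<Sum>F\<in>?J. shuffle_sign (insert v S) (F - insert v S) * lookup \<mu> F) =
          lookup (boundary \<mu>) (insert v S)"
        by (rule lookup_boundary[symmetric]) (rule facet)
      also have "\<dots> = 0" using cycle by (simp add: simplicial_cycle_def)
      finally show ?thesis by simp
    qed
  qed
  \<comment> \<open>Frobenius is additive and fixes the boundary signs, so the boundary of the twist
    is the twist of the boundary.\<close>
  have bzp: "lookup (boundary zp) S = 0" for S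
  proof -
    let ?I = "{G. G \<in> keys z \<and> S \<subseteq> G \<and> card (G - S) = 1}"
    have "lookup (boundary zp) S = (\<Sum>G\<in>?I. shuffle_sign S (G - S) * g G ^ p)"
      by (subst lookup_boundary) (auto simp: keys_fin keys_zp zp)
    also have "\<dots> = (\<Sum>G\<in>?I. (shuffle_sign S (G - S) * g G) ^ p)"
      by (simp only: power_mult_distrib shuffle_sign_power_CHAR[OF p])
    also have "\<dots> = (\<Sum>G\<in>?I. shuffle_sign S (G - S) * g G) ^ p"
      by (rule freshmans_dream_sum[symmetric]) (use p in auto)
    also have "(\<Sum>G\<in>?I. shuffle_sign S (G - S) * g G) = lookup (boundary z) S"
      by (subst lookup_boundary) (auto simp: keys_fin z)
    finally show ?thesis using p0 bz by (simp add: zero_power)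
  qed
  have b0: "boundary z = 0" "boundary zp = 0"
    using bz bzp by (auto intro!: poly_mapping_eqI)
  \<comment> \<open>A face of the link has at most d - 1 vertices, so there is nothing to bound in
    this degree, and every homology class consists of a single cycle.\<close>
  have bd: "(boundaries ?L (int d - 2) :: ('v set \<Rightarrow>\<^sub>0 'k) set) = {0}"
  proof -
    have "F \<notin> ?L" if "finite F" "int (card F) = int d" for F
    proof
      assume "F \<in> ?L"
      then obtain F' where F': "F' \<in> keys \<mu>" "insert v F \<subseteq> F'" "v \<notin> F"
        by (auto simp: link_def chain_support_def)
      have "card (insert v F) \<le> card F'" by (rule card_mono) (use F' facet in auto)
      then show False using facet(2)[OF F'(1)] F' that by simp
    qed
    then have "chains ?L (int d - 1) = {0 :: 'v set \<Rightarrow>\<^sub>0 'k}"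
      by (auto simp: chains_def intro!: poly_mapping_eqI) (metis in_keys_iff)
    moreover have "int d - 2 + 1 = int d - 1" by simp
    ultimately show ?thesis by (simp add: boundaries_def)
  qed
  let ?M = "cycle_module ?L (int d - 2) :: ('k, 'v set \<Rightarrow>\<^sub>0 'k) module"
  let ?H = "reduced_homology ?L (int d - 2) :: ('k, ('v set \<Rightarrow>\<^sub>0 'k) set) module"
  have add_M: "add ?M = (+)" "\<And>a x. a \<odot>\<^bsub>?M\<^esub> x = Poly_Mapping.map ((*) a) x"
    "carrier ?M = {c \<in> chains ?L (int d - 2). boundary c = 0}"
    by (simp_all add: cycle_module_def)
  have H: "carrier ?H = (\<lambda>x. {x}) ` carrier ?M" "\<And>x y. {x} \<oplus>\<^bsub>?H\<^esub> {y} = {x + y}"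
    "\<And>a x. a \<odot>\<^bsub>?H\<^esub> {x} = {Poly_Mapping.map ((*) a) x}"
    by (auto simp: reduced_homology_def quotient_module_def bd add_M A_RCOSETS_def' a_r_coset_def'
        set_add_def' )
  obtain f where f: "f \<in> iso (add_monoid ?H) (add_monoid scalar_module)"
    "\<And>a x. x \<in> carrier ?H \<Longrightarrow> f (a \<odot>\<^bsub>?H\<^esub> x) = a \<odot>\<^bsub>scalar_module\<^esub> f x"
    using iso unfolding linearly_isomorphic_def by blast
  have f_inj: "inj_on f (carrier ?H)"
    using f(1) by (simp add: iso_def bij_betw_def)
  have f_scale: "f {Poly_Mapping.map ((*) a) x} = a * f {x}" if "x \<in> carrier ?M" for a x
    using f(2)[of "{x}" a] that by (auto simp: H scalar_module_def)
  have zM: "z \<in> carrier ?M" "zp \<in> carrier ?M" using chains b0 by (auto simp: add_M)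
  obtain F where F: "F \<in> keys \<mu>" "v \<in> F" using v by (auto simp: chain_support_def)
  have kF: "F - {v} \<in> keys z" using F by (simp add: keys_z insert_absorb)
  then have z0: "z \<noteq> 0" by auto
  have gF: "g (F - {v}) \<noteq> 0" using kF by (simp add: in_keys_iff z)
  have scale0: "Poly_Mapping.map ((*) 0) x = 0" for x :: "'v set \<Rightarrow>\<^sub>0 'k"
    by (rule poly_mapping_eqI) (simp add: Poly_Mapping.map.rep_eq when_def)
  have zeroM: "0 \<in> carrier ?M" by (simp add: add_M chains_def)
  have "f {0} = 0" using f_scale[OF zeroM, of 0] by (simp add: scale0)
  moreover have "f {z} \<noteq> f {0}"
    using inj_onD[OF f_inj, of "{z}" "{0}"] zM zeroM z0 by (auto simp: H)
  ultimately have fz: "f {z} \<noteq> 0" by simp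
  \<comment> \<open>The isomorphism takes values in a line and is nonzero on the link cycle, so the
    image of the twist is a multiple of it; injectivity carries this back to the cycles.\<close>
  define c where "c = f {zp} / f {z}"
  let ?cz = "Poly_Mapping.map ((*) c) z"
  have lcz: "lookup ?cz G = c * g G" for G
    by (simp add: Poly_Mapping.map.rep_eq z when_def)
  have "?cz \<in> carrier ?M"
  proof -
    have sub: "keys ?cz \<subseteq> keys z" by (auto simp: in_keys_iff lcz z)
    have "lookup (boundary ?cz) S = 0" for S
    proof -
      let ?I = "{G. G \<in> keys z \<and> S \<subseteq> G \<and> card (G - S) = 1}"
      have "lookup (boundary ?cz) S =
          (\<Sum>G | G \<in> keys ?cz \<and> S \<subseteq> G \<and> card (G - S) = 1. shuffle_sign S (G - S) * (c * g G))"
        by (subst lookup_boundary) (use sub keys_fin in \<open>auto simp: lcz\<close>)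
      also have "\<dots> = (\<Sum>G\<in>?I. shuffle_sign S (G - S) * (c * g G))"
        by (rule sum.mono_neutral_left) (use sub in \<open>auto simp: in_keys_iff lcz\<close>)
      also have "\<dots> = c * (\<Sum>G\<in>?I. shuffle_sign S (G - S) * g G)"
        by (simp add: sum_distrib_left mult.left_commute)
      also have "(\<Sum>G\<in>?I. shuffle_sign S (G - S) * g G) = lookup (boundary z) S"
        by (subst lookup_boundary) (auto simp: keys_fin z)
      finally show ?thesis by (simp add: bz)
    qed
    then have "boundary ?cz = 0" by (intro poly_mapping_eqI) simp
    moreover have "?cz \<in> chains ?L (int d - 2)"
      using sub chains(1) by (auto simp: chains_def)
    ultimately show ?thesis by (simp add: add_M)
  qed
  moreover have "f {?cz} = f {zp}" using f_scale[OF zM(1), of c] fz by (simp add: c_def)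
  ultimately have "{?cz} = {zp}"
    using inj_onD[OF f_inj, of "{?cz}" "{zp}"] zM(2) by (auto simp: H)
  then have "?cz = zp" by simp
  then have main: "g G ^ p = c * g G" for G by (metis lcz zp)
  show thesis
  proof (rule that[of c])
    show "c \<noteq> 0" using main[of "F - {v}"] gF by auto
    fix F assume F: "F \<in> keys \<mu>" "v \<in> F"
    let ?s = "shuffle_sign (F - {v}) {v} :: 'k"
    have "g (F - {v}) = ?s * lookup \<mu> F" using F by (simp add: g_def insert_absorb)
    then have "?s * lookup \<mu> F ^ p = ?s * (c * lookup \<mu> F)"
      using main[of "F - {v}"] by (simp add: power_mult_distrib shuffle_sign_power_CHAR[OF p] mult_ac)
    then have "?s * (?s * lookup \<mu> F ^ p) = ?s * (?s * (c * lookup \<mu> F))"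
      by simp
    then show "lookup \<mu> F ^ p = c * lookup \<mu> F" by simp
  qed
qed

section \<open>Independence over \<open>p\<close>-th powers\<close>

lemma CHAR_poly_mapping [simp]: "CHAR('a::comm_monoid_add \<Rightarrow>\<^sub>0 'b::comm_semiring_1) = CHAR('b)"
proof (rule CHAR_eqI)
  have *: "(of_nat n :: 'a \<Rightarrow>\<^sub>0 'b) = 0 \<longleftrightarrow> (of_nat n :: 'b) = 0" for n
  proof -
    have "(of_nat n :: 'a \<Rightarrow>\<^sub>0 'b) = Poly_Mapping.single 0 (of_nat n)" by simp
    moreover have "Poly_Mapping.single (0 :: 'a) c = 0 \<longleftrightarrow> c = 0" for c :: 'b
      using lookup_single_eq[of "0 :: 'a" c] by (auto simp del: lookup_single_eq)
    ultimately show ?thesis by (simp only:)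
  qed
  show "of_nat CHAR('b) = (0 :: 'a \<Rightarrow>\<^sub>0 'b)" by (simp add: *)
  show "CHAR('b) dvd n" if "of_nat n = (0 :: 'a \<Rightarrow>\<^sub>0 'b)" for n
    using that by (simp add: * of_nat_eq_0_iff_char_dvd)
qed

definition scale_mon :: "nat \<Rightarrow> (nat \<Rightarrow>\<^sub>0 nat) \<Rightarrow> (nat \<Rightarrow>\<^sub>0 nat)" where
  "scale_mon p m = (\<Sum>i<p. m)"

lemma lookup_scale_mon [simp]: "lookup (scale_mon p m) v = p * lookup m v"
  unfolding scale_mon_def lookup_sum by simp

lemma single_power: "Poly_Mapping.single m c ^ p = Poly_Mapping.single (scale_mon p m) (c ^ p :: 'k::comm_semiring_1)"
proof (induction p)
  case 0
  show ?case unfolding scale_mon_def by simp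
next
  case (Suc p)
  have "scale_mon (Suc p) m = m + scale_mon p m"
    unfolding scale_mon_def by (simp only: sum.lessThan_Suc add.commute)
  then show ?case by (simp only: power_Suc Suc.IH mult_single)
qed

lemma frobenius_poly_mapping:
  fixes f :: "(nat \<Rightarrow>\<^sub>0 nat) \<Rightarrow>\<^sub>0 'k::field"
  assumes "prime p" "CHAR('k) = p"
  shows "f ^ p = (\<Sum>m \<in> keys f. Poly_Mapping.single (scale_mon p m) (lookup f m ^ p))"
proof -
  have "f ^ p = (\<Sum>m \<in> keys f. Poly_Mapping.single m (lookup f m)) ^ p"
    by (simp only: poly_mapping_sum_singles)
  also have "\<dots> = (\<Sum>m \<in> keys f. Poly_Mapping.single m (lookup f m) ^ p)"
    by (rule freshmans_dream_sum) (use assms in simp_all)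
  finally show ?thesis by (simp only: single_power)
qed

lemma lookup_single_mult_add:
  fixes y :: "'a::cancel_comm_monoid_add \<Rightarrow>\<^sub>0 'k::comm_semiring_1"
  shows "lookup (Poly_Mapping.single a 1 * y) b =
    (\<Sum>m \<in> keys y. lookup y m when a + m = b)"
proof -
  have "Poly_Mapping.single a 1 * y =
      Poly_Mapping.single a 1 * (\<Sum>m \<in> keys y. Poly_Mapping.single m (lookup y m))"
    by (simp add: poly_mapping_sum_singles)
  then show ?thesis by (simp add: sum_distrib_left mult_single lookup_sum lookup_single)
qed

definition exponent_mon :: "('v \<Rightarrow> nat) \<Rightarrow> 'v set \<Rightarrow> ('v \<Rightarrow> nat) \<Rightarrow> (nat \<Rightarrow>\<^sub>0 nat)" where
  "exponent_mon e V \<epsilon> = (\<Sum>v\<in>V. Poly_Mapping.single (e v) (\<epsilon> v))"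

lemma lookup_exponent_mon:
  assumes "finite V" "inj_on e V" "v \<in> V"
  shows "lookup (exponent_mon e V \<epsilon>) (e v) = \<epsilon> v"
proof -
  have "lookup (exponent_mon e V \<epsilon>) (e v) = (\<Sum>w\<in>V. if w = v then \<epsilon> v else 0)"
    unfolding exponent_mon_def lookup_sum
    by (rule sum.cong[OF refl]) (use assms in \<open>auto simp: lookup_single when_def inj_on_def\<close>)
  then show ?thesis using assms by simp
qed

text \<open>A sum of scalar multiples of \<open>p\<close>-th powers has only exponents divisible by \<open>p\<close>, so
  the monomials \<open>\<Prod>v. x\<^sub>v ^ \<epsilon>\<^sub>v\<close> with \<open>\<epsilon>\<^sub>v < p\<close> separate such sums.\<close>

lemma p_basis_independence_poly:
  fixes f :: "'f \<Rightarrow> ('v \<Rightarrow> nat) \<Rightarrow> (nat \<Rightarrow>\<^sub>0 nat) \<Rightarrow>\<^sub>0 'k::field"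
  assumes p: "prime p" "CHAR('k) = p" and V: "finite V" "inj_on e V" and Fs: "finite Fs"
    and zero: "(\<Sum>\<epsilon> \<in> V \<rightarrow>\<^sub>E {..<p}. Poly_Mapping.single (exponent_mon e V \<epsilon>) 1 *
      (\<Sum>F\<in>Fs. Poly_Mapping.single 0 (c F) * f F \<epsilon> ^ p)) = 0"
    and eps: "\<epsilon>\<^sub>0 \<in> V \<rightarrow>\<^sub>E {..<p}"
  shows "(\<Sum>F\<in>Fs. Poly_Mapping.single 0 (c F) * f F \<epsilon>\<^sub>0 ^ p) = 0"
proof -
  have p0: "p > 0" using p(1) prime_gt_0_nat by blast
  define y where "y \<epsilon> = (\<Sum>F\<in>Fs. Poly_Mapping.single 0 (c F) * f F \<epsilon> ^ p)" for \<epsilon>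
  \<comment> \<open>Scalars from the ground field leave exponents unchanged, so only the exponents
    of p-th powers can occur.\<close>
  have y: "\<exists>n. m = scale_mon p n" if "m \<in> keys (y \<epsilon>)" for m \<epsilon>
  proof (rule ccontr)
    assume no: "\<not> ?thesis"
    have "y \<epsilon> = (\<Sum>F\<in>Fs. \<Sum>n \<in> keys (f F \<epsilon>).
        Poly_Mapping.single (scale_mon p n) (c F * lookup (f F \<epsilon>) n ^ p))"
      by (simp add: y_def frobenius_poly_mapping[OF p] sum_distrib_left mult_single)
    then have "lookup (y \<epsilon>) m = 0"
      using no by (auto simp: lookup_sum lookup_single when_def intro!: sum.neutral)
    then show False using that by (simp add: in_keys_iff)
  qed
  have "lookup (y \<epsilon>\<^sub>0) m = 0" for m
  proof (cases "m \<in> keys (y \<epsilon>\<^sub>0)")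
    case True
    then obtain n where n: "m = scale_mon p n" using y by blast
    \<comment> \<open>At this exponent the residues modulo p determine \<epsilon>, so all other
      summands have coefficient 0 there.\<close>
    let ?b = "exponent_mon e V \<epsilon>\<^sub>0 + m"
    have other: "lookup (Poly_Mapping.single (exponent_mon e V \<epsilon>) 1 * y \<epsilon>) ?b = 0"
      if e: "\<epsilon> \<in> V \<rightarrow>\<^sub>E {..<p}" "\<epsilon> \<noteq> \<epsilon>\<^sub>0" for \<epsilon>
      unfolding lookup_single_mult_add
    proof (rule sum.neutral, rule ballI)
      fix m' assume "m' \<in> keys (y \<epsilon>)"
      then obtain n' where n': "m' = scale_mon p n'" using y by blast
      have "exponent_mon e V \<epsilon> + m' \<noteq> ?b"
      proof
        assume eq: "exponent_mon e V \<epsilon> + m' = ?b"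
        have "\<epsilon> v = \<epsilon>\<^sub>0 v" if v: "v \<in> V" for v
        proof -
          have "\<epsilon> v + p * lookup n' (e v) = \<epsilon>\<^sub>0 v + p * lookup n (e v)"
            using arg_cong[OF eq, of "\<lambda>m. lookup m (e v)"]
            by (simp add: lookup_add lookup_exponent_mon[OF V v] n n')
          then have "\<epsilon> v mod p = \<epsilon>\<^sub>0 v mod p" by (metis mod_mult_self2)
          moreover have "\<epsilon> v < p" "\<epsilon>\<^sub>0 v < p" using v e(1) eps by auto
          ultimately show ?thesis by simp
        qed
        then have "\<epsilon> = \<epsilon>\<^sub>0" using PiE_ext[OF e(1) eps] by blast
        then show False using e(2) by simp
      qed
      then show "(lookup (y \<epsilon>) m' when exponent_mon e V \<epsilon> + m' = ?b) = 0" by simp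
    qed
    have fin: "finite (V \<rightarrow>\<^sub>E {..<p})" using V(1) by (intro finite_PiE) auto
    have "0 = (\<Sum>\<epsilon> \<in> V \<rightarrow>\<^sub>E {..<p}. lookup (Poly_Mapping.single (exponent_mon e V \<epsilon>) 1 * y \<epsilon>) ?b)"
      using arg_cong[OF zero, of "\<lambda>g. lookup g ?b"] by (simp add: y_def lookup_sum)
    also have "\<dots> = (\<Sum>\<epsilon> \<in> {\<epsilon>\<^sub>0}. lookup (Poly_Mapping.single (exponent_mon e V \<epsilon>) 1 * y \<epsilon>) ?b)"
      by (rule sum.mono_neutral_right) (use fin eps other in auto)
    also have "\<dots> = lookup (y \<epsilon>\<^sub>0) m"
      using True by (simp add: lookup_single_mult_add when_def)
    finally show ?thesis by simp
  qed (simp add: in_keys_iff)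
  then have "y \<epsilon>\<^sub>0 = 0" by (intro poly_mapping_eqI) simp
  then show ?thesis by (simp add: y_def)
qed

section \<open>Rational functions inside the universal domain\<close>

definition iota :: "((nat \<Rightarrow>\<^sub>0 nat) \<Rightarrow>\<^sub>0 'k::field) \<Rightarrow> 'k universal_domain" where
  "iota f = to_ac (Fraction_Field.Fract f 1)"

lemma iota_simps [simp]: "iota 0 = 0" "iota 1 = 1" "iota (f + g) = iota f + iota g"
  "iota (f * g) = iota f * iota g" "iota (- f) = - iota f"
proof -
  show "iota 0 = 0" "iota 1 = 1"
    by (simp_all add: iota_def flip: Zero_fract_def One_fract_def)
  show "iota (f + g) = iota f + iota g" "iota (f * g) = iota f * iota g" "iota (- f) = - iota f"
    unfolding iota_def to_ac_add[symmetric] to_ac_mult[symmetric] to_ac_minus[symmetric] to_ac_eq_iff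
    by simp_all
qed

lemma iota_eq_0_iff [simp]: "iota f = 0 \<longleftrightarrow> f = 0"
  unfolding iota_def to_ac_eq_0_iff Zero_fract_def by (simp add: eq_fract)

lemma iota_power: "iota (f ^ n) = iota f ^ n"
  by (induction n) simp_all

lemma iota_sum: "iota (sum f A) = (\<Sum>x\<in>A. iota (f x))"
  by (induction A rule: infinite_finite_induct) simp_all

lemma iota_prod: "iota (prod f A) = (\<Prod>x\<in>A. iota (f x))"
  by (induction A rule: infinite_finite_induct) simp_all

lemma to_universal_eq: "to_universal c = iota (Poly_Mapping.single 0 c)"
  by (simp add: to_universal_def iota_def)

text \<open>The extension field of the theorem. Independence over p-th powers would fail in the
  algebraic closure, where every element is a p-th power.\<close>

definition rational_functions :: "'k::field universal_domain set" where
  "rational_functions = range to_ac"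

lemma rational_function_cases:
  assumes "x \<in> rational_functions"
  obtains f g where "g \<noteq> 0" "iota g * x = iota f"
proof -
  obtain r where r: "x = to_ac r" using assms by (auto simp: rational_functions_def)
  obtain f g where fg: "r = Fraction_Field.Fract f g" "g \<noteq> 0" by (cases r) auto
  have "iota g * x = iota f"
    unfolding r fg(1) iota_def to_ac_mult[symmetric] using fg(2) by (simp add: eq_fract)
  then show thesis using that fg(2) by blast
qed

lemma common_denominator:
  assumes "finite S" "\<And>x. x \<in> S \<Longrightarrow> w x \<in> rational_functions"
  obtains D f where "D \<noteq> 0" "\<And>x. x \<in> S \<Longrightarrow> iota D * w x = iota (f x)"
proof -
  have "\<exists>D f. D \<noteq> 0 \<and> (\<forall>x\<in>S. iota D * w x = iota (f x))"
    using assms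
  proof (induction S rule: finite_induct)
    case empty
    show ?case by (intro exI[of _ 1]) simp
  next
    case (insert a S)
    obtain D f where D: "D \<noteq> 0" "\<forall>x\<in>S. iota D * w x = iota (f x)" using insert by auto
    obtain f' g where g: "g \<noteq> 0" "iota g * w a = iota f'"
      by (rule rational_function_cases[of "w a"]) (use insert.prems in auto)
    let ?f = "\<lambda>x. if x = a then D * f' else g * f x"
    have "iota (D * g) * w x = iota (?f x)" if "x \<in> insert a S" for x
    proof (cases "x = a")
      case True
      then show ?thesis using g(2) by (simp add: mult.assoc)
    next
      case False
      then have "iota D * w x = iota (f x)" using that D(2) by auto
      then show ?thesis using False by (simp add: mult.assoc mult.left_commute[of "iota D"])
    qed
    then show ?case using D(1) g(1) by (intro exI[of _ "D * g"] exI[of _ ?f]) auto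
  qed
  then show thesis using that by blast
qed

text \<open>Denominators are cleared by a common D. The relation gets multiplied by D ^ p, which is
  absorbed into the p-th powers and leaves a relation between polynomials.\<close>

lemma p_basis_independence:
  fixes w :: "'f \<Rightarrow> ('v \<Rightarrow> nat) \<Rightarrow> 'k::field universal_domain"
  assumes p: "prime p" "CHAR('k) = p" and V: "finite V" "inj_on e V" and Fs: "finite Fs"
    and w: "\<And>F \<epsilon>. F \<in> Fs \<Longrightarrow> \<epsilon> \<in> V \<rightarrow>\<^sub>E {..<p} \<Longrightarrow> w F \<epsilon> \<in> rational_functions"
    and zero: "(\<Sum>\<epsilon> \<in> V \<rightarrow>\<^sub>E {..<p}. (\<Prod>v\<in>V. iota (Poly_Mapping.single (Poly_Mapping.single (e v) 1) 1) ^ \<epsilon> v) *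
      (\<Sum>F\<in>Fs. to_universal (c F) * w F \<epsilon> ^ p)) = 0"
    and eps: "\<epsilon>\<^sub>0 \<in> V \<rightarrow>\<^sub>E {..<p}"
  shows "(\<Sum>F\<in>Fs. to_universal (c F) * w F \<epsilon>\<^sub>0 ^ p) = 0"
proof -
  let ?E = "V \<rightarrow>\<^sub>E {..<p}"
  have fin: "finite ?E" using V(1) by (intro finite_PiE) auto
  obtain D f where D: "D \<noteq> 0" "\<And>x. x \<in> Fs \<times> ?E \<Longrightarrow> iota D * (case x of (F, \<epsilon>) \<Rightarrow> w F \<epsilon>) = iota (f x)"
    by (rule common_denominator[of "Fs \<times> ?E" "\<lambda>(F, \<epsilon>). w F \<epsilon>"]) (use fin Fs w in auto)
  have Dw: "iota D ^ p * (\<Sum>F\<in>Fs. to_universal (c F) * w F \<epsilon> ^ p) =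
      iota (\<Sum>F\<in>Fs. Poly_Mapping.single 0 (c F) * f (F, \<epsilon>) ^ p)" if e: "\<epsilon> \<in> ?E" for \<epsilon>
  proof -
    have "iota D ^ p * (\<Sum>F\<in>Fs. to_universal (c F) * w F \<epsilon> ^ p) =
        (\<Sum>F\<in>Fs. to_universal (c F) * (iota D * w F \<epsilon>) ^ p)"
      by (simp only: sum_distrib_left power_mult_distrib mult.left_commute)
    also have "\<dots> = (\<Sum>F\<in>Fs. to_universal (c F) * iota (f (F, \<epsilon>)) ^ p)"
      using D(2)[of "(_, \<epsilon>)"] e by (intro sum.cong refl) simp
    finally show ?thesis by (simp only: iota_sum iota_simps iota_power to_universal_eq)
  qed
  have mon: "(\<Prod>v\<in>V. iota (Poly_Mapping.single (Poly_Mapping.single (e v) 1) 1 :: _ \<Rightarrow>\<^sub>0 'k) ^ \<epsilon> v) =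
      iota (Poly_Mapping.single (exponent_mon e V \<epsilon>) 1)" for \<epsilon>
  proof -
    have "Poly_Mapping.single (Poly_Mapping.single (e v) 1) 1 ^ n =
        (Poly_Mapping.single (Poly_Mapping.single (e v) n) 1 :: _ \<Rightarrow>\<^sub>0 'k)" for v n
      by (induction n) (simp_all add: mult_single flip: single_add)
    then show ?thesis
      by (simp add: exponent_mon_def mon_sum[OF V(1)] iota_prod flip: iota_power)
  qed
  have "iota (\<Sum>\<epsilon> \<in> ?E. Poly_Mapping.single (exponent_mon e V \<epsilon>) 1 *
      (\<Sum>F\<in>Fs. Poly_Mapping.single 0 (c F) * f (F, \<epsilon>) ^ p)) =
    (\<Sum>\<epsilon> \<in> ?E. iota (Poly_Mapping.single (exponent_mon e V \<epsilon>) 1) *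
      (iota D ^ p * (\<Sum>F\<in>Fs. to_universal (c F) * w F \<epsilon> ^ p)))"
    unfolding iota_sum[of _ ?E] by (rule sum.cong[OF refl]) (simp only: iota_simps Dw)
  also have "\<dots> = iota D ^ p * (\<Sum>\<epsilon> \<in> ?E. (\<Prod>v\<in>V. iota (Poly_Mapping.single (Poly_Mapping.single (e v) 1) 1) ^ \<epsilon> v) *
      (\<Sum>F\<in>Fs. to_universal (c F) * w F \<epsilon> ^ p))"
    unfolding mon sum_distrib_left[of "iota D ^ p" _ ?E] by (simp only: mult.left_commute)
  also have "\<dots> = 0" unfolding zero by simp
  finally have "(\<Sum>\<epsilon> \<in> ?E. Poly_Mapping.single (exponent_mon e V \<epsilon>) 1 *
      (\<Sum>F\<in>Fs. Poly_Mapping.single 0 (c F) * f (F, \<epsilon>) ^ p)) = 0" by simp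
  then have "(\<Sum>F\<in>Fs. Poly_Mapping.single 0 (c F) * f (F, \<epsilon>\<^sub>0) ^ p) = 0"
    by (rule p_basis_independence_poly[OF p V Fs _ eps])
  then have "iota D ^ p * (\<Sum>F\<in>Fs. to_universal (c F) * w F \<epsilon>\<^sub>0 ^ p) = 0"
    unfolding Dw[OF eps] by simp
  then show ?thesis using D(1) by simp
qed

interpretation rational_functions: subfield_type "rational_functions :: 'k::field universal_domain set"
proof
  let ?K = "rational_functions :: 'k universal_domain set"
  show "0 \<in> ?K" "1 \<in> ?K"
    unfolding rational_functions_def using to_ac_0 to_ac_1 by (metis rangeI)+
  fix a b assume "a \<in> ?K" "b \<in> ?K"
  then obtain r s where "a = to_ac r" "b = to_ac s" by (auto simp: rational_functions_def)
  then show "a - b \<in> ?K" "a * b \<in> ?K"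
    unfolding rational_functions_def by (metis to_ac_diff to_ac_mult rangeI)+
next
  fix a :: "'k universal_domain" assume "a \<in> rational_functions"
  then obtain r where "a = to_ac r" by (auto simp: rational_functions_def)
  then show "inverse a \<in> rational_functions"
    unfolding rational_functions_def by (metis to_ac_inverse rangeI)
qed

lemma iota_rational [intro]: "iota f \<in> rational_functions"
  by (simp add: iota_def rational_functions_def)

section \<open>Anisotropy\<close>

context moment_lsop
begin

lemma CHAR_l: "CHAR('l) = CHAR('k)"
proof (rule CHAR_eqI)
  have h: "h (of_nat n) = of_nat n" for n by (induction n) (simp_all add: h_add)
  show "of_nat CHAR('k) = (0 :: 'l)" using h[of "CHAR('k)"] by simp
  show "CHAR('k) dvd n" if "of_nat n = (0 :: 'l)" for n
    using that h[of n] by (metis h_eq_0_iff of_nat_eq_0_iff_char_dvd)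
qed

lemma h_power: "h (x ^ n) = h x ^ n"
  by (induction n) (simp_all add: h_mult)

text \<open>The monomial on S evaluates to 0 at facets not containing S; for the others
  \<open>wt_emon_set_mon\<close> yields the common factor \<open>face_const S\<close>.\<close>

lemma phi_hom_mult_set_mon:
  assumes f: "f \<in> hom_part i" and S: "S \<subseteq> V" "i + card S = d"
  shows "phi (f * mon (set_mon S)) = pairsign * face_const S *
    (\<Sum>F | F \<in> keys \<mu> \<and> S \<subseteq> F.
      h (lookup \<mu> F) * (shuffle_sign S (F - S) * vdm t (F - S) * ev F f))"
proof -
  have fin: "finite S" by (rule finite_subset_V[OF S(1)])
  have "f * mon (set_mon S) \<in> hom_part (i + card S)"
    using hom_mult[OF f hom_mon[of "set_mon S"]] S fin by simp
  then have "phi (f * mon (set_mon S)) = pairsign * (\<Sum>F \<in> keys \<mu>. wt F * ev F (f * mon (set_mon S)))"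
    using S(2) by (intro phi_hom) (auto simp: hom_iff)
  also have "(\<Sum>F \<in> keys \<mu>. wt F * ev F (f * mon (set_mon S))) =
    (\<Sum>F \<in> keys \<mu>. if S \<subseteq> F then face_const S *
      (h (lookup \<mu> F) * (shuffle_sign S (F - S) * vdm t (F - S) * ev F f)) else 0)"
  proof (rule sum.cong[OF refl])
    fix F assume F: "F \<in> keys \<mu>"
    have "wt F * ev F (f * mon (set_mon S)) = (wt F * emon F (set_mon S)) * ev F f"
      by (simp add: ev_mult mult_ac)
    then show "wt F * ev F (f * mon (set_mon S)) = (if S \<subseteq> F then face_const S *
      (h (lookup \<mu> F) * (shuffle_sign S (F - S) * vdm t (F - S) * ev F f)) else 0)"
      by (simp only: wt_emon_set_mon[OF F S(1)] mult.assoc if_distrib[of "\<lambda>x. x * _"] mult_zero_left)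
  qed
  also have "\<dots> = (\<Sum>F | F \<in> keys \<mu> \<and> S \<subseteq> F. face_const S *
      (h (lookup \<mu> F) * (shuffle_sign S (F - S) * vdm t (F - S) * ev F f)))"
    by (simp add: sum.If_cases Int_def)
  also have "\<dots> = face_const S * (\<Sum>F | F \<in> keys \<mu> \<and> S \<subseteq> F.
      h (lookup \<mu> F) * (shuffle_sign S (F - S) * vdm t (F - S) * ev F f))"
    by (simp only: sum_distrib_left)
  finally show ?thesis by (simp only: mult.assoc)
qed

text \<open>If \<open>f ^ p\<close> pairs to zero with the squarefree monomial on \<open>\<gamma>\<close>, then so does every coefficient of this
  pairing over the \<open>p\<close>-th powers.  For \<open>T\<close> disjoint from \<open>\<gamma>\<close> one of these coefficients is, by \<open>star\<close>, a nonzero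
  multiple of the \<open>p\<close>-th power of the pairing of \<open>f\<close> with the monomial on \<open>\<gamma> \<union> T\<close>.\<close>

lemma power_notin_I0:
  assumes p: "prime p" "CHAR('k) = p"
    and indep: "\<And>(Fs :: 'v set set) c w \<epsilon>\<^sub>0. finite Fs \<Longrightarrow>
      (\<And>F \<epsilon>. F \<in> Fs \<Longrightarrow> \<epsilon> \<in> V \<rightarrow>\<^sub>E {..<p} \<Longrightarrow> w F \<epsilon> \<in> K) \<Longrightarrow>
      (\<Sum>\<epsilon> \<in> V \<rightarrow>\<^sub>E {..<p}. (\<Prod>v\<in>V. t v ^ \<epsilon> v) * (\<Sum>F\<in>Fs. h (c F) * w F \<epsilon> ^ p)) = 0 \<Longrightarrow>
      \<epsilon>\<^sub>0 \<in> V \<rightarrow>\<^sub>E {..<p} \<Longrightarrow> (\<Sum>F\<in>Fs. h (c F) * w F \<epsilon>\<^sub>0 ^ p) = 0"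
    and star: "\<And>v. d \<ge> 2 \<Longrightarrow> v \<in> V \<Longrightarrow> \<exists>c. c \<noteq> 0 \<and>
      (\<forall>F \<in> keys \<mu>. v \<in> F \<longrightarrow> lookup \<mu> F ^ p = c * lookup \<mu> F)"
    and f: "f \<in> hom_part k" "f \<notin> I0" and pk: "p * k \<le> d"
  shows "f ^ p \<notin> I0"
proof
  assume fp: "f ^ p \<in> I0"
  have p2: "p \<ge> 2" using p(1) prime_ge_2_nat by blast
  have char_l: "CHAR('l) = p" using p(2) by (simp add: CHAR_l)
  \<comment> \<open>Squarefree monomials of complementary degree come first; the other monomials are
    reduced to them at the end.\<close>
  have test: "phi (f * mon (set_mon S)) = 0" if S: "S \<subseteq> V" "card S + k = d" for S
  proof (cases "k = 0")
    case True
    \<comment> \<open>In degree 0 the polynomial is a constant, and pairing its p-th power with the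
      same monomial decides directly. The residue expansion requires k > 0.\<close>
    have "keys f \<subseteq> {0}"
      using f(1) True by (auto simp: hom_iff mdeg_def in_keys_iff intro!: poly_mapping_eqI)
    then have "f = Const (lookup f 0)"
      by (intro poly_mapping_eqI) (auto simp: Const_def lookup_single when_def in_keys_iff)
    then obtain c where c: "f = Const c" by blast
    have "phi (Const (c ^ p) * mon (set_mon S)) = 0"
      using fp S(1) finite_subset_V[OF S(1)] by (auto simp: I0_iff c Const_power)
    then have "c = 0 \<or> phi (mon (set_mon S)) = 0" by auto
    then show ?thesis by (auto simp: c)
  next
    case False
    have fin: "finite S" by (rule finite_subset_V[OF S(1)])
    \<comment> \<open>These bounds give S at least k > 0 vertices, leave room for \<gamma> inside S,
      and force d to be at least 2, as \<open>star\<close> requires.\<close>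
    have "k \<le> p * k" "2 * k \<le> p * k" using p2 by simp_all
    then have d: "d \<ge> 2" "card S \<noteq> 0" "d - p * k \<le> card S"
      using False S(2) pk by linarith+
    obtain \<gamma> where \<gamma>: "\<gamma> \<subseteq> S" "card \<gamma> = d - p * k"
      using obtain_subset_with_card_n[OF d(3)] by blast
    define T where "T = S - \<gamma>"
    have fin\<gamma>: "finite \<gamma>" using \<gamma>(1) fin by (rule finite_subset)
    have S_eq: "S = \<gamma> \<union> T" "\<gamma> \<inter> T = {}" using \<gamma>(1) by (auto simp: T_def)
    have TV: "T \<subseteq> V" "finite T" using S(1) fin by (auto simp: T_def)
    have cT: "card T = (p - 1) * k"
    proof -
      have "card T = card S - card \<gamma>" using \<gamma>(1) fin\<gamma> by (simp add: T_def card_Diff_subset)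
      also have "\<dots> = p * k - k" using S(2) \<gamma>(2) pk by linarith
      finally show ?thesis by (simp add: diff_mult_distrib)
    qed
    have charL: "prime p" "CHAR('l) = p" by (fact p(1), fact char_l)
    obtain \<kappa> :: 'l and \<epsilon>\<^sub>0 W where W: "\<kappa> \<noteq> 0" "\<epsilon>\<^sub>0 \<in> V \<rightarrow>\<^sub>E {..<p}"
      "\<And>G \<epsilon>. G \<subseteq> V \<Longrightarrow> W G \<epsilon> \<in> K"
      "\<And>G. G \<subseteq> V \<Longrightarrow> card G = p * k \<Longrightarrow>
        vdm t G = (\<Sum>\<epsilon> \<in> V \<rightarrow>\<^sub>E {..<p}. (\<Prod>v\<in>V. t v ^ \<epsilon> v) * W G \<epsilon> ^ p)"
      "\<And>G. G \<subseteq> V \<Longrightarrow> card G = p * k \<Longrightarrow>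
        W G \<epsilon>\<^sub>0 = (if T \<subseteq> G then shuffle_sign T (G - T) * \<kappa> * vdm t (G - T) else 0)"
      by (rule vdm_frobenius_expansion[OF charL finite_V TV(1) cT, where t = t and K = K])
        (use False t_inj_V[of V] t_V in \<open>auto intro: K_closed\<close>)
    let ?Fs = "{F. F \<in> keys \<mu> \<and> \<gamma> \<subseteq> F}"
    have finFs: "finite ?Fs" by simp
    have G: "F - \<gamma> \<subseteq> V" "card (F - \<gamma>) = p * k" if F: "F \<in> ?Fs" for F
      using F facet facet_V fin\<gamma> \<gamma>(2) pk by (auto simp: card_Diff_subset)
    \<comment> \<open>The p-th root of the cofactor of the basis monomial and of the coefficient of
      \<mu>; the sign may be included because it equals its p-th power.\<close>
    define w where "w F \<epsilon> = shuffle_sign \<gamma> (F - \<gamma>) * W (F - \<gamma>) \<epsilon> * ev F f" for F \<epsilon>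
    have ev_K: "ev F f \<in> K" if "F \<in> keys \<mu>" for F
    proof -
      have "lookup f m \<in> K" for m using hom_Pol[OF f(1)] by (simp add: Pol_iff)
      then show ?thesis unfolding ev_def linext_def by (intro K_sum K_mult emon_K that)
    qed
    have ss_K: "shuffle_sign A B \<in> K" for A B :: "'v set"
      using shuffle_sign_cases[of A B, where 'a = 'l] K_1 K_uminus[OF K_1] by auto
    have ss_p: "shuffle_sign A B ^ p = (shuffle_sign A B :: 'l)" for A B :: "'v set"
      by (rule shuffle_sign_power_CHAR[OF charL])
    have "phi (f ^ p * mon (set_mon \<gamma>)) = 0"
      using fp S(1) \<gamma>(1) fin\<gamma> by (simp add: I0_iff)
    moreover have "phi (f ^ p * mon (set_mon \<gamma>)) = pairsign * face_const \<gamma> *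
      (\<Sum>F\<in>?Fs. h (lookup \<mu> F) * (shuffle_sign \<gamma> (F - \<gamma>) * vdm t (F - \<gamma>) * ev F (f ^ p)))"
      by (rule phi_hom_mult_set_mon[OF hom_power[OF f(1)]]) (use S(1) \<gamma> pk in auto)
    moreover have "face_const \<gamma> \<noteq> 0" using S(1) \<gamma>(1) by (intro face_const_neq_0) auto
    ultimately have "0 = (\<Sum>F\<in>?Fs. h (lookup \<mu> F) *
        (shuffle_sign \<gamma> (F - \<gamma>) * vdm t (F - \<gamma>) * ev F (f ^ p)))" by simp
    also have "\<dots> = (\<Sum>F\<in>?Fs. \<Sum>\<epsilon> \<in> V \<rightarrow>\<^sub>E {..<p}. (\<Prod>v\<in>V. t v ^ \<epsilon> v) *
        (h (lookup \<mu> F) * w F \<epsilon> ^ p))"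
    proof (rule sum.cong[OF refl])
      fix F assume F: "F \<in> ?Fs"
      show "h (lookup \<mu> F) * (shuffle_sign \<gamma> (F - \<gamma>) * vdm t (F - \<gamma>) * ev F (f ^ p)) =
        (\<Sum>\<epsilon> \<in> V \<rightarrow>\<^sub>E {..<p}. (\<Prod>v\<in>V. t v ^ \<epsilon> v) * (h (lookup \<mu> F) * w F \<epsilon> ^ p))"
        unfolding W(4)[OF G[OF F]] w_def power_mult_distrib ss_p ev_power sum_distrib_left sum_distrib_right
        by (rule sum.cong[OF refl]) (simp only: mult_ac)
    qed
    also have "\<dots> = (\<Sum>\<epsilon> \<in> V \<rightarrow>\<^sub>E {..<p}. (\<Prod>v\<in>V. t v ^ \<epsilon> v) *
        (\<Sum>F\<in>?Fs. h (lookup \<mu> F) * w F \<epsilon> ^ p))"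
      unfolding sum_distrib_left by (rule sum.swap)
    finally have zero: "(\<Sum>\<epsilon> \<in> V \<rightarrow>\<^sub>E {..<p}. (\<Prod>v\<in>V. t v ^ \<epsilon> v) *
        (\<Sum>F\<in>?Fs. h (lookup \<mu> F) * w F \<epsilon> ^ p)) = 0" by simp
    have "w F \<epsilon> \<in> K" if "F \<in> ?Fs" for F \<epsilon>
      unfolding w_def using that by (intro K_mult ss_K W(3) G ev_K) auto
    from indep[OF finFs this zero W(2)]
    have *: "(\<Sum>F\<in>?Fs. h (lookup \<mu> F) * w F \<epsilon>\<^sub>0 ^ p) = 0" .
    let ?X = "\<lambda>F. shuffle_sign S (F - S) * vdm t (F - S) * ev F f"
    let ?Gs = "{F. F \<in> keys \<mu> \<and> S \<subseteq> F}"
    let ?C = "(shuffle_sign \<gamma> T * \<kappa>) ^ p"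
    \<comment> \<open>For the chosen exponent \<open>W\<close> vanishes unless F contains T, so only
      the facets through all of S remain.\<close>
    have "(\<Sum>F\<in>?Fs. h (lookup \<mu> F) * w F \<epsilon>\<^sub>0 ^ p) =
      (\<Sum>F\<in>?Gs. h (lookup \<mu> F) * w F \<epsilon>\<^sub>0 ^ p)"
    proof (rule sum.mono_neutral_right)
      show "?Gs \<subseteq> ?Fs" using \<gamma>(1) by auto
      show "\<forall>F\<in>?Fs - ?Gs. h (lookup \<mu> F) * w F \<epsilon>\<^sub>0 ^ p = 0"
      proof
        fix F assume F: "F \<in> ?Fs - ?Gs"
        then have "\<not> T \<subseteq> F - \<gamma>" using S_eq by auto
        then have "w F \<epsilon>\<^sub>0 = 0" unfolding w_def using W(5)[OF G[of F]] F by simp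
        then show "h (lookup \<mu> F) * w F \<epsilon>\<^sub>0 ^ p = 0" using p2 by (simp add: zero_power)
      qed
    qed simp
    also have "\<dots> = (\<Sum>F\<in>?Gs. ?C * (h (lookup \<mu> F) * ?X F ^ p))"
    proof (rule sum.cong[OF refl])
      fix F assume F: "F \<in> ?Gs"
      then have F': "F \<in> ?Fs" "T \<subseteq> F - \<gamma>" using S_eq by auto
      have FS: "F - \<gamma> - T = F - S" using S_eq by auto
      have finF: "finite F" using facet F by auto
      \<comment> \<open>The signs of \<gamma> and of T combine to the sign of S against F - S; what
        is left over depends on \<gamma> and T only and goes into the constant.\<close>
      have "shuffle_sign \<gamma> (F - \<gamma>) = shuffle_sign \<gamma> T * (shuffle_sign \<gamma> (F - S) :: 'l)"
      proof -
        have "F - \<gamma> = T \<union> (F - S)" using F' S_eq by auto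
        then show ?thesis
          using shuffle_sign_Un_right[of T "F - S" \<gamma>] TV finF S_eq by auto
      qed
      moreover have "shuffle_sign S (F - S) = shuffle_sign \<gamma> (F - S) * (shuffle_sign T (F - S) :: 'l)"
        by (subst (1) S_eq(1)) (rule shuffle_sign_Un_left[OF fin\<gamma> TV(2) S_eq(2)])
      moreover have "W (F - \<gamma>) \<epsilon>\<^sub>0 = shuffle_sign T (F - S) * \<kappa> * vdm t (F - S)"
        using W(5)[OF G[OF F'(1)]] F'(2) by (simp add: FS)
      ultimately have "w F \<epsilon>\<^sub>0 = (shuffle_sign \<gamma> T * \<kappa>) * ?X F"
        unfolding w_def by (simp only: mult_ac)
      then show "h (lookup \<mu> F) * w F \<epsilon>\<^sub>0 ^ p = ?C * (h (lookup \<mu> F) * ?X F ^ p)"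
        by (simp only: power_mult_distrib mult_ac)
    qed
    finally have "?C * (\<Sum>F\<in>?Gs. h (lookup \<mu> F) * ?X F ^ p) = 0"
      unfolding * by (simp only: sum_distrib_left)
    moreover have "?C \<noteq> 0" using W(1) by simp
    ultimately have sum0: "(\<Sum>F\<in>?Gs. h (lookup \<mu> F) * ?X F ^ p) = 0"
      using mult_eq_0_iff by blast
    \<comment> \<open>All facets in the sum contain v, so a single constant from \<open>star\<close>
      converts their coefficients into p-th powers and makes the sum a p-th power.\<close>
    obtain v where v: "v \<in> S" using d(2) by fastforce
    obtain c where c: "c \<noteq> 0"
      "\<And>F. F \<in> keys \<mu> \<Longrightarrow> v \<in> F \<Longrightarrow> lookup \<mu> F ^ p = c * lookup \<mu> F"
      using star[OF d(1), of v] v S(1) by blast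
    have "(\<Sum>F\<in>?Gs. h (lookup \<mu> F) * ?X F) ^ p =
      (\<Sum>F\<in>?Gs. (h (lookup \<mu> F) * ?X F) ^ p)"
      by (rule freshmans_dream_sum) (use charL in auto)
    also have "\<dots> = (\<Sum>F\<in>?Gs. h c * (h (lookup \<mu> F) * ?X F ^ p))"
    proof (rule sum.cong[OF refl])
      fix F assume "F \<in> ?Gs"
      then have "lookup \<mu> F ^ p = c * lookup \<mu> F" using c(2) v by auto
      then have "h (lookup \<mu> F) ^ p = h c * h (lookup \<mu> F)"
        by (simp only: h_power[symmetric] h_mult[symmetric])
      then show "(h (lookup \<mu> F) * ?X F) ^ p = h c * (h (lookup \<mu> F) * ?X F ^ p)"
        by (simp only: power_mult_distrib mult.assoc)
    qed
    also have "\<dots> = h c * (\<Sum>F\<in>?Gs. h (lookup \<mu> F) * ?X F ^ p)"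
      by (simp only: sum_distrib_left)
    also have "\<dots> = 0" unfolding sum0 by simp
    finally have "(\<Sum>F\<in>?Gs. h (lookup \<mu> F) * ?X F) = 0" by simp
    then show ?thesis
      using phi_hom_mult_set_mon[OF f(1) S(1)] S(2) by (simp add: add.commute)
  qed
  \<comment> \<open>This space contains the multiples of the linear forms, so interpolation extends
    \<open>test\<close> to all monomials of complementary degree.\<close>
  define N where "N = {g. phi (f * g) = 0}"
  have "phi (f * mon m) = 0" if m: "keys m \<subseteq> V" for m
  proof (cases "k + mdeg m = d")
    case True
    have "mon m \<in> N"
    proof (rule monomial_mem_if_squarefree_mem[where n = d and j = "mdeg m", OF _ _ _ _ _ m refl])
      show "g + g' \<in> N" if "g \<in> N" "g' \<in> N" for g g'
        using that by (simp add: N_def distrib_left phi_add)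
      show "Const c * g \<in> N" if "g \<in> N" for c g
        using that by (simp add: N_def mult.left_commute[of f])
      show "0 \<in> N" by (simp add: N_def)
      show "theta i * mon n \<in> N" if "i \<in> {1..d}" "keys n \<subseteq> V" for i n
      proof -
        have "phi (theta i * (f * mon n)) = 0"
          using theta_I0[OF that(1)] hom_Pol[OF f(1)] that(2) by (auto simp: I0_def)
        then show ?thesis by (simp add: N_def mult_ac)
      qed
      show "mon n \<in> N" if n: "keys n \<subseteq> V" "mdeg n = mdeg m"
        "card (keys n) = mdeg m \<or> d < card (keys n)" for n
      proof -
        have c: "card (keys n) = mdeg n"
          using n card_keys_le_mdeg[of n] True by linarith
        have "phi (f * mon (set_mon (keys n))) = 0"
          by (rule test) (use n c True in auto)
        then show ?thesis using squarefree_monomial[OF c] by (simp add: N_def)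
      qed
    qed
    then show ?thesis by (simp add: N_def)
  next
    case False
    have "f * mon m \<in> hom_part (k + mdeg m)" by (intro hom_mult f hom_mon m)
    then show ?thesis using False by (intro phi_other_degree) (auto simp: hom_iff)
  qed
  then have "f \<in> I0" using hom_Pol[OF f(1)] by (simp add: I0_iff)
  then show False using f(2) by simp
qed

text \<open>For the least \<open>j\<close> with \<open>m \<le> p ^ j\<close> one has \<open>p ^ j \<le> p * m\<close>, so \<open>f ^ (p ^ j)\<close>, hence \<open>f ^ m\<close>, and finally
  \<open>(f ^ m) ^ p\<close> are outside \<open>I0\<close>.\<close>

lemma multiple_power_notin_I0:
  assumes p: "p \<ge> 2" and m: "m > 0"
    and step: "\<And>k f. p * k \<le> d \<Longrightarrow> f \<in> hom_part k \<Longrightarrow> f \<notin> I0 \<Longrightarrow> f ^ p \<notin> I0"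
    and f: "f \<in> hom_part k" "f \<notin> I0" and k: "p * m * k \<le> d"
  shows "f ^ (p * m) \<notin> I0"
proof -
  have iter: "f ^ (p ^ j) \<notin> I0" if "p ^ j * k \<le> d" for j
    using that
  proof (induction j)
    case (Suc j)
    have "1 * (p ^ j * k) \<le> p * (p ^ j * k)" using p by (intro mult_le_mono1) simp
    also have "\<dots> \<le> d" using Suc.prems by (simp add: mult.assoc)
    finally have "p ^ j * k \<le> d" by (simp only: mult_1)
    then have "f ^ (p ^ j) \<notin> I0" by (rule Suc.IH)
    then have "(f ^ (p ^ j)) ^ p \<notin> I0"
      using Suc.prems by (intro step[OF _ hom_power[OF f(1)]]) (simp_all add: mult_ac)
    then show ?case by (simp add: mult.commute flip: power_mult)
  qed (use f in simp)
  obtain j where j: "m \<le> p ^ j" "p ^ j \<le> p * m"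
  proof -
    have "m \<le> 2 ^ m" using less_exp[of m] by simp
    also have "\<dots> \<le> p ^ m" using p by (intro power_mono) auto
    finally have ex: "\<exists>j. m \<le> p ^ j" by blast
    define j where "j = (LEAST j. m \<le> p ^ j)"
    have "m \<le> p ^ j" unfolding j_def by (rule LeastI_ex[OF ex])
    moreover have "p ^ j \<le> p * m"
    proof (cases j)
      case 0
      then show ?thesis using p m by simp
    next
      case (Suc i)
      then have "\<not> m \<le> p ^ i" using not_less_Least[of i "\<lambda>j. m \<le> p ^ j"] by (simp add: j_def)
      then show ?thesis using Suc by simp
    qed
    ultimately show thesis by (rule that)
  qed
  have "p ^ j * k \<le> p * m * k" using j(2) by (rule mult_le_mono1)
  then have pj: "f ^ (p ^ j) \<notin> I0" by (intro iter le_trans[OF _ k])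
  have "f ^ m \<notin> I0"
  proof
    assume "f ^ m \<in> I0"
    then have "f ^ m * f ^ (p ^ j - m) \<in> I0" by (rule I0_mult) (use hom_Pol[OF f(1)] in auto)
    then show False using pj j(1) by (simp flip: power_add)
  qed
  then have "(f ^ m) ^ p \<notin> I0"
    using k by (intro step[OF _ hom_power[OF f(1)]]) (simp_all add: mult_ac)
  then show ?thesis by (simp add: mult.commute flip: power_mult)
qed

end

section \<open>Choice of the field and of the parameters\<close>

theorem theorem1p1:
  fixes p m d :: nat and \<mu> :: "'v::linorder set \<Rightarrow>\<^sub>0 'k::field"
  assumes "prime p" and "CHAR('k) = p" and "m > 0"
    and "simplicial_cycle (int d - 1) \<mu>"
    and "\<And>\<tau>. \<tau> \<in> chain_support \<mu> \<Longrightarrow> 0 < card \<tau> \<Longrightarrow> card \<tau> < d \<Longrightarrow>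
      linearly_isomorphic
        (reduced_homology (link \<tau> (chain_support \<mu>)) (int d - 1 - int (card \<tau>)) ::
          ('k, ('v set \<Rightarrow>\<^sub>0 'k) set) module)
        scalar_module"
  shows "\<exists>(K :: 'k universal_domain set) a.
    is_extension_field K \<and>
    is_lsop K (chain_support \<mu>) d a \<and>
    anisotropic (p * m) to_universal K d \<mu> a \<and>
    (\<exists>t. (\<forall>v \<in> \<Union>(chain_support \<mu>). t v \<in> K) \<and>
      (\<forall>i \<in> {1..d}. \<forall>v \<in> \<Union>(chain_support \<mu>). a i v = t v ^ i))"
proof -
  let ?V = "\<Union>(chain_support \<mu>)"
  let ?K = "rational_functions :: 'k universal_domain set"
  have finV: "finite ?V"
  proof -
    have "?V = \<Union>(keys \<mu>)" by (auto simp: chain_support_def)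
    moreover have "finite F" if "F \<in> keys \<mu>" for F
      using assms(4) that by (auto simp: simplicial_cycle_def chains_def)
    ultimately show ?thesis by simp
  qed
  \<comment> \<open>Distinct vertices receive distinct variables of the universal domain; these
    variables are the parameters \<open>t v\<close>.\<close>
  obtain e :: "'v \<Rightarrow> nat" where e: "inj_on e ?V"
    using finite_imp_inj_to_nat_seg[OF finV] by blast
  define t where "t v = (iota (Poly_Mapping.single (Poly_Mapping.single (e v) 1) 1) :: 'k universal_domain)" for v
  interpret moment_lsop ?K to_universal \<mu> d t "\<lambda>i v. t v ^ i"
  proof
    show "to_universal 0 = (0 :: 'k universal_domain)" "to_universal 1 = (1 :: 'k universal_domain)"
      by (simp_all add: to_universal_eq)
    show "to_universal (a + b) = to_universal a + to_universal b"
      "to_universal (a * b) = to_universal a * to_universal b" for a b :: 'k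
      by (simp_all add: to_universal_eq single_add mult_single flip: iota_simps)
    show "to_universal a \<in> ?K" for a :: 'k
      unfolding to_universal_eq by (rule iota_rational)
    show "inj_on t ?V"
    proof (rule inj_onI)
      fix v w assume vw: "v \<in> ?V" "w \<in> ?V" "t v = t w"
      let ?x = "\<lambda>v. Poly_Mapping.single (Poly_Mapping.single (e v) 1) 1 :: (nat \<Rightarrow>\<^sub>0 nat) \<Rightarrow>\<^sub>0 'k"
      have "iota (?x v + - ?x w) = 0" using vw(3) unfolding t_def iota_simps by simp
      then have "?x v = ?x w" unfolding iota_eq_0_iff by simp
      then have "lookup (?x v) (Poly_Mapping.single (e w) 1) \<noteq> 0" by simp
      then have "Poly_Mapping.single (e v) (1::nat) = Poly_Mapping.single (e w) 1"
        by (simp add: lookup_single when_def split: if_splits)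
      then have "keys (Poly_Mapping.single (e v) (1::nat)) = keys (Poly_Mapping.single (e w) (1::nat))"
        by (rule arg_cong)
      then have "e v = e w" by simp
      then show "v = w" using e vw by (auto dest: inj_onD)
    qed
    show "t v \<in> ?K" for v unfolding t_def by (rule iota_rational)
    show "t v \<noteq> 0" for v
    proof -
      have "lookup (Poly_Mapping.single (Poly_Mapping.single (e v) 1) (1 :: 'k)) (Poly_Mapping.single (e v) 1) \<noteq> 0"
        by simp
      then show ?thesis unfolding t_def iota_eq_0_iff by (metis lookup_zero)
    qed
  qed (use assms in auto)
  have step: "f ^ p \<notin> I0" if "p * k \<le> d" "f \<in> hom_part k" "f \<notin> I0" for k f
  proof (rule power_notin_I0[OF assms(1,2) _ _ that(2,3,1)])
    show "(\<Sum>F\<in>Fs. to_universal (c F) * w F \<epsilon>\<^sub>0 ^ p) = 0"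
      if "finite Fs" "\<And>F \<epsilon>. F \<in> Fs \<Longrightarrow> \<epsilon> \<in> V \<rightarrow>\<^sub>E {..<p} \<Longrightarrow> w F \<epsilon> \<in> ?K"
        "(\<Sum>\<epsilon> \<in> V \<rightarrow>\<^sub>E {..<p}. (\<Prod>v\<in>V. t v ^ \<epsilon> v) * (\<Sum>F\<in>Fs. to_universal (c F) * w F \<epsilon> ^ p)) = 0"
        "\<epsilon>\<^sub>0 \<in> V \<rightarrow>\<^sub>E {..<p}"
      for Fs :: "'v set set" and c w \<epsilon>\<^sub>0
    proof (rule p_basis_independence[OF assms(1,2) finite_V _ that(1,2) _ that(4)])
      show "inj_on e V" using e by (simp add: V_def \<Delta>_def)
    qed (use that(3) in \<open>simp_all only: t_def\<close>)
    \<comment> \<open>For d at least 2 a vertex is a face of size 1 < d, so the homology hypothesis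
      applies to its link, in degree d - 1 - 1.\<close>
    show "\<exists>c. c \<noteq> 0 \<and> (\<forall>F \<in> keys \<mu>. v \<in> F \<longrightarrow> lookup \<mu> F ^ p = c * lookup \<mu> F)"
      if d: "d \<ge> 2" and v: "v \<in> V" for v
    proof -
      have v': "v \<in> ?V" using v by (simp add: V_def \<Delta>_def)
      then have "{v} \<in> chain_support \<mu>" by (auto simp: chain_support_def)
      then have "linearly_isomorphic
          (reduced_homology (link {v} (chain_support \<mu>)) (int d - 2) :: ('k, ('v set \<Rightarrow>\<^sub>0 'k) set) module)
          scalar_module"
        using assms(5)[of "{v}"] d by simp
      then show ?thesis
        by (rule cycle_frobenius_on_star[OF assms(1,2,4) v']) blast
    qed
  qed
  have "anisotropic (p * m) to_universal ?K d \<mu> (\<lambda>i v. t v ^ i)"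
  proof (rule anisotropicI)
    show "p * m > 0" using assms(1,3) prime_gt_0_nat by simp
    show "f ^ (p * m) \<notin> I0" if "p * m * k \<le> d" "f \<in> hom_part k" "f \<notin> I0" for k f
      by (rule multiple_power_notin_I0[OF _ assms(3) step that(2,3,1)])
        (use assms(1) prime_ge_2_nat in auto)
  qed
  moreover have "is_extension_field ?K"
    using subfield_K h_K by (auto simp: is_extension_field_def)
  moreover have "is_lsop ?K (chain_support \<mu>) d (\<lambda>i v. t v ^ i)"
    using is_lsop by (simp add: \<Delta>_def)
  ultimately show ?thesis
    using t_K by (intro exI[of _ ?K] exI[of _ "\<lambda>i v. t v ^ i"] conjI exI[of _ t]) auto
qed

end
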